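(* Let $X_0$ be an $H$-valued random variable and let $W^Q$ be a $Q$-Wiener process independent of $X_0$, with trace class operator $Q$ and Karhunen–Loève decomposition $W^Q_t=\sum_{k\in\mathbb N}\sqrt{\lambda_k}\,\beta_k(t)\,e_k$, and let $W^{Q_n}_t=\sum_{k=1}^n\sqrt{\lambda_k}\,\beta_k(t)\,e_k$ be its truncation. Let $(X_t)_{t\in[0,T]}$ be the (unique strong) solution of $$\mathrm dX_t=-\tfrac12\alpha_tX_t\,\mathrm dt+\sqrt{\alpha_t}\,\mathrm dW_t^Q$$ with initial value $X_0$, and let $(X_t^n)_{t\in[0,T]}$ be the (unique strong) solution of $$\mathrm dX_t^n=-\tfrac12\alpha_tX_t^n\,\mathrm dt+\sqrt{\alpha_t}\,\mathrm dW_t^{Q_n}$$ with initial value $X_0^n=\sum_{k=1}^n\langle X_0,e_k\rangle e_k$. Then $$\mathbb E\big[\lVert X_t-X_t^n\rVert^2\big]\le 2\,a_t^{-2}\,\mathbb E\big[\lVert X_0-X_0^n\rVert^2\big]+2\,(1-a_t^{-2})\,\mathrm{tr}(Q-Q_n),\qquad t\in[0,T],$$ and $$\mathbb E\Big[\sup_{t\in[0,T]}\lVert X_t-X_t^n\rVert^2\Big]\le 2\,\mathbb E\big[\lVert X_0-X_0^n\rVert^2\big]+8\,(a_T^2-1)\,\mathrm{tr}(Q-Q_n).$$ If $\mathbb E[\lVert X_0\rVert^2]<\infty$, then $\mathbb E\big[\sup_{t\in[0,T]}\lVert X_t-X_t^n\rVert^2\big]\to0$ as $n\to\infty$.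
   Context: $(H,\lVert\cdot\rVert)$ is a real separable Hilbert space, $T>0$, $\alpha\in\mathcal C^1([0,T];\mathbb R_{>0})$, and $a_t:=e^{\frac12\int_0^t\alpha_r\,\mathrm dr}$. A trace class operator $Q$ is a bounded self-adjoint positive semidefinite operator on $H$ with finite trace; $(e_k)_{k\in\mathbb N}$ is an orthonormal basis of $H$ of eigenvectors of $Q$ with eigenvalues $(\lambda_k)_{k\in\mathbb N}$. A $Q$-Wiener process is a continuous $H$-valued process $W^Q$ with $W^Q_0=0$, independent increments and $W^Q_t-W^Q_s\sim\mathcal N(0,(t-s)Q)$; the $\beta_k$ in its Karhunen–Loève decomposition are mutually independent standard real Brownian motions, and the series converges in $L^2(\Omega;\mathcal C([0,T],H))$. Put $Q_n:=\sum_{k=1}^n\lambda_k\langle e_k,\cdot\rangle e_k$. A strong solution with initial value $X_0$ is a process with continuous paths, adapted to the smallest complete filtration for which $X_0$ is $\mathcal F_0$-measurable and the driving Wiener process is adapted, satisfying the integrated SDE almost surely for all $t\in[0,T]$. *)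

theory Defs
  imports "HOL-Probability.Probability"
begin

text \<open>
  A real separable Hilbert space is a type of sort
  \<open>{real_inner, banach, second_countable_topology}\<close>.
  Expectations of nonnegative quantities are taken in \<open>[0,\<infinity>]\<close> (nonnegative integrals),
  so that no integrability is implicitly required. Properties of paths are required almost surely.
\<close>

subsection \<open>Trace class operators\<close>

definition orthonormal_basis :: "'h::real_inner set \<Rightarrow> bool" where
  "orthonormal_basis B \<longleftrightarrow>
     pairwise orthogonal B \<and> (\<forall>b\<in>B. norm b = 1) \<and> closure (span B) = UNIV"

definition trace_class :: "('h::real_inner \<Rightarrow> 'h) \<Rightarrow> bool" where
  "trace_class Q \<longleftrightarrow>
     bounded_linear Q \<and> (\<forall>x y. Q x \<bullet> y = x \<bullet> Q y) \<and> (\<forall>x. 0 \<le> Q x \<bullet> x) \<and>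
     (\<forall>B. orthonormal_basis B \<longrightarrow> (\<lambda>b. Q b \<bullet> b) summable_on B)"

definition op_trace :: "('h::real_inner \<Rightarrow> 'h) \<Rightarrow> real" where
  "op_trace Q = (THE \<tau>. \<forall>B. orthonormal_basis B \<longrightarrow> ((\<lambda>b. Q b \<bullet> b) has_sum \<tau>) B)"

definition truncated_op :: "(nat \<Rightarrow> real) \<Rightarrow> (nat \<Rightarrow> 'h::real_inner) \<Rightarrow> nat \<Rightarrow> 'h \<Rightarrow> 'h" where
  "truncated_op lam e n x = (\<Sum>k<n. lam k *\<^sub>R (e k \<bullet> x) *\<^sub>R e k)"


subsection \<open>Gaussian laws and Wiener processes\<close>

text \<open>The centred normal law on the reals with variance \<open>v\<close>, including the degenerate case.\<close>

definition real_normal :: "real \<Rightarrow> real measure" where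
  "real_normal v =
     (if v = 0 then return borel 0 else density lborel (\<lambda>x. ennreal (normal_density 0 (sqrt v) x)))"

definition centered_gaussian ::
    "'w measure \<Rightarrow> ('h::real_inner \<Rightarrow> 'h) \<Rightarrow> ('w \<Rightarrow> 'h) \<Rightarrow> bool" where
  "centered_gaussian M C Y \<longleftrightarrow>
     Y \<in> borel_measurable M \<and>
     (\<forall>h. distr M borel (\<lambda>\<omega>. h \<bullet> Y \<omega>) = real_normal (C h \<bullet> h))"

definition wiener_process ::
    "'w measure \<Rightarrow> real \<Rightarrow> ('h::real_inner \<Rightarrow> 'h) \<Rightarrow> (real \<Rightarrow> 'w \<Rightarrow> 'h) \<Rightarrow> bool" where
  "wiener_process M T Q W \<longleftrightarrow>
     (\<forall>t\<in>{0..T}. W t \<in> borel_measurable M) \<and>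
     (AE \<omega> in M. W 0 \<omega> = 0) \<and>
     (AE \<omega> in M. continuous_on {0..T} (\<lambda>t. W t \<omega>)) \<and>
     (\<forall>(\<tau>::nat \<Rightarrow> real) m. mono \<tau> \<and> range \<tau> \<subseteq> {0..T} \<longrightarrow>
        prob_space.indep_vars M (\<lambda>_. borel) (\<lambda>i \<omega>. W (\<tau> (Suc i)) \<omega> - W (\<tau> i) \<omega>) {..<m}) \<and>
     (\<forall>s t. 0 \<le> s \<and> s \<le> t \<and> t \<le> T \<longrightarrow>
        centered_gaussian M (\<lambda>x. (t - s) *\<^sub>R Q x) (\<lambda>\<omega>. W t \<omega> - W s \<omega>))"

text \<open>Standard Brownian motion on \<open>[0,T]\<close> is the real Wiener process with covariance \<open>id\<close>.\<close>

abbreviation brownian_motion :: "'w measure \<Rightarrow> real \<Rightarrow> (real \<Rightarrow> 'w \<Rightarrow> real) \<Rightarrow> bool" where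
  "brownian_motion M T b \<equiv> wiener_process M T id b"

text \<open>A process on \<open>[0,T]\<close> as a single random variable, with values in the product space.\<close>

definition sample_path :: "real \<Rightarrow> (real \<Rightarrow> 'w \<Rightarrow> 'h) \<Rightarrow> 'w \<Rightarrow> (real \<Rightarrow> 'h)" where
  "sample_path T X \<omega> = (\<lambda>t\<in>{0..T}. X t \<omega>)"

text \<open>
  Independence of two random variables with different value types (\<open>prob_space.indep_var\<close> requires
  equal ones).
\<close>

definition independent_rvs ::
    "'w measure \<Rightarrow> 'b measure \<Rightarrow> ('w \<Rightarrow> 'b) \<Rightarrow> 'c measure \<Rightarrow> ('w \<Rightarrow> 'c) \<Rightarrow> bool" where
  "independent_rvs M N Y N' Y' \<longleftrightarrow>
     Y \<in> measurable M N \<and> Y' \<in> measurable M N' \<and>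
     prob_space.indep_set M
       {Y -` A \<inter> space M | A. A \<in> sets N} {Y' -` A \<inter> space M | A. A \<in> sets N'}"

definition kl_partial_sum ::
    "(nat \<Rightarrow> real) \<Rightarrow> (nat \<Rightarrow> real \<Rightarrow> 'w \<Rightarrow> real) \<Rightarrow> (nat \<Rightarrow> 'h::real_vector) \<Rightarrow> nat \<Rightarrow> real \<Rightarrow> 'w \<Rightarrow> 'h"
  where "kl_partial_sum lam \<beta> e n t \<omega> = (\<Sum>k<n. (sqrt (lam k) * \<beta> k t \<omega>) *\<^sub>R e k)"

definition karhunen_loeve ::
    "'w measure \<Rightarrow> real \<Rightarrow> (nat \<Rightarrow> real) \<Rightarrow> (nat \<Rightarrow> real \<Rightarrow> 'w \<Rightarrow> real) \<Rightarrow> (nat \<Rightarrow> 'h::real_normed_vector) \<Rightarrow>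
     (real \<Rightarrow> 'w \<Rightarrow> 'h) \<Rightarrow> bool" where
  "karhunen_loeve M T lam \<beta> e W \<longleftrightarrow>
     (\<forall>k. brownian_motion M T (\<beta> k)) \<and>
     prob_space.indep_vars M (\<lambda>_. PiM {0..T} (\<lambda>_. borel)) (\<lambda>k. sample_path T (\<beta> k)) UNIV \<and>
     (\<lambda>n. \<integral>\<^sup>+\<omega>. (SUP t\<in>{0..T}. ennreal ((norm (W t \<omega> - kl_partial_sum lam \<beta> e n t \<omega>))\<^sup>2)) \<partial>M)
       \<longlonglongrightarrow> 0"


subsection \<open>The Ito integral\<close>

text \<open>
  The smallest complete filtration for which \<open>\<xi>\<close> is measurable at time \<open>0\<close> and \<open>W\<close> is adapted.
  The measure space \<open>M\<close> itself need not be complete, so completeness refers to its completion.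
\<close>

definition driving_filtration ::
    "'w measure \<Rightarrow> ('w \<Rightarrow> 'h::topological_space) \<Rightarrow> (real \<Rightarrow> 'w \<Rightarrow> 'h) \<Rightarrow> real \<Rightarrow> 'w measure" where
  "driving_filtration M \<xi> W t = sigma (space M)
     ({\<xi> -` A \<inter> space M | A. A \<in> sets borel} \<union>
      {W s -` A \<inter> space M | s A. 0 \<le> s \<and> s \<le> t \<and> A \<in> sets borel} \<union>
      null_sets (completion M))"

text \<open>
  A list of triples \<open>(s, u, \<phi>)\<close> represents the elementary process \<open>\<Sum> \<phi> 1\<^bsub>(s,u]\<^esub>\<close>;
  the intervals may overlap.
\<close>

type_synonym 'w elementary = "(real \<times> real \<times> ('w \<Rightarrow> real)) list"

definition is_elementary ::
    "'w measure \<Rightarrow> (real \<Rightarrow> 'w measure) \<Rightarrow> real \<Rightarrow> 'w elementary \<Rightarrow> bool" where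
  "is_elementary M F T E \<longleftrightarrow>
     (\<forall>(s, u, \<phi>)\<in>set E. 0 \<le> s \<and> s \<le> u \<and> u \<le> T \<and> \<phi> \<in> borel_measurable (F s) \<and>
        (\<exists>c. \<forall>\<omega>\<in>space M. \<bar>\<phi> \<omega>\<bar> \<le> c))"

definition elementary_process :: "'w elementary \<Rightarrow> real \<Rightarrow> 'w \<Rightarrow> real" where
  "elementary_process E t \<omega> = (\<Sum>(s, u, \<phi>)\<leftarrow>E. \<phi> \<omega> * indicator {s<..u} t)"

definition elementary_integral ::
    "'w elementary \<Rightarrow> (real \<Rightarrow> 'w \<Rightarrow> 'h::real_vector) \<Rightarrow> real \<Rightarrow> 'w \<Rightarrow> 'h" where
  "elementary_integral E W t \<omega> =
     (\<Sum>(s, u, \<phi>)\<leftarrow>E. \<phi> \<omega> *\<^sub>R (W (min u t) \<omega> - W (min s t) \<omega>))"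

text \<open>
  \<open>I\<close> is a continuous adapted version of \<open>\<integral>\<^sub>0\<^sup>t \<Phi>\<^sub>s dW\<^sub>s\<close>, \<open>t \<in> [0,T]\<close>, for a scalar integrand \<open>\<Phi>\<close>
  (acting on the Hilbert space as \<open>\<Phi>\<close> times the identity): the isometric extension from
  elementary processes.
\<close>

definition is_ito_integral ::
    "'w measure \<Rightarrow> (real \<Rightarrow> 'w measure) \<Rightarrow> real \<Rightarrow> (real \<Rightarrow> 'w \<Rightarrow> 'h::real_normed_vector) \<Rightarrow>
     (real \<Rightarrow> 'w \<Rightarrow> real) \<Rightarrow> (real \<Rightarrow> 'w \<Rightarrow> 'h) \<Rightarrow> bool" where
  "is_ito_integral M F T W \<Phi> I \<longleftrightarrow>
     (\<lambda>(t, \<omega>). \<Phi> t \<omega>) \<in> borel_measurable (restrict_space borel {0..T} \<Otimes>\<^sub>M completion M) \<and>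
     (\<forall>t\<in>{0..T}. \<Phi> t \<in> borel_measurable (F t)) \<and>
     (\<forall>t\<in>{0..T}. I t \<in> borel_measurable (F t)) \<and>
     (AE \<omega> in M. continuous_on {0..T} (\<lambda>t. I t \<omega>)) \<and>
     (\<exists>E. (\<forall>m. is_elementary M F T (E m)) \<and>
        (\<lambda>m. \<integral>\<^sup>+\<omega>. (\<integral>\<^sup>+t\<in>{0..T}. ennreal ((\<Phi> t \<omega> - elementary_process (E m) t \<omega>)\<^sup>2) \<partial>lborel) \<partial>M)
          \<longlonglongrightarrow> 0 \<and>
        (\<forall>t\<in>{0..T}.
          (\<lambda>m. \<integral>\<^sup>+\<omega>. ennreal ((norm (I t \<omega> - elementary_integral (E m) W t \<omega>))\<^sup>2) \<partial>M)
            \<longlonglongrightarrow> 0))"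


subsection \<open>The stochastic differential equation\<close>

definition positive_C1_on :: "real \<Rightarrow> (real \<Rightarrow> real) \<Rightarrow> bool" where
  "positive_C1_on T \<alpha> \<longleftrightarrow>
     (\<forall>t\<in>{0..T}. 0 < \<alpha> t) \<and>
     (\<exists>\<alpha>'. continuous_on {0..T} \<alpha>' \<and>
        (\<forall>t\<in>{0..T}. (\<alpha> has_real_derivative \<alpha>' t) (at t within {0..T})))"

definition a_coeff :: "(real \<Rightarrow> real) \<Rightarrow> real \<Rightarrow> real" where
  "a_coeff \<alpha> t = exp (1/2 * (LBINT r:{0..t}. \<alpha> r))"

text \<open>Strong solutions of \<open>dX\<^sub>t = - 1/2 \<alpha>\<^sub>t X\<^sub>t dt + sqrt \<alpha>\<^sub>t dW\<^sub>t\<close> on \<open>[0,T]\<close> with initial value \<open>\<xi>\<close>.\<close>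

definition strong_solution ::
    "'w measure \<Rightarrow> real \<Rightarrow> (real \<Rightarrow> real) \<Rightarrow>
     (real \<Rightarrow> 'w \<Rightarrow> 'h::{real_inner, banach, second_countable_topology}) \<Rightarrow>
     ('w \<Rightarrow> 'h) \<Rightarrow> (real \<Rightarrow> 'w \<Rightarrow> 'h) \<Rightarrow> bool" where
  "strong_solution M T \<alpha> W \<xi> X \<longleftrightarrow>
     (AE \<omega> in M. continuous_on {0..T} (\<lambda>t. X t \<omega>)) \<and>
     (\<forall>t\<in>{0..T}. X t \<in> borel_measurable (driving_filtration M \<xi> W t)) \<and>
     (AE \<omega> in M. X 0 \<omega> = \<xi> \<omega>) \<and>
     (\<exists>I. is_ito_integral M (driving_filtration M \<xi> W) T W (\<lambda>t _. sqrt (\<alpha> t)) I \<and>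
        (AE \<omega> in M. \<forall>t\<in>{0..T}.
           X t \<omega> = X 0 \<omega> + (LBINT s:{0..t}. (- (1/2) * \<alpha> s) *\<^sub>R X s \<omega>) + I t \<omega>))"

end

theory Submission
  imports Defs
begin

text \<open>
  Both equations are solved componentwise along the eigenvectors. The Ito isometry for adapted
  elementary integrands identifies the Ito integral of the smooth function \<open>sqrt \<alpha>\<close> with the pathwise
  expression obtained by partial integration, so variation of constants gives
  \<open>a\<^sub>t \<langle>X\<^sub>t, e\<^sub>k\<rangle> = \<langle>X\<^sub>0, e\<^sub>k\<rangle> + N\<^sub>k(t)\<close> with \<open>N\<^sub>k(t) = \<integral>\<^sub>0\<^sup>t a sqrt \<alpha> d\<langle>W, e\<^sub>k\<rangle>\<close>, for all \<open>t\<close> almost surely.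
  The truncated solution has the same components for \<open>k < n\<close> and vanishing ones for \<open>k \<ge> n\<close>, since
  the Karhunen--Loeve expansion forces \<open>\<langle>W, e\<^sub>k\<rangle> = sqrt \<lambda>\<^sub>k \<beta>\<^sub>k\<close>. As \<open>(a\<^sup>2)' = \<alpha> a\<^sup>2\<close>, the second moment of
  \<open>N\<^sub>k(t)\<close> is at most \<open>\<lambda>\<^sub>k (a\<^sub>t\<^sup>2 - 1)\<close>, Doob's inequality costs a factor 4 for the supremum, and summing
  over \<open>k \<ge> n\<close> produces \<open>tr (Q - Q\<^sub>n)\<close>.
\<close>

subsection \<open>Riemann--Stieltjes sums\<close>

text \<open>The stochastic integral is given only through some sequence of adapted elementary
  processes, and each equation brings its own filtration. All equations are therefore read in the
  single filtration of \<open>X0\<close> and \<open>W\<close> on the completion of \<open>M\<close>,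
  where one isometry serves the full and the truncated noise. The integrands are deterministic and
  continuously differentiable in time, so integration by parts gives the integrals a pathwise
  meaning for all \<open>t\<close> at once, in which the noise enters only through continuous paths.
  Second moments reach these pathwise integrals by Fatou's lemma along Riemann-Stieltjes sums. This
  yields upper bounds together with measurable majorants, so measurability of a supremum over
  uncountably many times does not come up. The factor 2 in both estimates stems from
  \<open>(u + v)\<^sup>2 \<le> 2 * u\<^sup>2 + 2 * v\<^sup>2\<close> for initial value and noise.
  Division by \<open>(a t)\<^sup>2\<close> turns \<open>(a t)\<^sup>2 - 1\<close> into
  \<open>1 - 1 / (a t)\<^sup>2\<close>; for the supremum \<open>1 / (a t)\<^sup>2\<close> is bounded
  by 1, and 2 times Doob's 4 gives 8.\<close>

definition grid :: "real \<Rightarrow> nat \<Rightarrow> nat \<Rightarrow> real" where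
  "grid T m i = T * real i / real (Suc m)"

lemma grid_0 [simp]: "grid T m 0 = 0"
  and grid_last [simp]: "grid T m (Suc m) = T"
  by (simp_all add: grid_def del: of_nat_Suc)

lemma grid_mono: "0 \<le> T \<Longrightarrow> i \<le> j \<Longrightarrow> grid T m i \<le> grid T m j"
  unfolding grid_def by (intro divide_right_mono mult_left_mono) auto

lemma grid_nonneg: "0 \<le> T \<Longrightarrow> 0 \<le> grid T m i"
  unfolding grid_def by simp

lemma grid_le: "0 \<le> T \<Longrightarrow> i \<le> Suc m \<Longrightarrow> grid T m i \<le> T"
  using grid_mono[of T i "Suc m" m] by simp

lemma grid_step: "grid T m (Suc i) - grid T m i = T / real (Suc m)"
  unfolding grid_def by (simp add: diff_divide_distrib[symmetric] algebra_simps)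

text \<open>\<open>g d - g c\<close> is the integral of \<open>g'\<close>, so the difference is the
  integral of \<open>g' s * (v - w s)\<close>. Only \<open>g\<close> is differentiated;
  \<open>w\<close> stands for a path that is merely continuous.\<close>

lemma stieltjes_cell_const:
  fixes g g' w :: "real \<Rightarrow> real"
  assumes "c \<le> d"
    and deriv: "\<And>s. s \<in> {c..d} \<Longrightarrow> (g has_real_derivative g' s) (at s within {c..d})"
    and cont: "continuous_on {c..d} g'" "continuous_on {c..d} w"
    and bound: "\<And>s. s \<in> {c..d} \<Longrightarrow> \<bar>g' s\<bar> \<le> B" "\<And>s. s \<in> {c..d} \<Longrightarrow> \<bar>v - w s\<bar> \<le> \<epsilon>"
    and "0 \<le> B" "0 \<le> \<epsilon>"
  shows "\<bar>(g d - g c) * v - integral {c..d} (\<lambda>s. g' s * w s)\<bar> \<le> B * \<epsilon> * (d - c)"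
proof -
  have "(g' has_integral (g d - g c)) {c..d}"
    using assms by (intro fundamental_theorem_of_calculus)
      (auto simp: has_real_derivative_iff_has_vector_derivative[symmetric])
  then have "((\<lambda>s. g' s * v) has_integral (g d - g c) * v) {c..d}"
    by (rule has_integral_mult_left)
  moreover have "((\<lambda>s. g' s * w s) has_integral integral {c..d} (\<lambda>s. g' s * w s)) {c..d}"
    by (intro integrable_integral integrable_continuous_real continuous_intros cont)
  ultimately have "((\<lambda>s. g' s * v - g' s * w s) has_integral
      (g d - g c) * v - integral {c..d} (\<lambda>s. g' s * w s)) {c..d}"
    by (rule has_integral_diff)
  moreover have "norm (g' s * v - g' s * w s) \<le> B * \<epsilon>" if "s \<in> {c..d}" for s
    using mult_mono[OF bound(1)[OF that] bound(2)[OF that] \<open>0 \<le> B\<close>]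
    by (simp add: right_diff_distrib[symmetric] abs_mult)
  ultimately have "norm ((g d - g c) * v - integral {c..d} (\<lambda>s. g' s * w s)) \<le> B * \<epsilon> * Henstock_Kurzweil_Integration.content {c..d}"
    using \<open>0 \<le> B\<close> \<open>0 \<le> \<epsilon>\<close> by (intro has_integral_bound_real[where S="{}"]) auto
  then show ?thesis using \<open>c \<le> d\<close> by simp
qed

text \<open>Summation by parts at the node:
  \<open>g r * w r - g p * w p - g \<xi> * (w r - w p)\<close> equals
  \<open>(g r - g \<xi>) * w r + (g \<xi> - g p) * w p\<close>, and each of the two pieces is a cell
  with \<open>w\<close> frozen at an endpoint.\<close>

lemma stieltjes_cell:
  fixes g g' w :: "real \<Rightarrow> real"
  assumes \<xi>: "p \<le> \<xi>" "\<xi> \<le> r"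
    and deriv: "\<And>s. s \<in> {p..r} \<Longrightarrow> (g has_real_derivative g' s) (at s within {p..r})"
    and cont: "continuous_on {p..r} g'" "continuous_on {p..r} w"
    and bound: "\<And>s. s \<in> {p..r} \<Longrightarrow> \<bar>g' s\<bar> \<le> B"
      "\<And>s s'. s \<in> {p..r} \<Longrightarrow> s' \<in> {p..r} \<Longrightarrow> \<bar>w s - w s'\<bar> \<le> \<epsilon>"
    and "0 \<le> B" "0 \<le> \<epsilon>"
  shows "\<bar>g r * w r - g p * w p - g \<xi> * (w r - w p) - integral {p..r} (\<lambda>s. g' s * w s)\<bar>
    \<le> B * \<epsilon> * (r - p)"
proof -
  have "\<bar>(g r - g \<xi>) * w r - integral {\<xi>..r} (\<lambda>s. g' s * w s)\<bar> \<le> B * \<epsilon> * (r - \<xi>)"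
  proof (rule stieltjes_cell_const)
    show "(g has_real_derivative g' s) (at s within {\<xi>..r})" if "s \<in> {\<xi>..r}" for s
      by (rule DERIV_subset[OF deriv]) (use \<xi> that in auto)
  qed (use assms in \<open>auto intro: continuous_on_subset\<close>)
  moreover have "\<bar>(g \<xi> - g p) * w p - integral {p..\<xi>} (\<lambda>s. g' s * w s)\<bar> \<le> B * \<epsilon> * (\<xi> - p)"
  proof (rule stieltjes_cell_const)
    show "(g has_real_derivative g' s) (at s within {p..\<xi>})" if "s \<in> {p..\<xi>}" for s
      by (rule DERIV_subset[OF deriv]) (use \<xi> that in auto)
  qed (use assms in \<open>auto intro: continuous_on_subset\<close>)
  moreover have "integral {p..\<xi>} (\<lambda>s. g' s * w s) + integral {\<xi>..r} (\<lambda>s. g' s * w s)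
      = integral {p..r} (\<lambda>s. g' s * w s)"
    by (intro Henstock_Kurzweil_Integration.integral_combine integrable_continuous_real
        continuous_intros cont \<xi>)
  ultimately show ?thesis by (simp add: algebra_simps)
qed

lemma stieltjes_sum_bound:
  fixes g g' w :: "real \<Rightarrow> real"
  assumes mono: "mono p" and p0: "p 0 = 0" and pj: "p j \<le> T"
    and \<xi>: "\<And>i. i < j \<Longrightarrow> p i \<le> \<xi> i \<and> \<xi> i \<le> p (Suc i)"
    and deriv: "\<And>s. s \<in> {0..T} \<Longrightarrow> (g has_real_derivative g' s) (at s within {0..T})"
    and cont: "continuous_on {0..T} g'" "continuous_on {0..T} w"
    and bound: "\<And>s. s \<in> {0..T} \<Longrightarrow> \<bar>g' s\<bar> \<le> B"
      "\<And>i s s'. i < j \<Longrightarrow> s \<in> {p i..p (Suc i)} \<Longrightarrow> s' \<in> {p i..p (Suc i)} \<Longrightarrow> \<bar>w s - w s'\<bar> \<le> \<epsilon>"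
    and "0 \<le> B" "0 \<le> \<epsilon>"
  shows "\<bar>g (p j) * w (p j) - g 0 * w 0 - (\<Sum>i<j. g (\<xi> i) * (w (p (Suc i)) - w (p i)))
      - integral {0..p j} (\<lambda>s. g' s * w s)\<bar> \<le> B * \<epsilon> * p j"
  using pj \<xi> bound(2)
proof (induction j)
  case 0
  then show ?case by (simp add: p0)
next
  case (Suc j)
  have le: "p j \<le> p (Suc j)" "0 \<le> p j" using mono p0 by (auto simp: mono_def) (metis le0 p0)
  then have sub: "{p j..p (Suc j)} \<subseteq> {0..T}" "{0..p (Suc j)} \<subseteq> {0..T}" using Suc.prems(1) by auto
  have "\<bar>g (p j) * w (p j) - g 0 * w 0 - (\<Sum>i<j. g (\<xi> i) * (w (p (Suc i)) - w (p i)))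
      - integral {0..p j} (\<lambda>s. g' s * w s)\<bar> \<le> B * \<epsilon> * p j"
  proof (rule Suc.IH)
    show "\<bar>w s - w s'\<bar> \<le> \<epsilon>" if "i < j" "s \<in> {p i..p (Suc i)}" "s' \<in> {p i..p (Suc i)}" for i s s'
      using Suc.prems(3)[of i s s'] that by simp
  qed (use Suc.prems le in auto)
  moreover have "\<bar>g (p (Suc j)) * w (p (Suc j)) - g (p j) * w (p j)
      - g (\<xi> j) * (w (p (Suc j)) - w (p j)) - integral {p j..p (Suc j)} (\<lambda>s. g' s * w s)\<bar>
      \<le> B * \<epsilon> * (p (Suc j) - p j)"
  proof (rule stieltjes_cell)
    show "(g has_real_derivative g' s) (at s within {p j..p (Suc j)})" if "s \<in> {p j..p (Suc j)}" for s
      by (rule DERIV_subset[OF deriv]) (use sub that in auto)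
    show "continuous_on {p j..p (Suc j)} g'" "continuous_on {p j..p (Suc j)} w"
      using cont sub by (blast intro: continuous_on_subset)+
  qed (use Suc.prems sub bound assms(10,11) in auto)
  moreover have "integral {0..p j} (\<lambda>s. g' s * w s) + integral {p j..p (Suc j)} (\<lambda>s. g' s * w s)
      = integral {0..p (Suc j)} (\<lambda>s. g' s * w s)"
    by (intro Henstock_Kurzweil_Integration.integral_combine integrable_continuous_real
        continuous_intros le continuous_on_subset[OF cont(1) sub(2)] continuous_on_subset[OF cont(2) sub(2)])
  ultimately show ?case by (simp add: algebra_simps)
qed

text \<open>The nodes are arbitrary because two choices occur: left endpoints for the Ito integral,
  mean value points for the second moments. The sums stop at a grid point near \<open>t\<close>;
  continuity of the limit in \<open>t\<close> absorbs the gap.\<close>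

lemma stieltjes_sums_tendsto:
  fixes g g' w :: "real \<Rightarrow> real"
  assumes T: "0 \<le> T"
    and deriv: "\<And>s. s \<in> {0..T} \<Longrightarrow> (g has_real_derivative g' s) (at s within {0..T})"
    and cont: "continuous_on {0..T} g'" "continuous_on {0..T} w"
    and t: "t \<in> {0..T}"
    and j: "\<And>m. j m \<le> Suc m" "(\<lambda>m. grid T m (j m)) \<longlonglongrightarrow> t"
    and \<xi>: "\<And>m i. i < Suc m \<Longrightarrow> grid T m i \<le> \<xi> m i \<and> \<xi> m i \<le> grid T m (Suc i)"
  shows "(\<lambda>m. \<Sum>i<j m. g (\<xi> m i) * (w (grid T m (Suc i)) - w (grid T m i)))
    \<longlonglongrightarrow> g t * w t - g 0 * w 0 - integral {0..t} (\<lambda>s. g' s * w s)"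
proof -
  define G where "G s = g s * w s - g 0 * w 0 - integral {0..s} (\<lambda>s. g' s * w s)" for s
  define S where "S m = (\<Sum>i<j m. g (\<xi> m i) * (w (grid T m (Suc i)) - w (grid T m i)))" for m
  have contg: "continuous_on {0..T} g"
    using deriv DERIV_continuous_on by blast
  have "continuous_on {0..T} G"
    unfolding G_def by (intro continuous_intros contg cont indefinite_integral_continuous_1
      integrable_continuous_real)
  moreover have grT: "grid T m (j m) \<in> {0..T}" for m
    using grid_nonneg grid_le T j by auto
  ultimately have lim: "(\<lambda>m. G (grid T m (j m))) \<longlonglongrightarrow> G t"
    using j(2) t by (auto intro: continuous_on_tendsto_compose[of _ G])
  obtain B where B: "0 < B" "\<And>s. s \<in> {0..T} \<Longrightarrow> \<bar>g' s\<bar> \<le> B"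
    using compact_imp_bounded[OF compact_continuous_image[OF cont(1) compact_Icc]]
    by (auto simp: bounded_pos)
  have ucont: "uniformly_continuous_on {0..T} w"
    by (rule compact_uniformly_continuous[OF cont(2) compact_Icc])
  have "(\<lambda>m. G (grid T m (j m)) - S m) \<longlonglongrightarrow> 0"
  proof (rule LIMSEQ_I)
    fix r :: real assume r: "0 < r"
    \<comment> \<open>\<open>T + 1\<close> in place of \<open>T\<close> covers \<open>T = 0\<close>,
      and the factor 1/2 makes the final inequality strict.\<close>
    define \<epsilon> where "\<epsilon> = r / (B * (T + 1)) / 2"
    have \<epsilon>: "0 < \<epsilon>" using r B T by (simp add: \<epsilon>_def)
    obtain d where d: "0 < d" "\<And>s s'. s \<in> {0..T} \<Longrightarrow> s' \<in> {0..T} \<Longrightarrow> dist s' s < d \<Longrightarrow> dist (w s') (w s) < \<epsilon>"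
      using ucont \<epsilon> unfolding uniformly_continuous_on_def by metis
    obtain n where n: "T / d < real n" using reals_Archimedean2 by blast
    have "norm (G (grid T m (j m)) - S m - 0) < r" if "n \<le> m" for m
    proof -
      have "T / d < real (Suc m)" using n that by linarith
      then have step: "T / real (Suc m) < d" using d(1)
        by (simp add: field_simps)
      have "\<bar>G (grid T m (j m)) - S m\<bar> \<le> B * \<epsilon> * grid T m (j m)"
        unfolding G_def S_def
      proof (rule order_trans[OF eq_refl stieltjes_sum_bound[where \<xi>="\<xi> m" and T=T]])
        show "mono (grid T m)" using grid_mono[OF T] by (simp add: mono_def)
        show "\<bar>w s - w s'\<bar> \<le> \<epsilon>" if i: "i < j m" and s: "s \<in> {grid T m i..grid T m (Suc i)}"
          and s': "s' \<in> {grid T m i..grid T m (Suc i)}" for i s s'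
        proof -
          have "0 \<le> grid T m i" "grid T m (Suc i) \<le> T"
            using grid_nonneg[OF T] grid_le[OF T, of "Suc i" m] i j(1)[of m] by auto
          then have "s \<in> {0..T}" "s' \<in> {0..T}" using s s' by auto
          moreover have "dist s s' < d" using s s' step grid_step[of T m i] by (auto simp: dist_real_def)
          ultimately show ?thesis using d(2)[of s' s] by (simp add: dist_real_def)
        qed
      qed (use deriv cont B \<epsilon> grT \<xi> j(1)[of m] in \<open>auto simp: algebra_simps\<close>)
      also have "\<dots> \<le> B * \<epsilon> * (T + 1)"
        using grT[of m] B(1) \<epsilon> by (intro mult_left_mono) auto
      also have "\<dots> < r"
        using r B(1) T unfolding \<epsilon>_def by (simp add: pos_divide_less_eq add_pos_nonneg algebra_simps)
      finally show ?thesis by simp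
    qed
    then show "\<exists>no. \<forall>n\<ge>no. norm (G (grid T n (j n)) - S n - 0) < r" by blast
  qed
  from tendsto_diff[OF lim this] show ?thesis
    by (simp add: G_def S_def)
qed

text \<open>Rounding down keeps the grid points below \<open>t\<close>, so that an increasing
  variance function is bounded along them by its value at \<open>t\<close>.\<close>

lemma grid_approximates:
  assumes "0 < T" "t \<in> {0..T}"
  obtains j where "\<And>m. j m \<le> Suc m" "\<And>m. grid T m (j m) \<le> t" "(\<lambda>m. grid T m (j m)) \<longlonglongrightarrow> t"
proof
  define j where "j m = nat \<lfloor>t * real (Suc m) / T\<rfloor>" for m
  have fl: "real (j m) = of_int \<lfloor>t * real (Suc m) / T\<rfloor>" for m
    using assms by (simp add: j_def)
  show 1: "grid T m (j m) \<le> t" for m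
  proof -
    have "T * real (j m) \<le> T * (t * real (Suc m) / T)"
      unfolding fl using assms by (intro mult_left_mono of_int_floor_le) auto
    also have "\<dots> = t * real (Suc m)" using assms by simp
    finally have "T * real (j m) \<le> t * real (Suc m)" .
    then show ?thesis unfolding grid_def by (subst pos_divide_le_eq) auto
  qed
  show "j m \<le> Suc m" for m
  proof -
    have "t * real (Suc m) \<le> T * real (Suc m)" using assms by (intro mult_right_mono) auto
    then have "t * real (Suc m) / T \<le> real (Suc m)" using assms by (simp add: pos_divide_le_eq mult.commute)
    then have "real (j m) \<le> real (Suc m)" unfolding fl by linarith
    then show ?thesis by simp
  qed
  have 2: "t - T / real (Suc m) \<le> grid T m (j m)" for m
  proof -
    have "t * real (Suc m) / T - 1 \<le> real (j m)" unfolding fl by linarith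
    then have "T * (t * real (Suc m) / T - 1) / real (Suc m) \<le> grid T m (j m)"
      unfolding grid_def using assms by (intro divide_right_mono mult_left_mono) auto
    moreover have "T * (t * real (Suc m) / T - 1) = t * real (Suc m) - T"
      using assms by (simp add: right_diff_distrib del: of_nat_Suc)
    ultimately show ?thesis by (simp add: diff_divide_distrib del: of_nat_Suc)
  qed
  have "(\<lambda>m. T / real (Suc m)) \<longlonglongrightarrow> 0"
    using LIMSEQ_inverse_real_of_nat[THEN tendsto_mult_left, of T] by (simp add: divide_inverse)
  then have "(\<lambda>m. t - T / real (Suc m)) \<longlonglongrightarrow> t" using tendsto_diff[OF tendsto_const] by force
  then show "(\<lambda>m. grid T m (j m)) \<longlonglongrightarrow> t"
    by (rule tendsto_sandwich[OF _ _ _ tendsto_const, rotated 2]) (simp_all add: 1 2 del: of_nat_Suc)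
qed

subsection \<open>A filtered real process with orthogonal increments\<close>

text \<open>The two increment axioms say that, given \<open>F s\<close>, the increment has mean 0
  and second moment \<open>q * (u - s)\<close>. Testing against integrable
  \<open>F s\<close>-measurable \<open>Y\<close> expresses this without conditional expectations.
  The zero process with \<open>q = 0\<close> is an instance that occurs later.\<close>

locale scalar_noise = prob_space N for N :: "'w measure" +
  fixes F :: "real \<Rightarrow> 'w measure" and T q :: real and w :: "real \<Rightarrow> 'w \<Rightarrow> real"
  assumes horizon: "0 \<le> T" and q_nonneg: "0 \<le> q"
    and sub: "\<And>t. t \<in> {0..T} \<Longrightarrow> subalgebra N (F t)"
    and filtration: "\<And>s t. 0 \<le> s \<Longrightarrow> s \<le> t \<Longrightarrow> t \<le> T \<Longrightarrow> subalgebra (F t) (F s)"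
    and adapted: "\<And>t. t \<in> {0..T} \<Longrightarrow> w t \<in> borel_measurable (F t)"
    and incr_mean: "\<And>s u Y. 0 \<le> s \<Longrightarrow> s \<le> u \<Longrightarrow> u \<le> T \<Longrightarrow> Y \<in> borel_measurable (F s) \<Longrightarrow>
      integrable N Y \<Longrightarrow> has_bochner_integral N (\<lambda>\<omega>. Y \<omega> * (w u \<omega> - w s \<omega>)) 0"
    and incr_var: "\<And>s u Y. 0 \<le> s \<Longrightarrow> s \<le> u \<Longrightarrow> u \<le> T \<Longrightarrow> Y \<in> borel_measurable (F s) \<Longrightarrow>
      integrable N Y \<Longrightarrow> has_bochner_integral N (\<lambda>\<omega>. Y \<omega> * (w u \<omega> - w s \<omega>)\<^sup>2) (q * (u - s) * expectation Y)"
    and start: "AE \<omega> in N. w 0 \<omega> = 0"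
    and cont: "AE \<omega> in N. continuous_on {0..T} (\<lambda>t. w t \<omega>)"
begin

lemma measurable_mono:
  "Y \<in> borel_measurable (F s) \<Longrightarrow> 0 \<le> s \<Longrightarrow> s \<le> t \<Longrightarrow> t \<le> T \<Longrightarrow> Y \<in> borel_measurable (F t)"
  by (rule measurable_from_subalg[OF filtration])

lemma measurable_N: "Y \<in> borel_measurable (F s) \<Longrightarrow> 0 \<le> s \<Longrightarrow> s \<le> T \<Longrightarrow> Y \<in> borel_measurable N"
  by (rule measurable_from_subalg[OF sub]) auto

lemma w_measurable_mono: "0 \<le> s \<Longrightarrow> s \<le> t \<Longrightarrow> t \<le> T \<Longrightarrow> w s \<in> borel_measurable (F t)"
  by (rule measurable_mono[OF adapted]) auto

lemma w_measurable [measurable]: "0 \<le> s \<Longrightarrow> s \<le> T \<Longrightarrow> w s \<in> borel_measurable N"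
  by (rule measurable_N[OF adapted]) auto

text \<open>The earlier increment times \<open>\<psi>\<close> is \<open>F c\<close>-measurable and,
  \<open>\<psi>\<close> being bounded, integrable. It is the \<open>Y\<close> of
  \<open>incr_mean\<close> for the later increment.\<close>

lemma orthogonal_increments:
  assumes "0 \<le> a" "a \<le> b" "b \<le> c" "c \<le> d" "d \<le> T"
    and "\<psi> \<in> borel_measurable (F c)" and "\<And>\<omega>. \<omega> \<in> space N \<Longrightarrow> \<bar>\<psi> \<omega>\<bar> \<le> K"
  shows "has_bochner_integral N (\<lambda>\<omega>. \<psi> \<omega> * ((w b \<omega> - w a \<omega>) * (w d \<omega> - w c \<omega>))) 0"
proof -
  have "has_bochner_integral N (\<lambda>\<omega>. 1 * (w b \<omega> - w a \<omega>)) 0"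
    by (rule incr_mean) (use assms(1-5) in simp_all)
  then have inc: "integrable N (\<lambda>\<omega>. w b \<omega> - w a \<omega>)" by (simp add: has_bochner_integral_iff)
  have "integrable N (\<lambda>\<omega>. \<psi> \<omega> * (w b \<omega> - w a \<omega>))"
  proof (rule Bochner_Integration.integrable_bound[of N "\<lambda>\<omega>. K * (w b \<omega> - w a \<omega>)"])
    show "(\<lambda>\<omega>. \<psi> \<omega> * (w b \<omega> - w a \<omega>)) \<in> borel_measurable N"
      using assms(1-5) by (intro borel_measurable_times borel_measurable_diff measurable_N[OF assms(6)] w_measurable) auto
    show "AE \<omega> in N. norm (\<psi> \<omega> * (w b \<omega> - w a \<omega>)) \<le> norm (K * (w b \<omega> - w a \<omega>))"
    proof (rule AE_I2)
      fix \<omega> assume "\<omega> \<in> space N"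
      then have "\<bar>\<psi> \<omega>\<bar> \<le> \<bar>K\<bar>" using assms(7) by fastforce
      then show "norm (\<psi> \<omega> * (w b \<omega> - w a \<omega>)) \<le> norm (K * (w b \<omega> - w a \<omega>))"
        by (simp add: abs_mult mult_right_mono)
    qed
  qed (simp add: inc)
  moreover have "(\<lambda>\<omega>. \<psi> \<omega> * (w b \<omega> - w a \<omega>)) \<in> borel_measurable (F c)"
    using assms(1-6) by (intro borel_measurable_times borel_measurable_diff w_measurable_mono) auto
  ultimately show ?thesis
    using assms(1-5) incr_mean[of c d "\<lambda>\<omega>. \<psi> \<omega> * (w b \<omega> - w a \<omega>)"] by (simp add: mult.assoc)
qed

text \<open>Cutting both increments at all endpoints leaves at most one common piece, whose square
  contributes \<open>q\<close> times its length by \<open>incr_var\<close>, and products over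
  disjoint intervals, which have mean 0.\<close>

lemma increment_product_ordered:
  assumes su: "0 \<le> s" "s \<le> u" "u \<le> T" and su': "s \<le> s'" "s' \<le> u'" "u' \<le> T"
    and \<psi>: "\<psi> \<in> borel_measurable (F s')" "\<And>\<omega>. \<omega> \<in> space N \<Longrightarrow> \<bar>\<psi> \<omega>\<bar> \<le> K"
  shows "has_bochner_integral N (\<lambda>\<omega>. \<psi> \<omega> * ((w u \<omega> - w s \<omega>) * (w u' \<omega> - w s' \<omega>)))
    (q * expectation \<psi> * measure lborel ({s<..u} \<inter> {s'<..u'}))"
proof -
  have int: "integrable N \<psi>"
    using \<psi> su su' measurable_N[OF \<psi>(1)] by (intro integrable_const_bound[of _ K]) auto
  consider "u \<le> s'" | "s' < u" "u \<le> u'" | "s' < u" "u' < u" by linarith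
  then show ?thesis
  proof cases
    case 1
    then have "{s<..u} \<inter> {s'<..u'} = {}" by auto
    then show ?thesis
      using orthogonal_increments[of s u s' u' \<psi> K] assms 1 by simp
  next
    case 2
    then have eq: "{s<..u} \<inter> {s'<..u'} = {s'<..u}" using su' by auto
    have "has_bochner_integral N (\<lambda>\<omega>. \<psi> \<omega> * ((w s' \<omega> - w s \<omega>) * (w u' \<omega> - w s' \<omega>)) +
       \<psi> \<omega> * (w u \<omega> - w s' \<omega>)\<^sup>2 + \<psi> \<omega> * ((w u \<omega> - w s' \<omega>) * (w u' \<omega> - w u \<omega>)))
       (0 + q * (u - s') * expectation \<psi> + 0)"
      using assms 2 int measurable_mono[OF \<psi>(1), of u]
      by (intro has_bochner_integral_add incr_var orthogonal_increments[where K=K]) auto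
    then show ?thesis unfolding eq
      using 2 by (simp add: algebra_simps power2_eq_square)
  next
    case 3
    then have eq: "{s<..u} \<inter> {s'<..u'} = {s'<..u'}" using su' by auto
    have "has_bochner_integral N (\<lambda>\<omega>. \<psi> \<omega> * ((w s' \<omega> - w s \<omega>) * (w u' \<omega> - w s' \<omega>)) +
       \<psi> \<omega> * (w u' \<omega> - w s' \<omega>)\<^sup>2 + \<psi> \<omega> * ((w u' \<omega> - w s' \<omega>) * (w u \<omega> - w u' \<omega>)))
       (0 + q * (u' - s') * expectation \<psi> + 0)"
      using assms 3 int measurable_mono[OF \<psi>(1), of u']
      by (intro has_bochner_integral_add incr_var orthogonal_increments[where K=K]) auto
    then show ?thesis unfolding eq
      using su' by (simp add: algebra_simps power2_eq_square)
  qed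
qed

text \<open>Stopping at \<open>t\<close> either shortens the intervals or annihilates an increment
  whose interval starts after \<open>t\<close>. In the first case the left endpoints may be ordered
  by symmetry, and \<open>\<phi> * \<phi>'\<close> is measurable at the later one.\<close>

lemma increment_product:
  assumes su: "0 \<le> s" "s \<le> u" "u \<le> T" and su': "0 \<le> s'" "s' \<le> u'" "u' \<le> T"
    and \<phi>: "\<phi> \<in> borel_measurable (F s)" "\<And>\<omega>. \<omega> \<in> space N \<Longrightarrow> \<bar>\<phi> \<omega>\<bar> \<le> K"
    and \<phi>': "\<phi>' \<in> borel_measurable (F s')" "\<And>\<omega>. \<omega> \<in> space N \<Longrightarrow> \<bar>\<phi>' \<omega>\<bar> \<le> K'"
    and t: "t \<in> {0..T}"
  shows "has_bochner_integral N
    (\<lambda>\<omega>. \<phi> \<omega> * (w (min u t) \<omega> - w (min s t) \<omega>) * (\<phi>' \<omega> * (w (min u' t) \<omega> - w (min s' t) \<omega>)))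
    (q * expectation (\<lambda>\<omega>. \<phi> \<omega> * \<phi>' \<omega>) * measure lborel ({s<..u} \<inter> {s'<..u'} \<inter> {0..t}))"
proof (cases "s \<le> t \<and> s' \<le> t")
  case True
  then have eq: "{s<..u} \<inter> {s'<..u'} \<inter> {0..t} = {min s t<..min u t} \<inter> {min s' t<..min u' t}"
    using su su' by auto
  have bd: "\<bar>\<phi> \<omega> * \<phi>' \<omega>\<bar> \<le> K * K'" if "\<omega> \<in> space N" for \<omega>
    unfolding abs_mult using \<phi>(2)[OF that] \<phi>'(2)[OF that] by (intro mult_mono) auto
  show ?thesis
  proof (cases "s \<le> s'")
    case s: True
    have "(\<lambda>\<omega>. \<phi> \<omega> * \<phi>' \<omega>) \<in> borel_measurable (F s')"
      using measurable_mono[OF \<phi>(1)] \<phi>'(1) s su su' by (intro borel_measurable_times) auto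
    then show ?thesis unfolding eq
      using increment_product_ordered[of "min s t" "min u t" "min s' t" "min u' t" "\<lambda>\<omega>. \<phi> \<omega> * \<phi>' \<omega>" "K * K'"]
        bd s True su su' t by (simp add: mult_ac min_def split: if_splits)
  next
    case s: False
    have "(\<lambda>\<omega>. \<phi> \<omega> * \<phi>' \<omega>) \<in> borel_measurable (F s)"
      using measurable_mono[OF \<phi>'(1)] \<phi>(1) s su su' by (intro borel_measurable_times) auto
    then show ?thesis unfolding eq
      using increment_product_ordered[of "min s' t" "min u' t" "min s t" "min u t" "\<lambda>\<omega>. \<phi> \<omega> * \<phi>' \<omega>" "K * K'"]
        bd s True su su' t by (simp add: mult_ac Int_commute min_def split: if_splits)
  qed
next
  case False
  then have eq: "{s<..u} \<inter> {s'<..u'} \<inter> {0..t} = {}" by auto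
  have "min u t = min s t \<or> min u' t = min s' t" using False su su' by auto
  then have "(\<lambda>\<omega>. \<phi> \<omega> * (w (min u t) \<omega> - w (min s t) \<omega>) *
      (\<phi>' \<omega> * (w (min u' t) \<omega> - w (min s' t) \<omega>))) = (\<lambda>_. 0)" by auto
  then show ?thesis unfolding eq by (simp add: has_bochner_integral_zero)
qed

text \<open>The intervals of an elementary process may overlap, so both sides are expanded over all
  pairs of entries. A pair contributes the mean of \<open>\<phi> i * \<phi> j\<close> times the
  length of the overlap before \<open>t\<close>, on both sides with the factor
  \<open>q\<close>.\<close>

lemma ito_isometry_elementary:
  assumes E: "is_elementary N F T E" and t: "t \<in> {0..T}"
  shows "(\<integral>\<^sup>+\<omega>. ennreal ((elementary_integral E w t \<omega>)\<^sup>2) \<partial>N)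
    = ennreal q * (\<integral>\<^sup>+\<omega>. (\<integral>\<^sup>+r\<in>{0..t}. ennreal ((elementary_process E r \<omega>)\<^sup>2) \<partial>lborel) \<partial>N)"
proof -
  define n where "n = length E"
  define s u \<phi> where "s i = fst (E ! i)" and "u i = fst (snd (E ! i))" and "\<phi> i = snd (snd (E ! i))" for i
  have Ei: "E ! i = (s i, u i, \<phi> i)" for i by (simp add: s_def u_def \<phi>_def)
  have E': "0 \<le> s i \<and> s i \<le> u i \<and> u i \<le> T \<and> \<phi> i \<in> borel_measurable (F (s i)) \<and>
      (\<exists>c. \<forall>\<omega>\<in>space N. \<bar>\<phi> i \<omega>\<bar> \<le> c)" if "i < n" for i
  proof -
    have "(s i, u i, \<phi> i) \<in> set E" using that Ei[of i] nth_mem[of i E] by (simp add: n_def)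
    then show ?thesis using E unfolding is_elementary_def by fastforce
  qed
  then obtain K where K: "\<And>i \<omega>. i < n \<Longrightarrow> \<omega> \<in> space N \<Longrightarrow> \<bar>\<phi> i \<omega>\<bar> \<le> K i" by metis
  define L where "L i j = measure lborel ({s i<..u i} \<inter> {s j<..u j} \<inter> {0..t})" for i j
  have I: "elementary_integral E w t \<omega> = (\<Sum>i<n. \<phi> i \<omega> * (w (min (u i) t) \<omega> - w (min (s i) t) \<omega>))" for \<omega>
    unfolding elementary_integral_def n_def
    by (simp add: sum_list_sum_nth Ei lessThan_atLeast0)
  have P: "elementary_process E r \<omega> = (\<Sum>i<n. \<phi> i \<omega> * indicator {s i<..u i} r)" for r \<omega>
    unfolding elementary_process_def n_def
    by (simp add: sum_list_sum_nth Ei lessThan_atLeast0)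
  have "has_bochner_integral N (\<lambda>\<omega>. \<Sum>i<n. \<Sum>j<n. \<phi> i \<omega> * (w (min (u i) t) \<omega> - w (min (s i) t) \<omega>) *
      (\<phi> j \<omega> * (w (min (u j) t) \<omega> - w (min (s j) t) \<omega>)))
      (\<Sum>i<n. \<Sum>j<n. q * expectation (\<lambda>\<omega>. \<phi> i \<omega> * \<phi> j \<omega>) * L i j)"
    unfolding L_def using E' K t by (intro has_bochner_integral_sum increment_product) auto
  then have "has_bochner_integral N (\<lambda>\<omega>. (elementary_integral E w t \<omega>)\<^sup>2)
      (\<Sum>i<n. \<Sum>j<n. q * expectation (\<lambda>\<omega>. \<phi> i \<omega> * \<phi> j \<omega>) * L i j)"
    unfolding I power2_eq_square sum_product .
  then have lhs: "(\<integral>\<^sup>+\<omega>. ennreal ((elementary_integral E w t \<omega>)\<^sup>2) \<partial>N)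
      = ennreal (\<Sum>i<n. \<Sum>j<n. q * expectation (\<lambda>\<omega>. \<phi> i \<omega> * \<phi> j \<omega>) * L i j)"
    by (simp add: nn_integral_eq_integral has_bochner_integral_iff)
  have inner: "has_bochner_integral lborel (\<lambda>r. (elementary_process E r \<omega>)\<^sup>2 * indicator {0..t} r)
      (\<Sum>i<n. \<Sum>j<n. \<phi> i \<omega> * \<phi> j \<omega> * L i j)" for \<omega>
  proof -
    have fin: "emeasure lborel (S \<inter> {0..t}) < \<infinity>" for S
    proof -
      have "emeasure lborel (S \<inter> {0..t}) \<le> emeasure lborel {0..t}"
        by (intro emeasure_mono) auto
      also have "\<dots> < \<infinity>" using t by simp
      finally show ?thesis .
    qed
    have "has_bochner_integral lborel (\<lambda>r. \<Sum>i<n. \<Sum>j<n. \<phi> i \<omega> * \<phi> j \<omega> *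
       indicator ({s i<..u i} \<inter> {s j<..u j} \<inter> {0..t}) r) (\<Sum>i<n. \<Sum>j<n. \<phi> i \<omega> * \<phi> j \<omega> * L i j)"
      unfolding L_def
      by (intro has_bochner_integral_sum has_bochner_integral_mult_right has_bochner_integral_real_indicator fin sets.Int)
        simp_all
    moreover have "(elementary_process E r \<omega>)\<^sup>2 * indicator {0..t} r = (\<Sum>i<n. \<Sum>j<n. \<phi> i \<omega> * \<phi> j \<omega> *
       indicator ({s i<..u i} \<inter> {s j<..u j} \<inter> {0..t}) r)" for r
      unfolding P power2_eq_square sum_product
      unfolding sum_distrib_right by (intro sum.cong refl) (simp split: split_indicator)
    ultimately show ?thesis by (simp only:)
  qed
  \<comment> \<open>The double sum is the integral of a square. Its sign permits the passage between
    nonnegative and Bochner integrals.\<close>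
  then have nonneg: "0 \<le> (\<Sum>i<n. \<Sum>j<n. \<phi> i \<omega> * \<phi> j \<omega> * L i j)" for \<omega>
    using inner[of \<omega>] by (subst has_bochner_integral_integral_eq[OF inner, symmetric]) simp
  have inner': "(\<integral>\<^sup>+r\<in>{0..t}. ennreal ((elementary_process E r \<omega>)\<^sup>2) \<partial>lborel)
      = ennreal (\<Sum>i<n. \<Sum>j<n. \<phi> i \<omega> * \<phi> j \<omega> * L i j)" for \<omega>
  proof -
    have "(\<integral>\<^sup>+r\<in>{0..t}. ennreal ((elementary_process E r \<omega>)\<^sup>2) \<partial>lborel)
      = (\<integral>\<^sup>+r. ennreal ((elementary_process E r \<omega>)\<^sup>2 * indicator {0..t} r) \<partial>lborel)"
      by (intro nn_integral_cong) (auto split: split_indicator)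
    then show ?thesis using inner[of \<omega>] by (simp add: nn_integral_eq_integral has_bochner_integral_iff)
  qed
  have int\<phi>: "integrable N (\<lambda>\<omega>. \<phi> i \<omega> * \<phi> j \<omega>)" if "i < n" "j < n" for i j
  proof (rule integrable_const_bound[of _ "K i * K j"])
    show "AE \<omega> in N. norm (\<phi> i \<omega> * \<phi> j \<omega>) \<le> K i * K j"
    proof (intro AE_I2)
      fix \<omega> assume "\<omega> \<in> space N"
      then show "norm (\<phi> i \<omega> * \<phi> j \<omega>) \<le> K i * K j"
        unfolding norm_mult using K[of i \<omega>] K[of j \<omega>] that by (intro mult_mono) auto
    qed
    show "(\<lambda>\<omega>. \<phi> i \<omega> * \<phi> j \<omega>) \<in> borel_measurable N"
      using E'[OF that(1)] E'[OF that(2)] by (intro borel_measurable_times measurable_N[of _ "s i"] measurable_N[of _ "s j"]) auto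
  qed
  have "has_bochner_integral N (\<lambda>\<omega>. \<Sum>i<n. \<Sum>j<n. \<phi> i \<omega> * \<phi> j \<omega> * L i j)
      (\<Sum>i<n. \<Sum>j<n. expectation (\<lambda>\<omega>. \<phi> i \<omega> * \<phi> j \<omega>) * L i j)"
    by (intro has_bochner_integral_sum has_bochner_integral_mult_left has_bochner_integral_integrable int\<phi>) auto
  then have "(\<integral>\<^sup>+\<omega>. ennreal (\<Sum>i<n. \<Sum>j<n. \<phi> i \<omega> * \<phi> j \<omega> * L i j) \<partial>N)
      = ennreal (\<Sum>i<n. \<Sum>j<n. expectation (\<lambda>\<omega>. \<phi> i \<omega> * \<phi> j \<omega>) * L i j)"
    using nonneg by (simp add: nn_integral_eq_integral has_bochner_integral_iff)
  moreover have "(\<Sum>i<n. \<Sum>j<n. q * expectation (\<lambda>\<omega>. \<phi> i \<omega> * \<phi> j \<omega>) * L i j)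
      = q * (\<Sum>i<n. \<Sum>j<n. expectation (\<lambda>\<omega>. \<phi> i \<omega> * \<phi> j \<omega>) * L i j)"
    by (simp add: sum_distrib_left mult_ac)
  ultimately show ?thesis
    unfolding inner' lhs using q_nonneg by (simp add: ennreal_mult')
qed

end

subsection \<open>Doob's maximal inequality for step sums\<close>

fun running_max :: "(nat \<Rightarrow> real) \<Rightarrow> nat \<Rightarrow> real" where
  "running_max s 0 = s 0"
| "running_max s (Suc n) = max (running_max s n) (s (Suc n))"

lemma running_max_ge: "k \<le> n \<Longrightarrow> s k \<le> running_max s n"
  by (induction n) (auto simp: le_Suc_eq le_max_iff_disj)

text \<open>For fixed \<open>y\<close> the expression \<open>2 * m * y - m\<^sup>2\<close> is
  largest at \<open>m = y\<close>. Replacing the old maximum by \<open>y = s (Suc n)\<close> when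
  the latter is larger therefore only increases the right-hand side.\<close>

lemma running_max_square:
  "2 * (\<Sum>k<n. running_max s k * (s (Suc k) - s k)) \<le> 2 * running_max s n * s n - (running_max s n)\<^sup>2"
proof (induction n)
  case 0
  then show ?case by (simp add: power2_eq_square)
next
  case (Suc n)
  have "2 * running_max s n * s (Suc n) - (running_max s n)\<^sup>2
      \<le> 2 * running_max s (Suc n) * s (Suc n) - (running_max s (Suc n))\<^sup>2"
  proof (cases "s (Suc n) \<le> running_max s n")
    case False
    have "0 \<le> (running_max s n - s (Suc n))\<^sup>2" by simp
    then show ?thesis using False by (simp add: power2_eq_square algebra_simps)
  qed (simp add: max_def)
  then show ?case using Suc by (simp add: algebra_simps)
qed

text \<open>The sum is a martingale transform of \<open>S\<close>, so taking expectations yields Doob's inequality.\<close>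

lemma doob_pathwise:
  fixes S :: "nat \<Rightarrow> real"
  defines "M \<equiv> running_max (\<lambda>k. \<bar>S k\<bar>)"
  shows "(M n)\<^sup>2 + 4 * (\<Sum>k<n. M k * sgn (S k) * (S (Suc k) - S k)) \<le> 4 * (S n)\<^sup>2"
proof -
  have M: "0 \<le> M k" for k
    using running_max_ge[of 0 k "\<lambda>k. \<bar>S k\<bar>"] by (auto simp: M_def)
  have "(\<Sum>k<n. M k * sgn (S k) * (S (Suc k) - S k)) \<le> (\<Sum>k<n. M k * (\<bar>S (Suc k)\<bar> - \<bar>S k\<bar>))"
  proof (rule sum_mono)
    fix k
    \<comment> \<open>\<open>sgn (S k)\<close> is a subgradient of the absolute value at
      \<open>S k\<close>.\<close>
    have "sgn (S k) * (S (Suc k) - S k) \<le> \<bar>S (Suc k)\<bar> - \<bar>S k\<bar>"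
      by (auto simp: sgn_real_def)
    then show "M k * sgn (S k) * (S (Suc k) - S k) \<le> M k * (\<bar>S (Suc k)\<bar> - \<bar>S k\<bar>)"
      using mult_left_mono[OF _ M] by (simp only: mult.assoc)
  qed
  moreover have "2 * (\<Sum>k<n. M k * (\<bar>S (Suc k)\<bar> - \<bar>S k\<bar>)) \<le> 2 * M n * \<bar>S n\<bar> - (M n)\<^sup>2"
    unfolding M_def by (rule running_max_square)
  \<comment> \<open>Origin of Doob's constant: twice the previous inequality leaves
    \<open>4 * M n * \<bar>S n\<bar> - (M n)\<^sup>2\<close> as a bound, and this square bounds it
    by \<open>4 * (S n)\<^sup>2\<close>.\<close>
  moreover have "0 \<le> (M n - 2 * \<bar>S n\<bar>)\<^sup>2" by simp
  then have "4 * (M n * \<bar>S n\<bar>) \<le> (M n)\<^sup>2 + 4 * (S n)\<^sup>2"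
    by (simp add: power2_diff algebra_simps power_mult_distrib)
  ultimately show ?thesis by (simp add: algebra_simps)
qed

section \<open>Second moments and maximal inequality for sums with deterministic
  coefficients\<close>

context scalar_noise
begin

definition step_sum :: "(nat \<Rightarrow> real) \<Rightarrow> (nat \<Rightarrow> real) \<Rightarrow> 'w \<Rightarrow> nat \<Rightarrow> real" where
  "step_sum p c \<omega> j = (\<Sum>i<j. c i * (w (p (Suc i)) \<omega> - w (p i) \<omega>))"

context
  fixes p :: "nat \<Rightarrow> real" and c :: "nat \<Rightarrow> real" and m :: nat
  assumes p: "mono p" "0 \<le> p 0" "p m \<le> T"
begin

lemma partition_bounds: "i \<le> j \<Longrightarrow> j \<le> m \<Longrightarrow> 0 \<le> p i \<and> p i \<le> p j \<and> p j \<le> T"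
  using monoD[OF p(1), of 0 i] monoD[OF p(1), of i j] monoD[OF p(1), of j m] p(2,3) by simp

lemma step_sum_adapted:
  assumes "j \<le> m" shows "(\<lambda>\<omega>. step_sum p c \<omega> j) \<in> borel_measurable (F (p j))"
  unfolding step_sum_def
proof (intro borel_measurable_sum borel_measurable_times borel_measurable_diff borel_measurable_const)
  fix i assume "i \<in> {..<j}"
  then show "w (p (Suc i)) \<in> borel_measurable (F (p j))" "w (p i) \<in> borel_measurable (F (p j))"
    using assms partition_bounds[of i j] partition_bounds[of "Suc i" j] by (auto intro: w_measurable_mono)
qed

text \<open>The cross term has mean 0 by \<open>incr_mean\<close>, the partial sum being adapted and
  integrable; the new square is \<open>incr_var\<close> with \<open>Y = 1\<close>.\<close>

lemma step_sum_square:
  "j \<le> m \<Longrightarrow> has_bochner_integral N (\<lambda>\<omega>. (step_sum p c \<omega> j)\<^sup>2) (q * (\<Sum>i<j. (c i)\<^sup>2 * (p (Suc i) - p i)))"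
proof (induction j)
  case 0
  then show ?case by (simp add: step_sum_def has_bochner_integral_zero)
next
  case (Suc j)
  have b: "0 \<le> p j" "p j \<le> p (Suc j)" "p (Suc j) \<le> T" using partition_bounds[of j "Suc j"] Suc by auto
  have IH: "has_bochner_integral N (\<lambda>\<omega>. (step_sum p c \<omega> j)\<^sup>2) (q * (\<Sum>i<j. (c i)\<^sup>2 * (p (Suc i) - p i)))"
    using Suc by auto
  have meas: "(\<lambda>\<omega>. step_sum p c \<omega> j) \<in> borel_measurable (F (p j))"
    using Suc.prems by (intro step_sum_adapted) simp
  have "integrable N (\<lambda>\<omega>. step_sum p c \<omega> j)"
    using IH measurable_N[OF meas] b by (intro square_integrable_imp_integrable[of "\<lambda>\<omega>. step_sum p c \<omega> j"])
      (simp_all add: has_bochner_integral_iff)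
  then have "has_bochner_integral N (\<lambda>\<omega>. step_sum p c \<omega> j * (w (p (Suc j)) \<omega> - w (p j) \<omega>)) 0"
    by (intro incr_mean b meas)
  moreover have "has_bochner_integral N (\<lambda>\<omega>. 1 * (w (p (Suc j)) \<omega> - w (p j) \<omega>)\<^sup>2)
      (q * (p (Suc j) - p j) * expectation (\<lambda>_. 1))"
    by (intro incr_var b) auto
  ultimately have "has_bochner_integral N (\<lambda>\<omega>. (step_sum p c \<omega> j)\<^sup>2
      + 2 * c j * (step_sum p c \<omega> j * (w (p (Suc j)) \<omega> - w (p j) \<omega>))
      + (c j)\<^sup>2 * (1 * (w (p (Suc j)) \<omega> - w (p j) \<omega>)\<^sup>2))
      (q * (\<Sum>i<j. (c i)\<^sup>2 * (p (Suc i) - p i)) + 2 * c j * 0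
        + (c j)\<^sup>2 * (q * (p (Suc j) - p j) * expectation (\<lambda>_. 1)))"
    by (intro has_bochner_integral_add has_bochner_integral_mult_right IH)
  then show ?case
    by (simp add: step_sum_def power2_eq_square algebra_simps prob_space)
qed

lemma running_max_adapted:
  "j \<le> m \<Longrightarrow> (\<lambda>\<omega>. running_max (\<lambda>k. \<bar>step_sum p c \<omega> k\<bar>) j) \<in> borel_measurable (F (p j))"
proof (induction j)
  case 0
  then show ?case using step_sum_adapted[of 0] by simp
next
  case (Suc j)
  then have "(\<lambda>\<omega>. running_max (\<lambda>k. \<bar>step_sum p c \<omega> k\<bar>) j) \<in> borel_measurable (F (p (Suc j)))"
    using partition_bounds[of j "Suc j"] by (intro measurable_mono[OF Suc.IH]) auto
  then show ?case using step_sum_adapted[of "Suc j"] Suc by simp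
qed

lemma running_max_measurable [measurable]:
  "j \<le> m \<Longrightarrow> (\<lambda>\<omega>. running_max (\<lambda>k. \<bar>step_sum p c \<omega> k\<bar>) j) \<in> borel_measurable N"
  using running_max_adapted[of j] partition_bounds[of j j] by (intro measurable_N[of _ "p j"]) auto

text \<open>Makes the running maximum an integrable, hence admissible, weight for
  \<open>incr_mean\<close>.\<close>

lemma running_max_square_integrable:
  "j \<le> m \<Longrightarrow> integrable N (\<lambda>\<omega>. (running_max (\<lambda>k. \<bar>step_sum p c \<omega> k\<bar>) j)\<^sup>2)"
proof (induction j)
  case 0
  then show ?case by (simp add: step_sum_def)
next
  case (Suc j)
  show ?case
  proof (rule Bochner_Integration.integrable_bound)
    show "integrable N (\<lambda>\<omega>. (running_max (\<lambda>k. \<bar>step_sum p c \<omega> k\<bar>) j)\<^sup>2 + (step_sum p c \<omega> (Suc j))\<^sup>2)"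
      using Suc step_sum_square[OF Suc.prems] by (simp add: has_bochner_integral_iff)
    show "(\<lambda>\<omega>. (running_max (\<lambda>k. \<bar>step_sum p c \<omega> k\<bar>) (Suc j))\<^sup>2) \<in> borel_measurable N"
      using running_max_measurable[OF Suc.prems] by (rule borel_measurable_power)
  qed (auto simp: max_def)
qed

text \<open>The transform in the pathwise inequality has weights known at the left end of each cell,
  so its expectation vanishes and four times the second moment of the last partial sum
  remains.\<close>

lemma doob_step_sum:
  "(\<integral>\<^sup>+\<omega>. ennreal ((running_max (\<lambda>k. \<bar>step_sum p c \<omega> k\<bar>) m)\<^sup>2) \<partial>N)
    \<le> ennreal (4 * q * (\<Sum>i<m. (c i)\<^sup>2 * (p (Suc i) - p i)))"
proof -
  define M where "M \<omega> = running_max (\<lambda>k. \<bar>step_sum p c \<omega> k\<bar>)" for \<omega>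
  define S where "S = step_sum p c"
  have doob: "(M \<omega> m)\<^sup>2 + 4 * (\<Sum>k<m. M \<omega> k * sgn (S \<omega> k) * (S \<omega> (Suc k) - S \<omega> k)) \<le> 4 * (S \<omega> m)\<^sup>2" for \<omega>
    unfolding M_def S_def by (rule doob_pathwise)
  have M2: "integrable N (\<lambda>\<omega>. (M \<omega> m)\<^sup>2)"
    unfolding M_def by (rule running_max_square_integrable) simp
  have "has_bochner_integral N (\<lambda>\<omega>. M \<omega> k * sgn (S \<omega> k) * (S \<omega> (Suc k) - S \<omega> k)) 0" if k: "k < m" for k
  proof -
    have b: "0 \<le> p k" "p k \<le> p (Suc k)" "p (Suc k) \<le> T" using partition_bounds[of k "Suc k"] k by auto
    \<comment> \<open>The increment of \<open>S\<close> carries the coefficient \<open>c k\<close>.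
      It is moved into the adapted weight, so that \<open>incr_mean\<close> applies to the increment
      of \<open>w\<close>.\<close>
    have ad: "(\<lambda>\<omega>. M \<omega> k * sgn (S \<omega> k) * c k) \<in> borel_measurable (F (p k))"
      unfolding M_def S_def using k running_max_adapted[of k] step_sum_adapted[of k] by simp
    have intM: "integrable N (\<lambda>\<omega>. M \<omega> k)"
      unfolding M_def using k
      by (intro square_integrable_imp_integrable[OF running_max_measurable running_max_square_integrable]) auto
    have "integrable N (\<lambda>\<omega>. M \<omega> k * sgn (S \<omega> k) * c k)"
    proof (rule Bochner_Integration.integrable_bound)
      show "integrable N (\<lambda>\<omega>. M \<omega> k * c k)" using intM by simp
      show "(\<lambda>\<omega>. M \<omega> k * sgn (S \<omega> k) * c k) \<in> borel_measurable N"
        using b by (intro measurable_N[OF ad]) auto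
      show "AE \<omega> in N. norm (M \<omega> k * sgn (S \<omega> k) * c k) \<le> norm (M \<omega> k * c k)"
        by (intro AE_I2) (simp add: abs_mult sgn_real_def)
    qed
    from incr_mean[OF b ad this] show ?thesis by (simp add: S_def step_sum_def algebra_simps)
  qed
  then have "has_bochner_integral N (\<lambda>\<omega>. \<Sum>k<m. M \<omega> k * sgn (S \<omega> k) * (S \<omega> (Suc k) - S \<omega> k)) (\<Sum>k<m. 0)"
    by (intro has_bochner_integral_sum) auto
  moreover have "has_bochner_integral N (\<lambda>\<omega>. (M \<omega> m)\<^sup>2) (expectation (\<lambda>\<omega>. (M \<omega> m)\<^sup>2))"
    using M2 by (rule has_bochner_integral_integrable)
  ultimately have "has_bochner_integral N (\<lambda>\<omega>. (M \<omega> m)\<^sup>2 +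
      4 * (\<Sum>k<m. M \<omega> k * sgn (S \<omega> k) * (S \<omega> (Suc k) - S \<omega> k))) (expectation (\<lambda>\<omega>. (M \<omega> m)\<^sup>2) + 4 * (\<Sum>k<m. 0))"
    by (intro has_bochner_integral_add has_bochner_integral_mult_right)
  moreover have "has_bochner_integral N (\<lambda>\<omega>. 4 * (S \<omega> m)\<^sup>2) (4 * (q * (\<Sum>i<m. (c i)\<^sup>2 * (p (Suc i) - p i))))"
    unfolding S_def by (intro has_bochner_integral_mult_right step_sum_square) simp
  ultimately have "expectation (\<lambda>\<omega>. (M \<omega> m)\<^sup>2) + 4 * (\<Sum>k<m. 0) \<le> 4 * (q * (\<Sum>i<m. (c i)\<^sup>2 * (p (Suc i) - p i)))"
    using integral_mono[of N "\<lambda>\<omega>. (M \<omega> m)\<^sup>2 + 4 * (\<Sum>k<m. M \<omega> k * sgn (S \<omega> k) * (S \<omega> (Suc k) - S \<omega> k))"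
      "\<lambda>\<omega>. 4 * (S \<omega> m)\<^sup>2"] doob
    unfolding has_bochner_integral_iff by simp
  then show ?thesis
    using M2 unfolding M_def by (subst nn_integral_eq_integral) (auto intro: ennreal_leI)
qed

end

subsection \<open>Maximal and pointwise estimates for Wiener integrals of smooth functions\<close>

text \<open>Partial integration of the integral of \<open>g\<close> against \<open>w\<close>, with
  the boundary term at 0 dropped because \<open>w 0 = 0\<close> almost surely. The argument
  \<open>g'\<close> is free and carries this meaning only when it is the derivative of
  \<open>g\<close>.\<close>

definition wiener_integral :: "(real \<Rightarrow> real) \<Rightarrow> (real \<Rightarrow> real) \<Rightarrow> real \<Rightarrow> 'w \<Rightarrow> real" where
  "wiener_integral g g' t \<omega> = g t * w t \<omega> - integral {0..t} (\<lambda>s. g' s * w s \<omega>)"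

context
  fixes g g' A :: "real \<Rightarrow> real"
  assumes T_pos: "0 < T"
    and g_deriv: "\<And>s. s \<in> {0..T} \<Longrightarrow> (g has_real_derivative g' s) (at s within {0..T})"
    and g'_cont: "continuous_on {0..T} g'"
    and A_deriv: "\<And>s. s \<in> {0..T} \<Longrightarrow> (A has_real_derivative (g s)\<^sup>2) (at s within {0..T})"
begin

text \<open>\<open>A\<close> is an antiderivative of \<open>g\<^sup>2\<close>, so
  \<open>q * (A t - A 0)\<close> is the variance to be expected of the integral. It will be
  instantiated with \<open>a\<^sup>2\<close>.\<close>

lemma mean_value:
  assumes "0 \<le> r" "r \<le> t" "t \<le> T"
  obtains z where "r \<le> z" "z \<le> t" "(g z)\<^sup>2 * (t - r) = A t - A r"
proof -
  have "\<exists>z\<in>{r..t}. A t - A r = (\<lambda>h. (g z)\<^sup>2 * h) (t - r)"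
  proof (rule mvt_very_simple)
    fix z assume "r \<le> z" "z \<le> t"
    then have "(A has_derivative (\<lambda>h. (g z)\<^sup>2 * h)) (at z within {0..T})"
      using A_deriv[of z] assms by (simp add: has_field_derivative_def)
    then show "(A has_derivative (\<lambda>h. (g z)\<^sup>2 * h)) (at z within {r..t})"
      by (rule has_derivative_subset) (use assms in auto)
  qed (use assms in auto)
  then show ?thesis using that by force
qed

text \<open>With these nodes the quadratic variation sums telescope exactly, so that no Riemann sums of \<open>g\<^sup>2\<close> are needed.\<close>

lemma mean_value_nodes:
  obtains \<xi> where "\<And>m i. i < Suc m \<Longrightarrow> grid T m i \<le> \<xi> m i \<and> \<xi> m i \<le> grid T m (Suc i)"
    "\<And>m i. i < Suc m \<Longrightarrow> (g (\<xi> m i))\<^sup>2 * (grid T m (Suc i) - grid T m i) = A (grid T m (Suc i)) - A (grid T m i)"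
proof -
  have "\<exists>z. grid T m i \<le> z \<and> z \<le> grid T m (Suc i) \<and>
     (g z)\<^sup>2 * (grid T m (Suc i) - grid T m i) = A (grid T m (Suc i)) - A (grid T m i)" if "i < Suc m" for m i
    using mean_value[of "grid T m i" "grid T m (Suc i)"] grid_nonneg[OF horizon, of m i]
      grid_mono[OF horizon, of i "Suc i" m] grid_le[OF horizon, of "Suc i" m] that by (metis Suc_leI le_Suc_eq order_refl)
  then have "\<exists>\<xi>. \<forall>m i. i < Suc m \<longrightarrow> grid T m i \<le> \<xi> m i \<and> \<xi> m i \<le> grid T m (Suc i) \<and>
     (g (\<xi> m i))\<^sup>2 * (grid T m (Suc i) - grid T m i) = A (grid T m (Suc i)) - A (grid T m i)"
    by (intro choice allI) blast
  then show ?thesis using that by blast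
qed

lemma step_sums_tendsto_wiener_integral:
  assumes \<xi>: "\<And>m i. i < Suc m \<Longrightarrow> grid T m i \<le> \<xi> m i \<and> \<xi> m i \<le> grid T m (Suc i)"
    and t: "t \<in> {0..T}" and j: "\<And>m. j m \<le> Suc m" "(\<lambda>m. grid T m (j m)) \<longlonglongrightarrow> t"
    and \<omega>: "continuous_on {0..T} (\<lambda>t. w t \<omega>)" "w 0 \<omega> = 0"
  shows "(\<lambda>m. ennreal ((step_sum (grid T m) (\<lambda>i. g (\<xi> m i)) \<omega> (j m))\<^sup>2))
    \<longlonglongrightarrow> ennreal ((wiener_integral g g' t \<omega>)\<^sup>2)"
proof -
  have "(\<lambda>m. step_sum (grid T m) (\<lambda>i. g (\<xi> m i)) \<omega> (j m)) \<longlonglongrightarrow> wiener_integral g g' t \<omega>"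
    using stieltjes_sums_tendsto[OF horizon g_deriv g'_cont \<omega>(1) t j \<xi>] \<omega>(2)
    by (simp add: step_sum_def wiener_integral_def)
  then show ?thesis by (intro tendsto_ennrealI tendsto_power)
qed

lemma quadratic_variation_sum:
  assumes "\<And>m i. i < Suc m \<Longrightarrow> (g (\<xi> m i))\<^sup>2 * (grid T m (Suc i) - grid T m i) = A (grid T m (Suc i)) - A (grid T m i)"
    and "j \<le> Suc m"
  shows "(\<Sum>i<j. (g (\<xi> m i))\<^sup>2 * (grid T m (Suc i) - grid T m i)) = A (grid T m j) - A 0"
proof -
  have "(\<Sum>i<j. (g (\<xi> m i))\<^sup>2 * (grid T m (Suc i) - grid T m i)) = (\<Sum>i<j. A (grid T m (Suc i)) - A (grid T m i))"
    using assms by (intro sum.cong) auto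
  also have "\<dots> = A (grid T m j) - A (grid T m 0)" by (rule sum_lessThan_telescope)
  finally show ?thesis by simp
qed

text \<open>The majorant is the liminf of the squared running maxima over the grids, and Fatou's
  lemma carries Doob's bound over to it. Every \<open>t\<close> is a limit of grid points, each
  covered by the maximum over its own grid, so one exceptional set serves all
  \<open>t\<close>.\<close>

lemma wiener_integral_sup_bound:
  obtains Z where "Z \<in> borel_measurable N" "(\<integral>\<^sup>+\<omega>. Z \<omega> \<partial>N) \<le> ennreal (4 * q * (A T - A 0))"
    "AE \<omega> in N. \<forall>t\<in>{0..T}. ennreal ((wiener_integral g g' t \<omega>)\<^sup>2) \<le> Z \<omega>"
proof -
  obtain \<xi> where \<xi>: "\<And>m i. i < Suc m \<Longrightarrow> grid T m i \<le> \<xi> m i \<and> \<xi> m i \<le> grid T m (Suc i)"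
    "\<And>m i. i < Suc m \<Longrightarrow> (g (\<xi> m i))\<^sup>2 * (grid T m (Suc i) - grid T m i) = A (grid T m (Suc i)) - A (grid T m i)"
    using mean_value_nodes by blast
  define S where "S m \<omega> = step_sum (grid T m) (\<lambda>i. g (\<xi> m i)) \<omega>" for m \<omega>
  define R where "R m \<omega> = ennreal ((running_max (\<lambda>k. \<bar>S m \<omega> k\<bar>) (Suc m))\<^sup>2)" for m \<omega>
  have part: "mono (grid T m)" "0 \<le> grid T m 0" "grid T m (Suc m) \<le> T" for m
    using grid_mono[OF horizon] by (auto simp: mono_def)
  have meas: "R m \<in> borel_measurable N" for m
    unfolding R_def S_def using running_max_measurable[OF part order_refl] by simp
  have bound: "(\<integral>\<^sup>+\<omega>. R m \<omega> \<partial>N) \<le> ennreal (4 * q * (A T - A 0))" for m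
    unfolding R_def S_def
    using doob_step_sum[OF part, of m "\<lambda>i. g (\<xi> m i)"] quadratic_variation_sum[OF \<xi>(2), of "Suc m" m] by simp
  show thesis
  proof
    show "(\<lambda>\<omega>. liminf (\<lambda>m. R m \<omega>)) \<in> borel_measurable N" using meas by simp
    have "(\<integral>\<^sup>+\<omega>. liminf (\<lambda>m. R m \<omega>) \<partial>N) \<le> liminf (\<lambda>m. \<integral>\<^sup>+\<omega>. R m \<omega> \<partial>N)"
      using meas by (rule nn_integral_liminf)
    also have "\<dots> \<le> ennreal (4 * q * (A T - A 0))"
      using bound by (intro Liminf_le) auto
    finally show "(\<integral>\<^sup>+\<omega>. liminf (\<lambda>m. R m \<omega>) \<partial>N) \<le> ennreal (4 * q * (A T - A 0))" .
    show "AE \<omega> in N. \<forall>t\<in>{0..T}. ennreal ((wiener_integral g g' t \<omega>)\<^sup>2) \<le> liminf (\<lambda>m. R m \<omega>)"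
      using start cont
    proof eventually_elim
      case (elim \<omega>)
      show ?case
      proof
        fix t assume t: "t \<in> {0..T}"
        obtain j where j: "\<And>m. j m \<le> Suc m" "\<And>m. grid T m (j m) \<le> t" "(\<lambda>m. grid T m (j m)) \<longlonglongrightarrow> t"
          using grid_approximates[OF T_pos t] by blast
        have "ennreal ((wiener_integral g g' t \<omega>)\<^sup>2) = liminf (\<lambda>m. ennreal ((S m \<omega> (j m))\<^sup>2))"
          unfolding S_def
          by (intro lim_imp_Liminf[symmetric] sequentially_bot step_sums_tendsto_wiener_integral \<xi>(1) t j(1,3) elim)
        also have "\<dots> \<le> liminf (\<lambda>m. R m \<omega>)"
        proof (intro Liminf_mono always_eventually allI)
          fix m
          have "\<bar>S m \<omega> (j m)\<bar> \<le> running_max (\<lambda>k. \<bar>S m \<omega> k\<bar>) (Suc m)"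
            using running_max_ge[OF j(1), of "\<lambda>k. \<bar>S m \<omega> k\<bar>"] .
          then have "(S m \<omega> (j m))\<^sup>2 \<le> (running_max (\<lambda>k. \<bar>S m \<omega> k\<bar>) (Suc m))\<^sup>2"
            by (simp add: abs_le_square_iff[symmetric])
          then show "ennreal ((S m \<omega> (j m))\<^sup>2) \<le> R m \<omega>" unfolding R_def by (rule ennreal_leI)
        qed
        finally show "ennreal ((wiener_integral g g' t \<omega>)\<^sup>2) \<le> liminf (\<lambda>m. R m \<omega>)" .
      qed
    qed
  qed
qed

text \<open>At a fixed time no maximum is taken, hence no factor 4: Fatou's lemma is applied
  directly to the squared sums up to grid points below \<open>t\<close>.\<close>

lemma wiener_integral_bound:
  assumes t: "t \<in> {0..T}"
  obtains Z where "Z \<in> borel_measurable N" "(\<integral>\<^sup>+\<omega>. Z \<omega> \<partial>N) \<le> ennreal (q * (A t - A 0))"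
    "AE \<omega> in N. ennreal ((wiener_integral g g' t \<omega>)\<^sup>2) \<le> Z \<omega>"
proof -
  obtain \<xi> where \<xi>: "\<And>m i. i < Suc m \<Longrightarrow> grid T m i \<le> \<xi> m i \<and> \<xi> m i \<le> grid T m (Suc i)"
    "\<And>m i. i < Suc m \<Longrightarrow> (g (\<xi> m i))\<^sup>2 * (grid T m (Suc i) - grid T m i) = A (grid T m (Suc i)) - A (grid T m i)"
    using mean_value_nodes by blast
  obtain j where j: "\<And>m. j m \<le> Suc m" "\<And>m. grid T m (j m) \<le> t" "(\<lambda>m. grid T m (j m)) \<longlonglongrightarrow> t"
    using grid_approximates[OF T_pos t] by blast
  define R where "R m \<omega> = ennreal ((step_sum (grid T m) (\<lambda>i. g (\<xi> m i)) \<omega> (j m))\<^sup>2)" for m \<omega>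
  have part: "mono (grid T m)" "0 \<le> grid T m 0" "grid T m (Suc m) \<le> T" for m
    using grid_mono[OF horizon] by (auto simp: mono_def)
  have square: "has_bochner_integral N (\<lambda>\<omega>. (step_sum (grid T m) (\<lambda>i. g (\<xi> m i)) \<omega> (j m))\<^sup>2)
      (q * (A (grid T m (j m)) - A 0))" for m
    using step_sum_square[where p="grid T m" and m="Suc m" and j="j m" and c="\<lambda>i. g (\<xi> m i)", OF part j(1)] quadratic_variation_sum[OF \<xi>(2) j(1)] by simp
  then have meas: "R m \<in> borel_measurable N" for m
    unfolding R_def by (intro measurable_compose[OF _ measurable_ennreal] borel_measurable_has_bochner_integral)
  have bound: "(\<integral>\<^sup>+\<omega>. R m \<omega> \<partial>N) \<le> ennreal (q * (A t - A 0))" for m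
  proof -
    have "(\<integral>\<^sup>+\<omega>. R m \<omega> \<partial>N) = ennreal (q * (A (grid T m (j m)) - A 0))"
      unfolding R_def using square[of m] by (simp add: nn_integral_eq_integral has_bochner_integral_iff)
    \<comment> \<open>\<open>A\<close> increases because its derivative is a square.\<close>
    moreover have "A (grid T m (j m)) \<le> A t"
      using mean_value[of "grid T m (j m)" t] grid_nonneg[OF horizon, of m "j m"] j(2)[of m] t
      by (metis atLeastAtMost_iff diff_ge_0_iff_ge mult_nonneg_nonneg zero_le_power2)
    ultimately show ?thesis using q_nonneg by (auto intro!: ennreal_leI mult_left_mono)
  qed
  show thesis
  proof
    show "(\<lambda>\<omega>. liminf (\<lambda>m. R m \<omega>)) \<in> borel_measurable N" using meas by simp
    have "(\<integral>\<^sup>+\<omega>. liminf (\<lambda>m. R m \<omega>) \<partial>N) \<le> liminf (\<lambda>m. \<integral>\<^sup>+\<omega>. R m \<omega> \<partial>N)"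
      using meas by (rule nn_integral_liminf)
    also have "\<dots> \<le> ennreal (q * (A t - A 0))"
      using bound by (intro Liminf_le) auto
    finally show "(\<integral>\<^sup>+\<omega>. liminf (\<lambda>m. R m \<omega>) \<partial>N) \<le> ennreal (q * (A t - A 0))" .
    show "AE \<omega> in N. ennreal ((wiener_integral g g' t \<omega>)\<^sup>2) \<le> liminf (\<lambda>m. R m \<omega>)"
      using start cont
    proof eventually_elim
      case (elim \<omega>)
      have "liminf (\<lambda>m. R m \<omega>) = ennreal ((wiener_integral g g' t \<omega>)\<^sup>2)"
        unfolding R_def
        by (intro lim_imp_Liminf sequentially_bot step_sums_tendsto_wiener_integral \<xi>(1) t j(1,3) elim)
      then show ?case by simp
    qed
  qed
qed

end

end

subsection \<open>The Ito integral of a smooth deterministic function\<close>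

lemma grid_cell:
  assumes "0 < r" "r \<le> t"
  obtains i where "i < Suc m" "grid t m i < r" "r \<le> grid t m (Suc i)"
proof -
  define k where "k = (LEAST k. r \<le> grid t m k)"
  have last: "r \<le> grid t m (Suc m)" using assms by simp
  then have k: "r \<le> grid t m k" "k \<le> Suc m"
    unfolding k_def by (rule LeastI, rule Least_le)
  moreover have "k \<noteq> 0" using k(1) assms(1) by (intro notI) simp
  ultimately obtain i where i: "k = Suc i" by (cases k) auto
  have "\<not> r \<le> grid t m i" using not_less_Least[of i "\<lambda>k. r \<le> grid t m k"] i unfolding k_def by simp
  then show ?thesis using that[of i] k i by auto
qed

lemma sum_grid_indicator:
  fixes c :: "nat \<Rightarrow> real"
  assumes "i < Suc m" "grid t m i < r" "r \<le> grid t m (Suc i)" "0 \<le> t"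
  shows "(\<Sum>k<Suc m. c k * indicator {grid t m k<..grid t m (Suc k)} r) = c i"
proof -
  have "c k * indicator {grid t m k<..grid t m (Suc k)} r = (if k = i then c i else 0)" for k
  proof (cases k i rule: linorder_cases)
    case less
    then have "grid t m (Suc k) \<le> grid t m i" by (intro grid_mono assms) auto
    then show ?thesis using less assms by auto
  next
    case greater
    then have "grid t m (Suc i) \<le> grid t m k" by (intro grid_mono assms) auto
    then show ?thesis using greater assms by auto
  qed (use assms in auto)
  then show ?thesis using assms(1) by simp
qed

lemma ennreal_square_diff_le:
  fixes a b c :: real
  shows "ennreal ((a - c)\<^sup>2) \<le> 2 * ennreal ((b - a)\<^sup>2) + 2 * ennreal ((b - c)\<^sup>2)"
proof -
  have "(a - c)\<^sup>2 \<le> 2 * (b - a)\<^sup>2 + 2 * (b - c)\<^sup>2"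
    using zero_le_power2[of "2 * b - a - c"] by (simp add: power2_eq_square algebra_simps)
  then have "ennreal ((a - c)\<^sup>2) \<le> ennreal (2 * (b - a)\<^sup>2 + 2 * (b - c)\<^sup>2)" by (rule ennreal_leI)
  then show ?thesis by (simp add: ennreal_plus ennreal_mult)
qed

text \<open>The grid divides \<open>{0..t}\<close> rather than the whole horizon, so that the
  elementary integral stopped at \<open>t\<close> is the full sum over all cells.\<close>

definition step_process :: "(real \<Rightarrow> real) \<Rightarrow> real \<Rightarrow> nat \<Rightarrow> 'w elementary" where
  "step_process f t m = map (\<lambda>i. (grid t m i, grid t m (Suc i), \<lambda>_. f (grid t m i))) [0..<Suc m]"

text \<open>Since list entries may overlap, a difference of elementary processes is concatenation
  with a negated list. This makes the isometry available for differences.\<close>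

definition neg_elementary :: "'w elementary \<Rightarrow> 'w elementary" where
  "neg_elementary E = map (\<lambda>(s, u, \<phi>). (s, u, \<lambda>\<omega>. - \<phi> \<omega>)) E"

lemma elementary_append_neg:
  "elementary_process (D @ neg_elementary E) r \<omega> = elementary_process D r \<omega> - elementary_process E r \<omega>"
  "elementary_integral (D @ neg_elementary E) V t \<omega> = elementary_integral D V t \<omega> - elementary_integral E V t \<omega>"
proof -
  have "elementary_process (neg_elementary E) r \<omega> = - elementary_process E r \<omega>"
    by (induction E) (auto simp: elementary_process_def neg_elementary_def)
  then show "elementary_process (D @ neg_elementary E) r \<omega> = elementary_process D r \<omega> - elementary_process E r \<omega>"
    by (simp add: elementary_process_def)
  have "elementary_integral (neg_elementary E) V t \<omega> = - elementary_integral E V t \<omega>"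
    by (induction E) (auto simp: elementary_integral_def neg_elementary_def)
  then show "elementary_integral (D @ neg_elementary E) V t \<omega> = elementary_integral D V t \<omega> - elementary_integral E V t \<omega>"
    by (simp add: elementary_integral_def)
qed

lemma is_elementary_append_neg:
  "is_elementary M F T D \<Longrightarrow> is_elementary M F T E \<Longrightarrow> is_elementary M F T (D @ neg_elementary E)"
  unfolding is_elementary_def neg_elementary_def by fastforce

lemma step_process_approximates:
  assumes t: "0 \<le> t" and f: "continuous_on {0..t} f"
  shows "(\<lambda>m. \<integral>\<^sup>+r\<in>{0..t}. ennreal ((f r - elementary_process (step_process f t m) r \<omega>)\<^sup>2) \<partial>lborel) \<longlonglongrightarrow> 0"
proof (rule tendsto_0_if_Limsup_eq_0_ennreal)
  have eq: "elementary_process (step_process f t m) r \<omega>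
      = (\<Sum>i<Suc m. f (grid t m i) * indicator {grid t m i<..grid t m (Suc i)} r)" for m r
    unfolding elementary_process_def step_process_def
    by (simp add: interv_sum_list_conv_sum_set_nat lessThan_atLeast0 comp_def del: upt_Suc)
  have ucont: "uniformly_continuous_on {0..t} f"
    by (rule compact_uniformly_continuous[OF f compact_Icc])
  have ev: "\<forall>\<^sub>F m in sequentially. (\<integral>\<^sup>+r\<in>{0..t}. ennreal ((f r - elementary_process (step_process f t m) r \<omega>)\<^sup>2) \<partial>lborel)
      \<le> ennreal (\<epsilon>\<^sup>2 * t)" if \<epsilon>: "0 < \<epsilon>" for \<epsilon>
  proof -
    obtain d where d: "0 < d" "\<And>s s'. s \<in> {0..t} \<Longrightarrow> s' \<in> {0..t} \<Longrightarrow> dist s' s < d \<Longrightarrow> dist (f s') (f s) < \<epsilon>"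
      using ucont \<epsilon> unfolding uniformly_continuous_on_def by metis
    obtain n where n: "t / d < real n" using reals_Archimedean2 by blast
    have "(\<integral>\<^sup>+r\<in>{0..t}. ennreal ((f r - elementary_process (step_process f t m) r \<omega>)\<^sup>2) \<partial>lborel)
      \<le> ennreal (\<epsilon>\<^sup>2 * t)" if "n \<le> m" for m
    proof -
      have "t / d < real (Suc m)" using n that by linarith
      then have step: "t / real (Suc m) < d" using d(1) by (simp add: field_simps)
      have bd: "(f r - elementary_process (step_process f t m) r \<omega>)\<^sup>2 \<le> \<epsilon>\<^sup>2" if r: "0 < r" "r \<le> t" for r
      proof -
        obtain i where i: "i < Suc m" "grid t m i < r" "r \<le> grid t m (Suc i)" using grid_cell[OF r] by blast
        have "dist r (grid t m i) < d" using i step grid_step[of t m i] by (auto simp: dist_real_def)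
        then have "dist (f r) (f (grid t m i)) < \<epsilon>"
          using i r by (intro d(2)) (auto intro: grid_nonneg t)
        then have "\<bar>f r - elementary_process (step_process f t m) r \<omega>\<bar> \<le> \<bar>\<epsilon>\<bar>"
          unfolding eq sum_grid_indicator[OF i t] by (simp add: dist_real_def)
        then show ?thesis by (simp add: abs_le_square_iff)
      qed
      have "(\<integral>\<^sup>+r\<in>{0..t}. ennreal ((f r - elementary_process (step_process f t m) r \<omega>)\<^sup>2) \<partial>lborel)
        \<le> (\<integral>\<^sup>+r. ennreal (\<epsilon>\<^sup>2) * indicator {0..t} r \<partial>lborel)"
      proof (rule nn_integral_mono_AE)
        \<comment> \<open>The half-open cells leave out the point 0, where the step process
          vanishes.\<close>
        have "AE r in lborel. r \<noteq> (0::real)" by (rule AE_lborel_singleton)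
        then show "AE r in lborel. ennreal ((f r - elementary_process (step_process f t m) r \<omega>)\<^sup>2) * indicator {0..t} r
          \<le> ennreal (\<epsilon>\<^sup>2) * indicator {0..t} r"
          by eventually_elim (auto split: split_indicator intro!: ennreal_leI bd)
      qed
      also have "\<dots> = ennreal (\<epsilon>\<^sup>2) * emeasure lborel {0..t}" by (simp add: nn_integral_cmult_indicator)
      also have "\<dots> = ennreal (\<epsilon>\<^sup>2 * t)" using t by (simp add: ennreal_mult)
      finally show ?thesis .
    qed
    then show ?thesis unfolding eventually_sequentially by blast
  qed
  let ?V = "\<lambda>m. \<integral>\<^sup>+r\<in>{0..t}. ennreal ((f r - elementary_process (step_process f t m) r \<omega>)\<^sup>2) \<partial>lborel"
  have "limsup ?V \<le> ennreal (\<epsilon>\<^sup>2 * t)" if "0 < \<epsilon>" for \<epsilon>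
    by (rule Limsup_bounded[OF ev[OF that]])
  then have lim: "limsup ?V \<le> ennreal \<eta>" if "0 < \<eta>" for \<eta>
  proof -
    \<comment> \<open>The summand 1 in the choice of \<open>\<epsilon>\<close> covers
      \<open>t = 0\<close>.\<close>
    have "(sqrt (\<eta> / (t + 1)))\<^sup>2 * t \<le> \<eta>" using that t by (simp add: field_simps)
    then show ?thesis
      using \<open>\<And>\<epsilon>. 0 < \<epsilon> \<Longrightarrow> limsup ?V \<le> ennreal (\<epsilon>\<^sup>2 * t)\<close>[of "sqrt (\<eta> / (t + 1))"] that t
      by (auto intro: order_trans ennreal_leI)
  qed
  have "limsup ?V \<le> 0"
    by (rule ennreal_le_epsilon) (simp add: lim)
  then show "limsup ?V = 0" by simp
qed

section \<open>Identification of the Ito integral with the pathwise integral\<close>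

context scalar_noise
begin

text \<open>Joint measurability makes the inner time integral measurable in \<open>\<omega>\<close>,
  which is what splitting the outer integral of a sum requires.\<close>

lemma elementary_process_measurable:
  assumes "is_elementary N F T E"
  shows "(\<lambda>(\<omega>, r). elementary_process E r \<omega>) \<in> borel_measurable (N \<Otimes>\<^sub>M lborel)"
  using assms
proof (induction E)
  case Nil
  then show ?case by (simp add: elementary_process_def)
next
  case (Cons x E)
  obtain s u \<phi> where x: "x = (s, u, \<phi>)" by (cases x)
  have [measurable]: "\<phi> \<in> borel_measurable N"
  proof -
    have "0 \<le> s" "s \<le> T" "\<phi> \<in> borel_measurable (F s)"
      using Cons.prems by (auto simp: is_elementary_def x)
    then show ?thesis by (intro measurable_N[of \<phi> s])
  qed
  have [measurable]: "(\<lambda>(\<omega>, r). elementary_process E r \<omega>) \<in> borel_measurable (N \<Otimes>\<^sub>M lborel)"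
    using Cons by (simp add: is_elementary_def)
  have "(\<lambda>(\<omega>, r). \<phi> \<omega> * indicator {s<..u} r + elementary_process E r \<omega>) \<in> borel_measurable (N \<Otimes>\<^sub>M lborel)"
    unfolding split_beta' using \<open>(\<lambda>(\<omega>, r). elementary_process E r \<omega>) \<in> _\<close>[unfolded split_beta']
    by (intro borel_measurable_add borel_measurable_times) measurable
  then show ?case by (simp add: elementary_process_def x)
qed

lemma elementary_integral_measurable:
  assumes "is_elementary N F T E" "t \<in> {0..T}"
  shows "elementary_integral E w t \<in> borel_measurable N"
  using assms(1)
proof (induction E)
  case Nil
  then show ?case by (simp add: elementary_integral_def[abs_def])
next
  case (Cons x E)
  obtain s u \<phi> where x: "x = (s, u, \<phi>)" by (cases x)
  have su: "0 \<le> s" "s \<le> u" "u \<le> T" and \<phi>: "\<phi> \<in> borel_measurable (F s)"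
    using Cons.prems by (auto simp: is_elementary_def x)
  have [measurable]: "\<phi> \<in> borel_measurable N" using su by (intro measurable_N[OF \<phi>]) auto
  have [measurable]: "w (min u t) \<in> borel_measurable N" "w (min s t) \<in> borel_measurable N"
    using su assms(2) by (auto intro!: w_measurable)
  have "elementary_integral E w t \<in> borel_measurable N"
    using Cons by (simp add: is_elementary_def)
  then have "(\<lambda>\<omega>. \<phi> \<omega> * (w (min u t) \<omega> - w (min s t) \<omega>) + elementary_integral E w t \<omega>) \<in> borel_measurable N"
    by measurable
  then show ?case by (simp add: elementary_integral_def[abs_def] x)
qed

lemma step_process_elementary:
  assumes "t \<in> {0..T}"
  shows "is_elementary N F T (step_process f t m)"
proof -
  have "\<exists>c. \<forall>\<omega>\<in>space N. \<bar>f r\<bar> \<le> c" for r by blast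
  then show ?thesis
    using assms grid_le[of t _ m] grid_mono[of t _ _ m] order_trans[OF grid_le[of t _ m], of _ T]
    unfolding is_elementary_def step_process_def
    by (auto simp del: upt_Suc simp: grid_nonneg)
qed

lemma step_process_integral:
  assumes "0 \<le> t"
  shows "elementary_integral (step_process f t m) w t \<omega>
    = (\<Sum>i<Suc m. f (grid t m i) * (w (grid t m (Suc i)) \<omega> - w (grid t m i) \<omega>))"
proof -
  have "elementary_integral (step_process f t m) w t \<omega>
    = (\<Sum>i<Suc m. f (grid t m i) * (w (min (grid t m (Suc i)) t) \<omega> - w (min (grid t m i) t) \<omega>))"
    unfolding elementary_integral_def step_process_def
    by (simp add: interv_sum_list_conv_sum_set_nat lessThan_atLeast0 comp_def del: upt_Suc sum.op_ivl_Suc)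
  also have "\<dots> = (\<Sum>i<Suc m. f (grid t m i) * (w (grid t m (Suc i)) \<omega> - w (grid t m i) \<omega>))"
    using grid_le[OF assms] by (intro sum.cong refl) (simp add: min_absorb1)
  finally show ?thesis .
qed

text \<open>
  The approximating \<open>E m\<close> are arbitrary adapted elementary processes; by the isometry their integrals are
  close in \<open>L\<^sup>2\<close> to the Riemann--Stieltjes sums of \<open>f\<close>, which converge pathwise.
\<close>

lemma ito_integral_eq_wiener_integral:
  assumes f: "\<And>s. s \<in> {0..T} \<Longrightarrow> (f has_real_derivative f' s) (at s within {0..T})"
    and f': "continuous_on {0..T} f'"
    and t: "t \<in> {0..T}"
    and E: "\<And>m. is_elementary N F T (E m)"
    and approx: "(\<lambda>m. \<integral>\<^sup>+\<omega>. (\<integral>\<^sup>+r\<in>{0..T}. ennreal ((f r - elementary_process (E m) r \<omega>)\<^sup>2) \<partial>lborel) \<partial>N) \<longlonglongrightarrow> 0"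
    and I: "I \<in> borel_measurable N"
      "(\<lambda>m. \<integral>\<^sup>+\<omega>. ennreal ((I \<omega> - elementary_integral (E m) w t \<omega>)\<^sup>2) \<partial>N) \<longlonglongrightarrow> 0"
  shows "AE \<omega> in N. I \<omega> = wiener_integral f f' t \<omega>"
proof -
  define D :: "nat \<Rightarrow> 'w elementary" where "D = step_process f t"
  define S where "S m = elementary_integral (D m) w t" for m
  define J where "J m = elementary_integral (E m) w t" for m
  define U where "U m = (\<integral>\<^sup>+\<omega>. (\<integral>\<^sup>+r\<in>{0..T}. ennreal ((f r - elementary_process (E m) r \<omega>)\<^sup>2) \<partial>lborel) \<partial>N)" for m
  \<comment> \<open>The step process is deterministic, so any sample point may be inserted;
    \<open>undefined\<close> serves as one.\<close>
  define V where "V m = (\<integral>\<^sup>+r\<in>{0..t}. ennreal ((f r - elementary_process (D m) r undefined)\<^sup>2) \<partial>lborel)" for m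
  have D: "is_elementary N F T (D m)" for m
    unfolding D_def by (rule step_process_elementary[OF t])
  have Dconst: "elementary_process (D m) r \<omega> = elementary_process (D m) r undefined" for m r \<omega>
    unfolding D_def elementary_process_def step_process_def by (simp add: comp_def del: upt_Suc)
  have contf: "continuous_on {0..T} f" using f DERIV_continuous_on by blast
  have Smeas [measurable]: "S m \<in> borel_measurable N" and Jmeas [measurable]: "J m \<in> borel_measurable N" for m
    unfolding S_def J_def using elementary_integral_measurable[OF D t] elementary_integral_measurable[OF E t] by auto
  note [measurable] = I(1)
  \<comment> \<open>\<open>f\<close> is controlled only on \<open>{0..T}\<close>. Cut off outside,
    it is Borel measurable on the whole line.\<close>
  define fT where "fT r = indicator {0..T} r *\<^sub>R f r" for r
  have fT [measurable]: "fT \<in> borel_measurable borel"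
    unfolding fT_def using contf by (intro borel_measurable_continuous_on_indicator) auto
  have V0: "V \<longlonglongrightarrow> 0"
    unfolding V_def D_def using t by (intro step_process_approximates continuous_on_subset[OF contf]) auto
  \<comment> \<open>The isometry is applied to the difference of the arbitrary \<open>E m\<close>
    and the step process. Both are close to \<open>f\<close>, the first on \<open>{0..T}\<close>,
    the second on \<open>{0..t}\<close>.\<close>
  have JS: "(\<integral>\<^sup>+\<omega>. ennreal ((J m \<omega> - S m \<omega>)\<^sup>2) \<partial>N) \<le> ennreal q * (2 * U m + 2 * V m)" for m
  proof -
    have [measurable]: "(\<lambda>(\<omega>, r). elementary_process (E m) r \<omega>) \<in> borel_measurable (N \<Otimes>\<^sub>M lborel)"
      "(\<lambda>(\<omega>, r). elementary_process (D m) r \<omega>) \<in> borel_measurable (N \<Otimes>\<^sub>M lborel)"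
      by (intro elementary_process_measurable E D)+
    have [measurable]: "(\<lambda>r. elementary_process (E m) r \<omega>) \<in> borel_measurable lborel" if "\<omega> \<in> space N" for \<omega>
      using measurable_Pair2[OF elementary_process_measurable[OF E[of m]] that] by simp
    have [measurable]: "(\<lambda>r. elementary_process (D m) r undefined) \<in> borel_measurable lborel"
    proof -
      obtain \<omega> where "\<omega> \<in> space N" using not_empty by blast
      from measurable_Pair2[OF elementary_process_measurable[OF D[of m]] this] show ?thesis
        by (simp add: Dconst[of m _ \<omega>])
    qed
    have "(\<integral>\<^sup>+\<omega>. ennreal ((J m \<omega> - S m \<omega>)\<^sup>2) \<partial>N) = ennreal q *
      (\<integral>\<^sup>+\<omega>. (\<integral>\<^sup>+r\<in>{0..t}. ennreal ((elementary_process (E m) r \<omega> - elementary_process (D m) r \<omega>)\<^sup>2) \<partial>lborel) \<partial>N)"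
      using ito_isometry_elementary[OF is_elementary_append_neg[OF E D] t]
      by (simp add: elementary_append_neg J_def S_def)
    also have "(\<integral>\<^sup>+\<omega>. (\<integral>\<^sup>+r\<in>{0..t}. ennreal ((elementary_process (E m) r \<omega> - elementary_process (D m) r \<omega>)\<^sup>2) \<partial>lborel) \<partial>N)
      \<le> (\<integral>\<^sup>+\<omega>. 2 * (\<integral>\<^sup>+r\<in>{0..T}. ennreal ((fT r - elementary_process (E m) r \<omega>)\<^sup>2) \<partial>lborel) + 2 * V m \<partial>N)"
    proof (rule nn_integral_mono)
      fix \<omega> assume \<omega>: "\<omega> \<in> space N"
      have V_eq: "V m = (\<integral>\<^sup>+r\<in>{0..t}. ennreal ((fT r - elementary_process (D m) r undefined)\<^sup>2) \<partial>lborel)"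
        unfolding V_def using t by (intro nn_integral_cong) (auto simp: fT_def split: split_indicator)
      have "(\<integral>\<^sup>+r\<in>{0..t}. ennreal ((elementary_process (E m) r \<omega> - elementary_process (D m) r \<omega>)\<^sup>2) \<partial>lborel)
        \<le> (\<integral>\<^sup>+r. 2 * (ennreal ((fT r - elementary_process (E m) r \<omega>)\<^sup>2) * indicator {0..T} r)
          + 2 * (ennreal ((fT r - elementary_process (D m) r undefined)\<^sup>2) * indicator {0..t} r) \<partial>lborel)"
        using t by (intro nn_integral_mono) (auto simp: Dconst[of m _ \<omega>] split: split_indicator intro: ennreal_square_diff_le)
      also have "\<dots> = 2 * (\<integral>\<^sup>+r\<in>{0..T}. ennreal ((fT r - elementary_process (E m) r \<omega>)\<^sup>2) \<partial>lborel) + 2 * V m"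
        unfolding V_eq using \<omega> by (simp add: nn_integral_add nn_integral_cmult)
      finally show "(\<integral>\<^sup>+r\<in>{0..t}. ennreal ((elementary_process (E m) r \<omega> - elementary_process (D m) r \<omega>)\<^sup>2) \<partial>lborel)
        \<le> 2 * (\<integral>\<^sup>+r\<in>{0..T}. ennreal ((fT r - elementary_process (E m) r \<omega>)\<^sup>2) \<partial>lborel) + 2 * V m" .
    qed
    also have "\<dots> = 2 * (\<integral>\<^sup>+\<omega>. (\<integral>\<^sup>+r\<in>{0..T}. ennreal ((fT r - elementary_process (E m) r \<omega>)\<^sup>2) \<partial>lborel) \<partial>N) + 2 * V m"
      by (subst nn_integral_add) (auto simp: nn_integral_cmult emeasure_space_1)
    also have "(\<integral>\<^sup>+\<omega>. (\<integral>\<^sup>+r\<in>{0..T}. ennreal ((fT r - elementary_process (E m) r \<omega>)\<^sup>2) \<partial>lborel) \<partial>N) = U m"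
      unfolding U_def by (intro nn_integral_cong) (auto simp: fT_def split: split_indicator)
    finally show ?thesis by (simp add: mult_left_mono)
  qed
  define B where "B m = 2 * (\<integral>\<^sup>+\<omega>. ennreal ((I \<omega> - J m \<omega>)\<^sup>2) \<partial>N) + 2 * (ennreal q * (2 * U m + 2 * V m))" for m
  have "B \<longlonglongrightarrow> 2 * 0 + 2 * (ennreal q * (2 * 0 + 2 * 0))"
    unfolding B_def U_def J_def using approx I(2) V0
    by (intro tendsto_add ennreal_tendsto_cmult) auto
  then have B0: "B \<longlonglongrightarrow> 0" by simp
  have IS: "(\<integral>\<^sup>+\<omega>. ennreal ((I \<omega> - S m \<omega>)\<^sup>2) \<partial>N) \<le> B m" for m
  proof -
    have "(\<integral>\<^sup>+\<omega>. ennreal ((I \<omega> - S m \<omega>)\<^sup>2) \<partial>N)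
        \<le> (\<integral>\<^sup>+\<omega>. 2 * ennreal ((I \<omega> - J m \<omega>)\<^sup>2) + 2 * ennreal ((J m \<omega> - S m \<omega>)\<^sup>2) \<partial>N)"
      using ennreal_square_diff_le[of "I _" "S m _" "J m _"]
      by (intro nn_integral_mono) (simp add: power2_commute[of "J m _" "I _"])
    also have "\<dots> = 2 * (\<integral>\<^sup>+\<omega>. ennreal ((I \<omega> - J m \<omega>)\<^sup>2) \<partial>N) + 2 * (\<integral>\<^sup>+\<omega>. ennreal ((J m \<omega> - S m \<omega>)\<^sup>2) \<partial>N)"
      by (simp add: nn_integral_add nn_integral_cmult)
    also have "\<dots> \<le> B m" unfolding B_def using JS[of m] by (intro add_left_mono mult_left_mono) auto
    finally show ?thesis .
  qed
  \<comment> \<open>Fatou's lemma replaces the choice of an almost surely convergent subsequence: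
    the sums \<open>S m\<close> converge pathwise, so this liminf is the squared distance of
    \<open>I\<close> from their limit.\<close>
  have "(\<integral>\<^sup>+\<omega>. liminf (\<lambda>m. ennreal ((I \<omega> - S m \<omega>)\<^sup>2)) \<partial>N) \<le> liminf (\<lambda>m. \<integral>\<^sup>+\<omega>. ennreal ((I \<omega> - S m \<omega>)\<^sup>2) \<partial>N)"
    by (rule nn_integral_liminf) measurable
  also have "\<dots> \<le> liminf B" using IS by (intro Liminf_mono always_eventually) auto
  also have "\<dots> = 0" using B0 by (intro lim_imp_Liminf) auto
  finally have "AE \<omega> in N. liminf (\<lambda>m. ennreal ((I \<omega> - S m \<omega>)\<^sup>2)) = 0"
    by (subst nn_integral_0_iff_AE[symmetric]) auto
  then show ?thesis using start cont
  proof eventually_elim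
    case (elim \<omega>)
    have "(\<lambda>m. S m \<omega>) \<longlonglongrightarrow> wiener_integral f f' t \<omega>"
    proof -
      have "(\<lambda>m. \<Sum>i<Suc m. f (grid t m i) * (w (grid t m (Suc i)) \<omega> - w (grid t m i) \<omega>))
        \<longlonglongrightarrow> f t * w t \<omega> - f 0 * w 0 \<omega> - integral {0..t} (\<lambda>s. f' s * w s \<omega>)"
      proof (rule stieltjes_sums_tendsto[where T=t and \<xi>="grid t"])
        show "(f has_real_derivative f' s) (at s within {0..t})" if "s \<in> {0..t}" for s
          by (rule DERIV_subset[OF f]) (use that t in auto)
        show "continuous_on {0..t} f'" "continuous_on {0..t} (\<lambda>t. w t \<omega>)"
          using t by (auto intro: continuous_on_subset[OF f'] continuous_on_subset[OF elim(3)])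
      qed (use t in \<open>auto intro: grid_mono simp del: of_nat_Suc\<close>)
      then show ?thesis
        using t elim(2) unfolding S_def D_def wiener_integral_def by (simp add: step_process_integral del: sum.lessThan_Suc)
    qed
    then have "(\<lambda>m. ennreal ((I \<omega> - S m \<omega>)\<^sup>2)) \<longlonglongrightarrow> ennreal ((I \<omega> - wiener_integral f f' t \<omega>)\<^sup>2)"
      by (intro tendsto_ennrealI tendsto_power tendsto_diff tendsto_const)
    then have "liminf (\<lambda>m. ennreal ((I \<omega> - S m \<omega>)\<^sup>2)) = ennreal ((I \<omega> - wiener_integral f f' t \<omega>)\<^sup>2)"
      by (intro lim_imp_Liminf) auto
    then have "ennreal ((I \<omega> - wiener_integral f f' t \<omega>)\<^sup>2) = 0" using elim(1) by simp
    then show ?case by simp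
  qed
qed

end

subsection \<open>Increments of a Wiener process and the driving filtration\<close>

text \<open>For variance 0 the law is a point mass, so the moment formulas for the normal density
  cover only the other case.\<close>

lemma real_normal_moments:
  assumes "0 \<le> v"
  shows "has_bochner_integral (real_normal v) (\<lambda>x. x) 0" "has_bochner_integral (real_normal v) (\<lambda>x. x\<^sup>2) v"
proof -
  have "has_bochner_integral (real_normal v) (\<lambda>x. x) 0 \<and> has_bochner_integral (real_normal v) (\<lambda>x. x\<^sup>2) v"
  proof (cases "v = 0")
    case True
    have *: "has_bochner_integral (return borel 0) f (f 0)" if f: "f \<in> borel_measurable borel" for f :: "real \<Rightarrow> real"
    proof -
      have "integrable (return borel 0) f"
        using f by (intro integrableI_bounded) (auto simp: nn_integral_return)
      moreover have "integral\<^sup>L (return borel 0) f = f 0"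
        using f by (intro integral_return) auto
      ultimately show ?thesis unfolding has_bochner_integral_iff by blast
    qed
    have m: "(\<lambda>x::real. x) \<in> borel_measurable borel" "(\<lambda>x::real. x\<^sup>2) \<in> borel_measurable borel"
      by measurable
    have "real_normal v = return borel 0" using True by (simp add: real_normal_def)
    then show ?thesis using *[OF m(1)] *[OF m(2)] True by simp
  next
    case False
    then have v: "0 < v" using assms by simp
    have "has_bochner_integral lborel (\<lambda>x. normal_density 0 (sqrt v) x * (x - 0)) 0"
      using normal_moment_odd[of "sqrt v" 0 0] v by simp
    moreover have "has_bochner_integral lborel (\<lambda>x. normal_density 0 (sqrt v) x * (x - 0)\<^sup>2) v"
      using normal_moment_even[of "sqrt v" 0 1] v by (simp add: power2_eq_square field_simps)
    ultimately show ?thesis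
      using False by (simp add: real_normal_def has_bochner_integral_density)
  qed
  then show "has_bochner_integral (real_normal v) (\<lambda>x. x) 0" "has_bochner_integral (real_normal v) (\<lambda>x. x\<^sup>2) v"
    by auto
qed

lemma Int_stable_vimage: "Int_stable {f -` A \<inter> \<Omega> | A. A \<in> sets K}"
proof (rule Int_stableI)
  fix a b assume "a \<in> {f -` A \<inter> \<Omega> | A. A \<in> sets K}" "b \<in> {f -` A \<inter> \<Omega> | A. A \<in> sets K}"
  then obtain A B where "A \<in> sets K" "B \<in> sets K" "a = f -` A \<inter> \<Omega>" "b = f -` B \<inter> \<Omega>" by blast
  then have "A \<inter> B \<in> sets K" "a \<inter> b = f -` (A \<inter> B) \<inter> \<Omega>" by auto
  then show "a \<inter> b \<in> {f -` A \<inter> \<Omega> | A. A \<in> sets K}" by blast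
qed

lemma (in prob_space) indep_set_mono:
  "indep_set A B \<Longrightarrow> A' \<subseteq> A \<Longrightarrow> B' \<subseteq> B \<Longrightarrow> indep_set A' B'"
  unfolding indep_set_def by (erule indep_sets_mono_sets) (auto split: bool.split)

locale wiener_start = prob_space M for M :: "'w measure" +
  fixes T :: real and Q :: "'h::{real_inner, banach, second_countable_topology} \<Rightarrow> 'h"
    and W :: "real \<Rightarrow> 'w \<Rightarrow> 'h" and X0 :: "'w \<Rightarrow> 'h"
  assumes T_pos: "0 < T" and Q_nonneg: "\<And>x. 0 \<le> Q x \<bullet> x"
    and wiener: "wiener_process M T Q W"
    and X0_measurable: "X0 \<in> borel_measurable M"
    and independent: "independent_rvs M borel X0 (PiM {0..T} (\<lambda>_. borel)) (sample_path T W)"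
begin

lemma W_measurable: "t \<in> {0..T} \<Longrightarrow> W t \<in> borel_measurable M"
  and W_start: "AE \<omega> in M. W 0 \<omega> = 0"
  and W_cont: "AE \<omega> in M. continuous_on {0..T} (\<lambda>t. W t \<omega>)"
  and W_increments: "mono \<tau> \<Longrightarrow> range \<tau> \<subseteq> {0..T} \<Longrightarrow>
    indep_vars (\<lambda>_. borel) (\<lambda>i \<omega>. W (\<tau> (Suc i)) \<omega> - W (\<tau> i) \<omega>) {..<m}"
  and W_gaussian: "0 \<le> s \<Longrightarrow> s \<le> t \<Longrightarrow> t \<le> T \<Longrightarrow>
    centered_gaussian M (\<lambda>x. (t - s) *\<^sub>R Q x) (\<lambda>\<omega>. W t \<omega> - W s \<omega>)"
  using wiener unfolding wiener_process_def by blast+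

text \<open>Finite-dimensional constraints on a path up to time \<open>s\<close>, encoded as one set
  per time, all but finitely many equal to \<open>UNIV\<close>. Intersections are then formed time
  by time, without merging lists of times.\<close>

definition rectangle :: "real \<Rightarrow> (real \<Rightarrow> 'h set) \<Rightarrow> bool" where
  "rectangle s A \<longleftrightarrow> (\<forall>r. A r \<in> sets borel) \<and> finite {r \<in> {0..s}. A r \<noteq> UNIV}"

text \<open>Of the uncountably many conditions only finitely many are restrictive. The general
  \<open>V\<close> covers both the process on \<open>M\<close> and the coordinates of the path
  space.\<close>

lemma pred_rectangle:
  assumes A: "rectangle s A" and V: "\<And>r. r \<in> {0..s} \<Longrightarrow> V r \<in> borel_measurable K"
  shows "{x \<in> space K. \<forall>r\<in>{0..s}. V r x \<in> A r} \<in> sets K"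
proof -
  have "{x \<in> space K. \<forall>r\<in>{r \<in> {0..s}. A r \<noteq> UNIV}. V r x \<in> A r} \<in> sets K"
  proof (rule sets.sets_Collect_finite_All)
    fix r assume "r \<in> {r \<in> {0..s}. A r \<noteq> UNIV}"
    then have "V r -` A r \<inter> space K \<in> sets K"
      using A V[of r] by (auto simp: rectangle_def intro: measurable_sets)
    then show "{x \<in> space K. V r x \<in> A r} \<in> sets K" by (simp add: vimage_def Int_def conj_commute)
  qed (use A in \<open>auto simp: rectangle_def\<close>)
  moreover have "{x \<in> space K. \<forall>r\<in>{r \<in> {0..s}. A r \<noteq> UNIV}. V r x \<in> A r}
      = {x \<in> space K. \<forall>r\<in>{0..s}. V r x \<in> A r}" by auto
  ultimately show ?thesis by simp
qed

text \<open>As \<open>W 0 = 0\<close> almost surely, the values at finitely many times are partial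
  sums of the increments between the sorted times, and the increment after \<open>s\<close> is
  independent of those.\<close>

lemma increment_indep_rectangle:
  assumes s: "0 \<le> s" "s \<le> u" "u \<le> T" and A: "rectangle s A" and B: "B \<in> sets borel"
  shows "prob {\<omega> \<in> space M. (\<forall>r\<in>{0..s}. W r \<omega> \<in> A r) \<and> W u \<omega> - W s \<omega> \<in> B}
    = prob {\<omega> \<in> space M. \<forall>r\<in>{0..s}. W r \<omega> \<in> A r} * prob {\<omega> \<in> space M. W u \<omega> - W s \<omega> \<in> B}"
proof -
  \<comment> \<open>Adding 0 lets the partial sums start at \<open>W 0\<close>; adding
    \<open>s\<close> lets the last increment begin at \<open>s\<close>.\<close>
  define R where "R = {r \<in> {0..s}. A r \<noteq> UNIV} \<union> {0, s}"
  define xs where "xs = sorted_list_of_set R"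
  define l where "l = length xs - 1"
  \<comment> \<open>Beyond index \<open>l\<close> the sequence stays at \<open>u\<close>. It is thus
    monotone on all naturals, and the increment with index \<open>l\<close> is
    \<open>W u - W s\<close>.\<close>
  define \<tau> where "\<tau> i = (if i \<le> l then xs ! i else u)" for i
  have R: "finite R" "R \<subseteq> {0..s}" "0 \<in> R" "s \<in> R" using A s by (auto simp: R_def rectangle_def)
  have set_xs: "set xs = R" and sorted: "sorted xs" using R by (auto simp: xs_def)
  then have len: "length xs = Suc l" using R by (cases xs) (auto simp: l_def)
  have nth: "xs ! i \<in> R" if "i \<le> l" for i using that len set_xs nth_mem[of i xs] by auto
  have R_ex: "\<exists>i\<le>l. xs ! i = r" if "r \<in> R" for r
    using that len set_xs by (metis in_set_conv_nth less_Suc_eq_le)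
  have mono_xs: "xs ! i \<le> xs ! j" if "i \<le> j" "j \<le> l" for i j
    using sorted that len by (auto simp: sorted_iff_nth_mono)
  have x0: "xs ! 0 = 0"
  proof -
    obtain i where "i \<le> l" "xs ! i = 0" using R_ex[OF R(3)] by auto
    then have "xs ! 0 \<le> 0" using mono_xs[of 0 i] by auto
    then show ?thesis using nth[of 0] R(2) by auto
  qed
  have xl: "xs ! l = s"
  proof -
    obtain i where "i \<le> l" "xs ! i = s" using R_ex[OF R(4)] by auto
    then have "s \<le> xs ! l" using mono_xs[of i l] by auto
    then show ?thesis using nth[of l] R(2) by auto
  qed
  have le_s: "xs ! i \<le> s" "0 \<le> xs ! i" if "i \<le> l" for i using nth[OF that] R(2) by auto
  have "\<tau> i \<le> \<tau> j" if "i \<le> j" for i j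
    using mono_xs[OF that] le_s[of i] s that by (auto simp: \<tau>_def)
  then have mono: "mono \<tau>" by (simp add: mono_def)
  have "\<tau> i \<in> {0..T}" for i using le_s[of i] s by (auto simp: \<tau>_def)
  then have rng: "range \<tau> \<subseteq> {0..T}" by auto
  define \<Delta> where "\<Delta> i \<omega> = W (\<tau> (Suc i)) \<omega> - W (\<tau> i) \<omega>" for i \<omega>
  have ind: "indep_vars (\<lambda>_. borel) \<Delta> {..<Suc l}" unfolding \<Delta>_def by (rule W_increments[OF mono rng])
  have ind2: "indep_var (PiM {..<l} (\<lambda>_. borel)) (\<lambda>\<omega>. restrict (\<lambda>i. \<Delta> i \<omega>) {..<l})
      (PiM {l} (\<lambda>_. borel)) (\<lambda>\<omega>. restrict (\<lambda>i. \<Delta> i \<omega>) {l})"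
    by (rule indep_var_restrict[OF ind]) auto
  \<comment> \<open>The rectangle in increment coordinates, where the values of \<open>W\<close>
    become partial sums.\<close>
  define P where "P = {y \<in> space (PiM {..<l} (\<lambda>_. borel)). \<forall>i\<in>{..l}. (\<Sum>k<i. y k) \<in> A (xs ! i)}"
  define P' where "P' = {y \<in> space (PiM {l} (\<lambda>_. borel)). y l \<in> B}"
  have P: "P \<in> sets (PiM {..<l} (\<lambda>_. borel))"
    unfolding P_def
  proof (rule sets.sets_Collect_finite_All)
    fix i assume i: "i \<in> {..l}"
    have [measurable]: "A (xs ! i) \<in> sets borel" using A by (simp add: rectangle_def)
    have "(\<lambda>y. \<Sum>k<i. y k) \<in> borel_measurable (PiM {..<l} (\<lambda>_. borel :: 'h measure))"
      using i by (intro borel_measurable_sum measurable_component_singleton) auto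
    then show "{y \<in> space (PiM {..<l} (\<lambda>_. borel)). (\<Sum>k<i. y k) \<in> A (xs ! i)} \<in> sets (PiM {..<l} (\<lambda>_. borel))"
      by measurable
  qed simp
  have P': "P' \<in> sets (PiM {l} (\<lambda>_. borel))"
    unfolding P'_def using B by measurable
  have tau_l: "\<tau> l = s" "\<tau> (Suc l) = u" using xl by (auto simp: \<tau>_def)
  have sumW: "(\<Sum>k<i. \<Delta> k \<omega>) = W (xs ! i) \<omega>" if "W 0 \<omega> = 0" "i \<le> l" for i \<omega>
  proof -
    have "(\<Sum>k<i. \<Delta> k \<omega>) = W (\<tau> i) \<omega> - W (\<tau> 0) \<omega>"
      unfolding \<Delta>_def by (rule sum_lessThan_telescope)
    then show ?thesis using that x0 by (simp add: \<tau>_def)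
  qed
  have inP: "restrict (\<lambda>i. \<Delta> i \<omega>) {..<l} \<in> P \<longleftrightarrow> (\<forall>r\<in>{0..s}. W r \<omega> \<in> A r)" if "W 0 \<omega> = 0" for \<omega>
  proof -
    have "(\<Sum>k<i. restrict (\<lambda>i. \<Delta> i \<omega>) {..<l} k) = W (xs ! i) \<omega>" if i: "i \<in> {..l}" for i
    proof -
      have "(\<Sum>k<i. restrict (\<lambda>i. \<Delta> i \<omega>) {..<l} k) = (\<Sum>k<i. \<Delta> k \<omega>)"
        using i by (intro sum.cong) auto
      then show ?thesis using sumW[OF \<open>W 0 \<omega> = 0\<close>] i by simp
    qed
    then have "restrict (\<lambda>i. \<Delta> i \<omega>) {..<l} \<in> P \<longleftrightarrow> (\<forall>i\<in>{..l}. W (xs ! i) \<omega> \<in> A (xs ! i))"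
      by (auto simp: P_def space_PiM)
    also have "\<dots> \<longleftrightarrow> (\<forall>r\<in>R. W r \<omega> \<in> A r)" using R_ex nth by (metis atMost_iff)
    also have "\<dots> \<longleftrightarrow> (\<forall>r\<in>{0..s}. W r \<omega> \<in> A r)" using R(2) by (auto simp: R_def)
    finally show ?thesis .
  qed
  have inP': "restrict (\<lambda>i. \<Delta> i \<omega>) {l} \<in> P' \<longleftrightarrow> W u \<omega> - W s \<omega> \<in> B" for \<omega>
    by (auto simp: P'_def space_PiM \<Delta>_def tau_l)
  have rv: "(\<lambda>\<omega>. restrict (\<lambda>i. \<Delta> i \<omega>) {..<l}) \<in> measurable M (PiM {..<l} (\<lambda>_. borel))"
    "(\<lambda>\<omega>. restrict (\<lambda>i. \<Delta> i \<omega>) {l}) \<in> measurable M (PiM {l} (\<lambda>_. borel))"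
    using ind2 indep_var_rv1 indep_var_rv2 by blast+
  let ?C = "{\<omega> \<in> space M. \<forall>r\<in>{0..s}. W r \<omega> \<in> A r}" and ?D = "{\<omega> \<in> space M. W u \<omega> - W s \<omega> \<in> B}"
  have C: "?C \<in> sets M" by (rule pred_rectangle[OF A]) (use s W_measurable in auto)
  have D: "?D \<in> sets M"
    using measurable_sets[OF rv(2) P'] by (simp add: vimage_def inP' Int_def conj_commute)
  have "prob (?C \<inter> ?D) = prob ((\<lambda>\<omega>. (restrict (\<lambda>i. \<Delta> i \<omega>) {..<l}, restrict (\<lambda>i. \<Delta> i \<omega>) {l})) -` (P \<times> P') \<inter> space M)"
  proof (rule measure_eq_AE)
    show "AE \<omega> in M. \<omega> \<in> ?C \<inter> ?D \<longleftrightarrow>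
      \<omega> \<in> (\<lambda>\<omega>. (restrict (\<lambda>i. \<Delta> i \<omega>) {..<l}, restrict (\<lambda>i. \<Delta> i \<omega>) {l})) -` (P \<times> P') \<inter> space M"
      using W_start by eventually_elim (auto simp: inP inP')
    show "(\<lambda>\<omega>. (restrict (\<lambda>i. \<Delta> i \<omega>) {..<l}, restrict (\<lambda>i. \<Delta> i \<omega>) {l})) -` (P \<times> P') \<inter> space M \<in> sets M"
      using rv P P' by (intro measurable_sets[OF measurable_Pair]) auto
  qed (use C D in auto)
  also have "\<dots> = prob ((\<lambda>\<omega>. restrict (\<lambda>i. \<Delta> i \<omega>) {..<l}) -` P \<inter> space M)
      * prob ((\<lambda>\<omega>. restrict (\<lambda>i. \<Delta> i \<omega>) {l}) -` P' \<inter> space M)"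
    by (rule indep_varD[OF ind2 P P'])
  also have "prob ((\<lambda>\<omega>. restrict (\<lambda>i. \<Delta> i \<omega>) {..<l}) -` P \<inter> space M) = prob ?C"
  proof (rule measure_eq_AE)
    show "AE \<omega> in M. \<omega> \<in> (\<lambda>\<omega>. restrict (\<lambda>i. \<Delta> i \<omega>) {..<l}) -` P \<inter> space M \<longleftrightarrow> \<omega> \<in> ?C"
      using W_start by eventually_elim (auto simp: inP)
  qed (use C measurable_sets[OF rv(1) P] in auto)
  also have "(\<lambda>\<omega>. restrict (\<lambda>i. \<Delta> i \<omega>) {l}) -` P' \<inter> space M = ?D"
    by (auto simp: inP')
  also have "?C \<inter> ?D = {\<omega> \<in> space M. (\<forall>r\<in>{0..s}. W r \<omega> \<in> A r) \<and> W u \<omega> - W s \<omega> \<in> B}" by auto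
  finally show ?thesis .
qed

definition cylinder :: "real \<Rightarrow> 'h set \<Rightarrow> (real \<Rightarrow> 'h set) \<Rightarrow> 'w set" where
  "cylinder s A0 A = {\<omega> \<in> space M. X0 \<omega> \<in> A0 \<and> (\<forall>r\<in>{0..s}. W r \<omega> \<in> A r)}"

lemma X0_indep_path:
  assumes A0: "A0 \<in> sets borel" and S: "S \<in> sets (PiM {0..T} (\<lambda>_. borel))"
  shows "prob ({\<omega> \<in> space M. X0 \<omega> \<in> A0} \<inter> (sample_path T W -` S \<inter> space M))
    = prob {\<omega> \<in> space M. X0 \<omega> \<in> A0} * prob (sample_path T W -` S \<inter> space M)"
proof (rule indep_setD)
  show "indep_set {X0 -` A \<inter> space M | A. A \<in> sets borel}
      {sample_path T W -` A \<inter> space M | A. A \<in> sets (PiM {0..T} (\<lambda>_. borel))}"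
    using independent by (simp add: independent_rvs_def)
  show "{\<omega> \<in> space M. X0 \<omega> \<in> A0} \<in> {X0 -` A \<inter> space M | A. A \<in> sets borel}" using A0 by auto
qed (use S in auto)

lemma cylinder_measurable:
  assumes "s \<le> T" "A0 \<in> sets borel" "rectangle s A"
  shows "cylinder s A0 A \<in> sets M"
proof -
  have "{\<omega> \<in> space M. X0 \<omega> \<in> A0} \<in> sets M"
    using X0_measurable assms(2) by measurable
  moreover have "{\<omega> \<in> space M. \<forall>r\<in>{0..s}. W r \<omega> \<in> A r} \<in> sets M"
    using assms W_measurable by (intro pred_rectangle) auto
  moreover have "cylinder s A0 A = {\<omega> \<in> space M. X0 \<omega> \<in> A0} \<inter> {\<omega> \<in> space M. \<forall>r\<in>{0..s}. W r \<omega> \<in> A r}"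
    by (auto simp: cylinder_def)
  ultimately show ?thesis by simp
qed

text \<open>Independence of \<open>X0\<close> from the path is used twice, for the past event and
  for its intersection with the increment event; the latter then factors by
  \<open>increment_indep_rectangle\<close>.\<close>

lemma increment_indep_cylinder:
  assumes s: "0 \<le> s" "s \<le> u" "u \<le> T" and A0: "A0 \<in> sets borel" and A: "rectangle s A" and B: "B \<in> sets borel"
  shows "prob (cylinder s A0 A \<inter> {\<omega> \<in> space M. W u \<omega> - W s \<omega> \<in> B})
    = prob (cylinder s A0 A) * prob {\<omega> \<in> space M. W u \<omega> - W s \<omega> \<in> B}"
proof -
  let ?\<Omega> = "PiM {0..T} (\<lambda>_. borel) :: (real \<Rightarrow> 'h) measure"
  define S where "S = {f \<in> space ?\<Omega>. \<forall>r\<in>{0..s}. f r \<in> A r}"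
  define S' where "S' = {f \<in> space ?\<Omega>. f u - f s \<in> B}"
  have S: "S \<in> sets ?\<Omega>"
    unfolding S_def by (rule pred_rectangle[OF A]) (use s in auto)
  have "(\<lambda>f. f u - f s) \<in> borel_measurable ?\<Omega>"
    using s by (intro borel_measurable_diff measurable_component_singleton) auto
  then have S': "S' \<in> sets ?\<Omega>" unfolding S'_def using B by measurable
  have sp: "sample_path T W \<omega> \<in> space ?\<Omega>" for \<omega> by (auto simp: sample_path_def space_PiM)
  have eS: "sample_path T W -` S \<inter> space M = {\<omega> \<in> space M. \<forall>r\<in>{0..s}. W r \<omega> \<in> A r}"
    using s sp by (auto simp: S_def) (auto simp: sample_path_def)
  have eSS': "sample_path T W -` (S \<inter> S') \<inter> space M
      = {\<omega> \<in> space M. (\<forall>r\<in>{0..s}. W r \<omega> \<in> A r) \<and> W u \<omega> - W s \<omega> \<in> B}"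
    using s sp by (auto simp: S_def S'_def) (auto simp: sample_path_def)
  have "cylinder s A0 A \<inter> {\<omega> \<in> space M. W u \<omega> - W s \<omega> \<in> B}
      = {\<omega> \<in> space M. X0 \<omega> \<in> A0} \<inter> (sample_path T W -` (S \<inter> S') \<inter> space M)"
    unfolding eSS' cylinder_def by auto
  moreover have "cylinder s A0 A = {\<omega> \<in> space M. X0 \<omega> \<in> A0} \<inter> (sample_path T W -` S \<inter> space M)"
    unfolding eS cylinder_def by auto
  ultimately show ?thesis
    using X0_indep_path[OF A0 S] X0_indep_path[OF A0 sets.Int[OF S S']] increment_indep_rectangle[OF s A B]
    unfolding eS eSS' by simp
qed

section \<open>The completed filtration and its independence from later increments\<close>

abbreviation "N \<equiv> completion M"
abbreviation "F \<equiv> driving_filtration M X0 W"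

lemma prob_space_N: "prob_space N"
  by (rule prob_spaceI) (simp add: emeasure_space_1)

lemma sets_F: "sets (F t) = sigma_sets (space M)
     ({X0 -` A \<inter> space M | A. A \<in> sets borel} \<union>
      {W s -` A \<inter> space M | s A. 0 \<le> s \<and> s \<le> t \<and> A \<in> sets borel} \<union>
      null_sets N)"
proof -
  have "null_sets N \<subseteq> Pow (space M)" using sets.sets_into_space[of _ N] by (auto simp: null_sets_def)
  then show ?thesis
    unfolding driving_filtration_def by (intro sets_measure_of) auto
qed

lemma space_F: "space (F t) = space M"
  unfolding driving_filtration_def by (simp add: space_measure_of_conv)

lemma F_subalgebra: "t \<in> {0..T} \<Longrightarrow> subalgebra N (F t)"
  unfolding subalgebra_def sets_F space_F space_completion
  using measurable_sets[OF X0_measurable] measurable_sets[OF W_measurable]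
  by (intro conjI refl sets.sigma_sets_subset[of _ N, unfolded space_completion] Un_least)
    (auto dest: null_setsD2)

lemma F_mono: "s \<le> t \<Longrightarrow> subalgebra (F t) (F s)"
  unfolding subalgebra_def sets_F space_F
  by (intro conjI refl sigma_sets_mono' Un_mono order_refl) (blast intro: order_trans)

lemma W_adapted: "0 \<le> s \<Longrightarrow> s \<le> t \<Longrightarrow> W s \<in> borel_measurable (F t)"
  by (intro measurableI) (auto simp: sets_F space_F intro!: sigma_sets.Basic)

text \<open>
  The cylinders form an intersection-stable generator of the filtration once sets that differ from a
  cylinder by a null set are added; \<open>F\<close> lives on the completion, hence \<open>N\<close> instead of \<open>M\<close>.
\<close>

lemma indep_increment:
  assumes s: "0 \<le> s" "s \<le> u" "u \<le> T"
  shows "prob_space.indep_set N (sets (F s)) {(\<lambda>\<omega>. W u \<omega> - W s \<omega>) -` B \<inter> space M | B. B \<in> sets borel}"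
proof -
  interpret N: prob_space N by (rule prob_space_N)
  define K where "K = {C \<in> sets N. \<exists>A0 A. A0 \<in> sets borel \<and> rectangle s A \<and> (AE \<omega> in N. \<omega> \<in> C \<longleftrightarrow> \<omega> \<in> cylinder s A0 A)}"
  let ?G = "{(\<lambda>\<omega>. W u \<omega> - W s \<omega>) -` B \<inter> space M | B. B \<in> sets borel}"
  have inc: "(\<lambda>\<omega>. W u \<omega> - W s \<omega>) \<in> borel_measurable M"
    using s W_measurable by (intro borel_measurable_diff) auto
  have cyl: "cylinder s A0 A \<in> sets M" if "A0 \<in> sets borel" "rectangle s A" for A0 A
    using that s by (intro cylinder_measurable) auto
  have "N.indep_set K ?G"
  proof (rule N.indep_setI)
    show "K \<subseteq> sets N" by (auto simp: K_def)
    show "?G \<subseteq> sets N" using inc by (auto intro!: sets_completionI_sets measurable_sets[of _ M borel])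
    fix C G assume "C \<in> K" "G \<in> ?G"
    then obtain A0 A B where C: "C \<in> sets N" "A0 \<in> sets borel" "rectangle s A" "AE \<omega> in N. \<omega> \<in> C \<longleftrightarrow> \<omega> \<in> cylinder s A0 A"
      and B: "B \<in> sets borel" and G: "G = {\<omega> \<in> space M. W u \<omega> - W s \<omega> \<in> B}"
      by (auto simp: K_def)
    have GM: "G \<in> sets M" unfolding G using inc B by measurable
    have "measure N (C \<inter> G) = measure N (cylinder s A0 A \<inter> G)"
      using C cyl[OF C(2,3)] GM by (intro measure_eq_AE) auto
    also have "\<dots> = measure M (cylinder s A0 A \<inter> G)" using cyl[OF C(2,3)] GM by simp
    also have "\<dots> = measure M (cylinder s A0 A) * measure M G"
      unfolding G by (rule increment_indep_cylinder[OF s C(2,3) B])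
    also have "\<dots> = measure N (cylinder s A0 A) * measure N G" using cyl[OF C(2,3)] GM by simp
    also have "measure N (cylinder s A0 A) = measure N C"
      using C cyl[OF C(2,3)] by (intro measure_eq_AE) auto
    finally show "measure N (C \<inter> G) = measure N C * measure N G" .
  qed
  moreover have "Int_stable K"
  proof (rule Int_stableI)
    fix C D assume "C \<in> K" "D \<in> K"
    then obtain A0 A B0 B where C: "C \<in> sets N" "A0 \<in> sets borel" "rectangle s A" "AE \<omega> in N. \<omega> \<in> C \<longleftrightarrow> \<omega> \<in> cylinder s A0 A"
      and D: "D \<in> sets N" "B0 \<in> sets borel" "rectangle s B" "AE \<omega> in N. \<omega> \<in> D \<longleftrightarrow> \<omega> \<in> cylinder s B0 B"
      by (auto simp: K_def)
    have "{r \<in> {0..s}. A r \<inter> B r \<noteq> UNIV} \<subseteq> {r \<in> {0..s}. A r \<noteq> UNIV} \<union> {r \<in> {0..s}. B r \<noteq> UNIV}" by auto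
    then have "rectangle s (\<lambda>r. A r \<inter> B r)"
      using C(3) D(3) unfolding rectangle_def by (auto intro: finite_subset)
    moreover have "AE \<omega> in N. \<omega> \<in> C \<inter> D \<longleftrightarrow> \<omega> \<in> cylinder s (A0 \<inter> B0) (\<lambda>r. A r \<inter> B r)"
      using C(4) D(4) by eventually_elim (auto simp: cylinder_def)
    ultimately show "C \<inter> D \<in> K"
      using C(1,2) D(1,2) unfolding K_def by (auto intro!: exI[of _ "A0 \<inter> B0"])
  qed
  moreover have "Int_stable ?G" by (rule Int_stable_vimage)
  ultimately have "N.indep_set (sigma_sets (space N) K) (sigma_sets (space N) ?G)"
    by (rule N.indep_set_sigma_sets)
  moreover have "sets (F s) \<subseteq> sigma_sets (space N) K"
  proof -
    have 1: "X0 -` A \<inter> space M \<in> K" if A: "A \<in> sets borel" for A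
    proof -
      have "X0 -` A \<inter> space M = cylinder s A (\<lambda>_. UNIV)" by (auto simp: cylinder_def)
      moreover have "rectangle s (\<lambda>_. UNIV)" by (simp add: rectangle_def)
      ultimately show ?thesis using A cyl[OF A] unfolding K_def by auto
    qed
    have 2: "W r -` A \<inter> space M \<in> K" if A: "A \<in> sets borel" and r: "0 \<le> r" "r \<le> s" for r A
    proof -
      define A' where "A' r' = (if r' = r then A else UNIV)" for r'
      have "W r -` A \<inter> space M = cylinder s UNIV A'"
        using r by (auto simp: cylinder_def A'_def)
      moreover have "{r' \<in> {0..s}. A' r' \<noteq> UNIV} \<subseteq> {r}" by (auto simp: A'_def)
      then have "rectangle s A'"
        using A by (auto simp: rectangle_def A'_def intro: finite_subset)
      ultimately show ?thesis using cyl[of UNIV A'] unfolding K_def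
        by (auto intro!: exI[of _ "UNIV :: 'h set"] exI[of _ A'])
    qed
    \<comment> \<open>A null set agrees almost everywhere with the empty cylinder, obtained from the
      empty constraint on \<open>X0\<close>.\<close>
    have 3: "Z \<in> K" if Z: "Z \<in> null_sets N" for Z
    proof -
      have "AE \<omega> in N. \<omega> \<notin> Z" using Z by (rule AE_not_in)
      then have "AE \<omega> in N. \<omega> \<in> Z \<longleftrightarrow> \<omega> \<in> cylinder s {} (\<lambda>_. UNIV)"
        by eventually_elim (simp add: cylinder_def)
      moreover have "rectangle s (\<lambda>_. UNIV)" by (simp add: rectangle_def)
      ultimately show ?thesis using Z unfolding K_def null_sets_def by blast
    qed
    show ?thesis unfolding sets_F using 1 2 3 by (auto intro!: sigma_sets_mono')
  qed
  ultimately show ?thesis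
    by (rule N.indep_set_mono) auto
qed

text \<open>The normal law supplies the first two moments of an increment along \<open>h\<close>,
  and independence from \<open>F s\<close> splits off the factor \<open>Y\<close>. Together they
  give both increment axioms.\<close>

lemma scalar_noise_inner: "scalar_noise N F T (Q h \<bullet> h) (\<lambda>t \<omega>. W t \<omega> \<bullet> h)"
proof -
  interpret N: prob_space N by (rule prob_space_N)
  have moments: "has_bochner_integral N (\<lambda>\<omega>. W u \<omega> \<bullet> h - W s \<omega> \<bullet> h) 0"
    "has_bochner_integral N (\<lambda>\<omega>. (W u \<omega> \<bullet> h - W s \<omega> \<bullet> h)\<^sup>2) ((Q h \<bullet> h) * (u - s))"
    if s: "0 \<le> s" "s \<le> u" "u \<le> T" for s u
  proof -
    have Z: "(\<lambda>\<omega>. h \<bullet> (W u \<omega> - W s \<omega>)) \<in> borel_measurable M"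
      using s W_measurable by (intro borel_measurable_inner borel_measurable_diff) auto
    have v: "0 \<le> ((u - s) *\<^sub>R Q h) \<bullet> h" using s Q_nonneg by simp
    have d: "distr M borel (\<lambda>\<omega>. h \<bullet> (W u \<omega> - W s \<omega>)) = real_normal (((u - s) *\<^sub>R Q h) \<bullet> h)"
      using W_gaussian[OF s] by (simp add: centered_gaussian_def)
    have "has_bochner_integral M (\<lambda>\<omega>. h \<bullet> (W u \<omega> - W s \<omega>)) 0"
      "has_bochner_integral M (\<lambda>\<omega>. (h \<bullet> (W u \<omega> - W s \<omega>))\<^sup>2) (((u - s) *\<^sub>R Q h) \<bullet> h)"
      using real_normal_moments[OF v] Z unfolding d[symmetric] has_bochner_integral_iff
      by (simp_all add: integrable_distr_eq integral_distr)
    then show "has_bochner_integral N (\<lambda>\<omega>. W u \<omega> \<bullet> h - W s \<omega> \<bullet> h) 0"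
      "has_bochner_integral N (\<lambda>\<omega>. (W u \<omega> \<bullet> h - W s \<omega> \<bullet> h)\<^sup>2) ((Q h \<bullet> h) * (u - s))"
      unfolding has_bochner_integral_iff
      by (simp_all add: integrable_completion integral_completion borel_measurable_integrable
          inner_diff_right inner_commute[of h] mult.commute)
  qed
  have indep: "N.indep_var borel Y borel (\<lambda>\<omega>. \<phi> (W u \<omega> - W s \<omega>))"
    if s: "0 \<le> s" "s \<le> u" "u \<le> T" and Y: "Y \<in> borel_measurable (F s)" and \<phi>: "\<phi> \<in> borel_measurable borel"
    for s u and Y :: "'w \<Rightarrow> real" and \<phi> :: "'h \<Rightarrow> real"
  proof -
    let ?G = "{(\<lambda>\<omega>. W u \<omega> - W s \<omega>) -` B \<inter> space M | B. B \<in> sets borel}"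
    have "(\<lambda>\<omega>. W u \<omega> - W s \<omega>) \<in> borel_measurable M"
      using s W_measurable by (intro borel_measurable_diff) auto
    then have 1: "(\<lambda>\<omega>. \<phi> (W u \<omega> - W s \<omega>)) \<in> borel_measurable N"
      using \<phi> by (intro measurable_completion measurable_compose[OF _ \<phi>])
    have 2: "Y \<in> borel_measurable N"
      using Y F_subalgebra[of s] s by (intro measurable_from_subalg[of N "F s"]) auto
    have "N.indep_set {Y -` A \<inter> space N | A. A \<in> sets borel} {(\<lambda>\<omega>. \<phi> (W u \<omega> - W s \<omega>)) -` A \<inter> space N | A. A \<in> sets borel}"
    proof (rule N.indep_setI)
      show "{Y -` A \<inter> space N | A. A \<in> sets borel} \<subseteq> sets N" using measurable_sets[OF 2] by auto
      show "{(\<lambda>\<omega>. \<phi> (W u \<omega> - W s \<omega>)) -` A \<inter> space N | A. A \<in> sets borel} \<subseteq> sets N"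
        using measurable_sets[OF 1] by auto
      fix a b assume "a \<in> {Y -` A \<inter> space N | A. A \<in> sets borel}"
        "b \<in> {(\<lambda>\<omega>. \<phi> (W u \<omega> - W s \<omega>)) -` A \<inter> space N | A. A \<in> sets borel}"
      then obtain A B where AB: "A \<in> sets borel" "B \<in> sets borel" "a = Y -` A \<inter> space N"
        "b = (\<lambda>\<omega>. \<phi> (W u \<omega> - W s \<omega>)) -` B \<inter> space N" by auto
      have "a \<in> sets (F s)" using measurable_sets[OF Y AB(1)] AB(3) by (simp add: space_F)
      moreover have "b \<in> ?G"
        using measurable_sets[OF \<phi> AB(2)] AB(4) by (auto intro!: exI[of _ "\<phi> -` B"])
      ultimately show "N.prob (a \<inter> b) = N.prob a * N.prob b"
        by (rule N.indep_setD[OF indep_increment[OF s]])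
    qed
    then show ?thesis
      unfolding N.indep_var_eq using 1 2
      by (intro conjI N.indep_set_sigma_sets Int_stable_vimage)
  qed
  show ?thesis
  proof
    show "0 \<le> T" "0 \<le> Q h \<bullet> h" using T_pos Q_nonneg by auto
    show "subalgebra N (F t)" if "t \<in> {0..T}" for t by (rule F_subalgebra[OF that])
    show "subalgebra (F t) (F s)" if "s \<le> t" for s t by (rule F_mono[OF that])
    show "(\<lambda>\<omega>. W t \<omega> \<bullet> h) \<in> borel_measurable (F t)" if "t \<in> {0..T}" for t
      using that W_adapted[of t t] by (intro borel_measurable_inner) auto
    show "AE \<omega> in N. W 0 \<omega> \<bullet> h = 0"
      using W_start unfolding AE_completion_iff by eventually_elim simp
    show "AE \<omega> in N. continuous_on {0..T} (\<lambda>t. W t \<omega> \<bullet> h)"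
      using W_cont unfolding AE_completion_iff by eventually_elim (intro continuous_intros)
    fix s u and Y :: "'w \<Rightarrow> real"
    assume s: "0 \<le> s" "s \<le> u" "u \<le> T" and Y: "Y \<in> borel_measurable (F s)" "integrable N Y"
    show "has_bochner_integral N (\<lambda>\<omega>. Y \<omega> * (W u \<omega> \<bullet> h - W s \<omega> \<bullet> h)) 0"
      using N.indep_var_lebesgue_integral[of Y "\<lambda>\<omega>. (W u \<omega> - W s \<omega>) \<bullet> h"]
        N.indep_var_integrable[of Y "\<lambda>\<omega>. (W u \<omega> - W s \<omega>) \<bullet> h"] indep[OF s Y(1), of "\<lambda>x. x \<bullet> h"]
        moments[OF s] Y(2)
      by (simp add: has_bochner_integral_iff inner_diff_left)
    show "has_bochner_integral N (\<lambda>\<omega>. Y \<omega> * (W u \<omega> \<bullet> h - W s \<omega> \<bullet> h)\<^sup>2) (Q h \<bullet> h * (u - s) * N.expectation Y)"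
      using N.indep_var_lebesgue_integral[of Y "\<lambda>\<omega>. ((W u \<omega> - W s \<omega>) \<bullet> h)\<^sup>2"]
        N.indep_var_integrable[of Y "\<lambda>\<omega>. ((W u \<omega> - W s \<omega>) \<bullet> h)\<^sup>2"] indep[OF s Y(1), of "\<lambda>x. (x \<bullet> h)\<^sup>2"]
        moments[OF s] Y(2)
      by (simp add: has_bochner_integral_iff inner_diff_left mult_ac)
  qed
qed

end

subsection \<open>Variation of constants\<close>

text \<open>The exceptional set may depend on \<open>t\<close>. Countably many grid points share
  one, and continuity extends the equality to all times.\<close>

lemma AE_eq_on_interval:
  fixes u v :: "real \<Rightarrow> 'w \<Rightarrow> 'b::t2_space"
  assumes T: "0 < T" and eq: "\<And>t. t \<in> {0..T} \<Longrightarrow> AE \<omega> in M. u t \<omega> = v t \<omega>"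
    and u: "AE \<omega> in M. continuous_on {0..T} (\<lambda>t. u t \<omega>)"
    and v: "AE \<omega> in M. continuous_on {0..T} (\<lambda>t. v t \<omega>)"
  shows "AE \<omega> in M. \<forall>t\<in>{0..T}. u t \<omega> = v t \<omega>"
proof -
  have gr: "grid T m i \<in> {0..T}" if "i \<le> Suc m" for m i
    using that T grid_nonneg[of T m i] grid_le[of T i m] by simp
  have "AE \<omega> in M. \<forall>m. \<forall>i. i \<le> Suc m \<longrightarrow> u (grid T m i) \<omega> = v (grid T m i) \<omega>"
    unfolding AE_all_countable using eq[OF gr] by (auto intro: AE_impI)
  with u v show ?thesis
  proof eventually_elim
    case (elim \<omega>)
    show ?case
    proof
      fix t assume t: "t \<in> {0..T}"
      obtain j where j: "\<And>m. j m \<le> Suc m" "\<And>m. grid T m (j m) \<le> t" "(\<lambda>m. grid T m (j m)) \<longlonglongrightarrow> t"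
        using grid_approximates[OF T t] by blast
      have "(\<lambda>m. u (grid T m (j m)) \<omega>) \<longlonglongrightarrow> u t \<omega>"
        by (rule continuous_on_tendsto_compose[OF elim(1) j(3) t]) (intro always_eventually allI gr[OF j(1)])
      moreover have "(\<lambda>m. v (grid T m (j m)) \<omega>) \<longlonglongrightarrow> v t \<omega>"
        by (rule continuous_on_tendsto_compose[OF elim(2) j(3) t]) (intro always_eventually allI gr[OF j(1)])
      ultimately show "u t \<omega> = v t \<omega>"
        using elim(3) j(1) by (auto intro: LIMSEQ_unique)
    qed
  qed
qed

section \<open>The integrating factor and the pathwise linear equation\<close>

locale ou_coefficients =
  fixes T :: real and \<alpha> \<alpha>' :: "real \<Rightarrow> real"
  assumes T_pos: "0 < T" and \<alpha>_pos: "\<And>t. t \<in> {0..T} \<Longrightarrow> 0 < \<alpha> t"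
    and \<alpha>_deriv: "\<And>t. t \<in> {0..T} \<Longrightarrow> (\<alpha> has_real_derivative \<alpha>' t) (at t within {0..T})"
    and \<alpha>'_cont: "continuous_on {0..T} \<alpha>'"
begin

abbreviation "a \<equiv> a_coeff \<alpha>"
text \<open>With \<open>\<sigma> = sqrt \<alpha>\<close>, the three functions are the derivative of
  \<open>\<sigma>\<close>, the noise coefficient after multiplication by the integrating factor
  \<open>a\<close>, and the derivative of that product.\<close>

definition "\<sigma>' t = \<alpha>' t / (2 * sqrt (\<alpha> t))"
definition "g t = a t * sqrt (\<alpha> t)"
definition "g' t = \<alpha> t / 2 * a t * sqrt (\<alpha> t) + a t * \<sigma>' t"

lemma \<alpha>_cont: "continuous_on {0..T} \<alpha>"
  by (rule DERIV_continuous_on[OF \<alpha>_deriv])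

lemma a_pos: "0 < a t"
  by (simp add: a_coeff_def)

lemma a_0: "a 0 = 1"
proof -
  have "(LBINT r:{0..0}. \<alpha> r) = 0"
    unfolding set_lebesgue_integral_def
    by (rule integral_eq_zero_AE) (use AE_lborel_singleton[of 0] in \<open>eventually_elim, auto\<close>)
  then show ?thesis by (simp add: a_coeff_def)
qed

lemma a_eq:
  assumes "t \<in> {0..T}"
  shows "a t = exp (1/2 * integral {0..t} \<alpha>)"
proof -
  have "continuous_on {0..t} \<alpha>" using assms by (intro continuous_on_subset[OF \<alpha>_cont]) auto
  then have "(LBINT r:{0..t}. \<alpha> r) = integral {0..t} \<alpha>"
    by (intro set_borel_integral_eq_integral borel_integrable_atLeastAtMost')
  then show ?thesis by (simp add: a_coeff_def)
qed

lemma a_deriv: "t \<in> {0..T} \<Longrightarrow> (a has_real_derivative \<alpha> t / 2 * a t) (at t within {0..T})"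
proof -
  assume t: "t \<in> {0..T}"
  have "((\<lambda>t. integral {0..t} \<alpha>) has_real_derivative \<alpha> t) (at t within {0..T})"
    using integral_has_real_derivative[OF \<alpha>_cont t] .
  then have "((\<lambda>t. exp (1/2 * integral {0..t} \<alpha>)) has_real_derivative \<alpha> t / 2 * exp (1/2 * integral {0..t} \<alpha>)) (at t within {0..T})"
    by (auto intro!: derivative_eq_intros)
  then show ?thesis
    unfolding a_eq[OF t]
    by (rule has_field_derivative_transform_within[OF _ zero_less_one t]) (rule a_eq[symmetric])
qed

lemma a_cont: "continuous_on {0..T} a"
  by (rule DERIV_continuous_on[OF a_deriv])

lemma \<sigma>_deriv: "t \<in> {0..T} \<Longrightarrow> ((\<lambda>t. sqrt (\<alpha> t)) has_real_derivative \<sigma>' t) (at t within {0..T})"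
proof -
  assume t: "t \<in> {0..T}"
  have "((\<lambda>t. sqrt (\<alpha> t)) has_real_derivative inverse (sqrt (\<alpha> t)) / 2 * \<alpha>' t) (at t within {0..T})"
    by (rule DERIV_chain2[OF DERIV_real_sqrt[OF \<alpha>_pos[OF t]] \<alpha>_deriv[OF t]])
  moreover have "inverse (sqrt (\<alpha> t)) / 2 * \<alpha>' t = \<sigma>' t"
    unfolding \<sigma>'_def by (simp add: field_simps)
  ultimately show ?thesis by metis
qed

lemma \<sigma>'_cont: "continuous_on {0..T} \<sigma>'"
proof -
  have "\<forall>t\<in>{0..T}. 2 * sqrt (\<alpha> t) \<noteq> 0" using \<alpha>_pos by (simp add: less_imp_neq[symmetric])
  then show ?thesis unfolding \<sigma>'_def by (intro continuous_intros \<alpha>'_cont \<alpha>_cont)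
qed

lemma g_deriv: "t \<in> {0..T} \<Longrightarrow> (g has_real_derivative g' t) (at t within {0..T})"
  unfolding g_def[abs_def] g'_def
  by (rule DERIV_cong[OF DERIV_mult[OF a_deriv \<sigma>_deriv]]) auto

lemma g'_cont: "continuous_on {0..T} g'"
  unfolding g'_def by (intro continuous_intros \<alpha>_cont a_cont \<sigma>'_cont) auto

text \<open>From \<open>a' = \<alpha> / 2 * a\<close> the antiderivative of \<open>g\<^sup>2\<close>
  is \<open>a\<^sup>2\<close>; as \<open>a 0 = 1\<close>, this produces the quantity
  \<open>(a t)\<^sup>2 - 1\<close> of the estimates.\<close>

lemma a_square_deriv: "t \<in> {0..T} \<Longrightarrow> ((\<lambda>t. (a t)\<^sup>2) has_real_derivative (g t)\<^sup>2) (at t within {0..T})"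
  using \<alpha>_pos[of t]
  by (intro DERIV_cong[OF DERIV_power[OF a_deriv]]) (simp_all add: g_def power_mult_distrib power2_eq_square)

lemma a_mono: assumes "0 \<le> s" "s \<le> t" "t \<le> T" shows "a s \<le> a t"
proof -
  have "integral {0..s} \<alpha> \<le> integral {0..t} \<alpha>"
    using assms \<alpha>_pos by (intro integral_subset_le integrable_continuous_real continuous_on_subset[OF \<alpha>_cont])
      (auto intro: less_imp_le)
  then show ?thesis using assms by (simp add: a_eq)
qed

lemma a_ge_1: "t \<in> {0..T} \<Longrightarrow> 1 \<le> a t"
  using a_mono[of 0 t] by (simp add: a_0)

text \<open>\<open>x\<close> inherits the roughness of \<open>w\<close>, but
  \<open>y = x - sqrt \<alpha> * w\<close> is differentiable. In the derivative of
  \<open>a * y\<close> the terms with \<open>x\<close> cancel and \<open>- g' * w\<close> is left;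
  integrating and using \<open>w 0 = 0\<close> gives the claim.\<close>

lemma variation_of_constants:
  fixes x w i :: "real \<Rightarrow> real"
  assumes x: "continuous_on {0..T} x" and w: "continuous_on {0..T} w" and w0: "w 0 = 0"
    and i: "\<And>t. t \<in> {0..T} \<Longrightarrow> i t = sqrt (\<alpha> t) * w t - integral {0..t} (\<lambda>s. \<sigma>' s * w s)"
    and sde: "\<And>t. t \<in> {0..T} \<Longrightarrow> x t = x 0 + integral {0..t} (\<lambda>s. - (1/2) * \<alpha> s * x s) + i t"
    and t: "t \<in> {0..T}"
  shows "a t * x t = x 0 + (g t * w t - integral {0..t} (\<lambda>s. g' s * w s))"
proof -
  define y where "y t = x t - sqrt (\<alpha> t) * w t" for t
  have cx: "continuous_on {0..T} (\<lambda>s. - (1/2) * \<alpha> s * x s)" and cw: "continuous_on {0..T} (\<lambda>s. \<sigma>' s * w s)"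
    by (intro continuous_intros \<alpha>_cont x w \<sigma>'_cont)+
  have y_eq: "y t = x 0 + integral {0..t} (\<lambda>s. - (1/2) * \<alpha> s * x s) - integral {0..t} (\<lambda>s. \<sigma>' s * w s)" if "t \<in> {0..T}" for t
    using sde[OF that] i[OF that] by (simp add: y_def)
  have dy: "(y has_real_derivative (- (1/2) * \<alpha> t * x t - \<sigma>' t * w t)) (at t within {0..T})" if t: "t \<in> {0..T}" for t
  proof -
    have "((\<lambda>t. x 0 + integral {0..t} (\<lambda>s. - (1/2) * \<alpha> s * x s) - integral {0..t} (\<lambda>s. \<sigma>' s * w s))
        has_real_derivative (0 + - (1/2) * \<alpha> t * x t - \<sigma>' t * w t)) (at t within {0..T})"
      by (intro DERIV_diff DERIV_add DERIV_const integral_has_real_derivative[OF cx t] integral_has_real_derivative[OF cw t])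
    then show ?thesis
      unfolding add_0 by (rule has_field_derivative_transform_within[OF _ zero_less_one t]) (rule y_eq[symmetric])
  qed
  have dz: "((\<lambda>t. a t * y t) has_real_derivative - (g' t * w t)) (at t within {0..T})" if t: "t \<in> {0..T}" for t
    using DERIV_mult[OF a_deriv[OF t] dy[OF t]]
    by (rule DERIV_cong) (simp add: y_def g'_def field_simps)
  have "((\<lambda>s. - (g' s * w s)) has_integral a t * y t - a 0 * y 0) {0..t}"
  proof (rule fundamental_theorem_of_calculus)
    fix s assume s: "s \<in> {0..t}"
    have "((\<lambda>t. a t * y t) has_real_derivative - (g' s * w s)) (at s within {0..t})"
      by (rule DERIV_subset[OF dz]) (use s t in auto)
    then show "((\<lambda>t. a t * y t) has_vector_derivative - (g' s * w s)) (at s within {0..t})"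
      by (simp add: has_real_derivative_iff_has_vector_derivative)
  qed (use t in auto)
  then have "integral {0..t} (\<lambda>s. - (g' s * w s)) = a t * y t - a 0 * y 0"
    by (rule integral_unique)
  then show ?thesis by (simp add: y_def g_def w0 a_0 algebra_simps)
qed

end

context scalar_noise
begin

text \<open>The Ito integral is identified at each fixed time, then at all times by continuity of
  both sides. Only after that can the equation be solved path by path.\<close>

lemma linear_sde_solution:
  assumes coeff: "ou_coefficients T \<alpha> \<alpha>'"
    and E: "\<And>m. is_elementary N F T (E m)"
    and approx: "(\<lambda>m. \<integral>\<^sup>+\<omega>. (\<integral>\<^sup>+r\<in>{0..T}. ennreal ((sqrt (\<alpha> r) - elementary_process (E m) r \<omega>)\<^sup>2) \<partial>lborel) \<partial>N) \<longlonglongrightarrow> 0"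
    and i: "\<And>t. t \<in> {0..T} \<Longrightarrow> i t \<in> borel_measurable N"
      "\<And>t. t \<in> {0..T} \<Longrightarrow> (\<lambda>m. \<integral>\<^sup>+\<omega>. ennreal ((i t \<omega> - elementary_integral (E m) w t \<omega>)\<^sup>2) \<partial>N) \<longlonglongrightarrow> 0"
      "AE \<omega> in N. continuous_on {0..T} (\<lambda>t. i t \<omega>)"
    and x: "AE \<omega> in N. continuous_on {0..T} (\<lambda>t. x t \<omega>)"
      "AE \<omega> in N. \<forall>t\<in>{0..T}. x t \<omega> = x 0 \<omega> + integral {0..t} (\<lambda>s. - (1/2) * \<alpha> s * x s \<omega>) + i t \<omega>"
  shows "AE \<omega> in N. \<forall>t\<in>{0..T}. a_coeff \<alpha> t * x t \<omega>
    = x 0 \<omega> + wiener_integral (ou_coefficients.g \<alpha>) (ou_coefficients.g' \<alpha> \<alpha>') t \<omega>"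
proof -
  interpret ou_coefficients T \<alpha> \<alpha>' by (rule coeff)
  have "AE \<omega> in N. \<forall>t\<in>{0..T}. i t \<omega> = wiener_integral (\<lambda>t. sqrt (\<alpha> t)) \<sigma>' t \<omega>"
  proof (rule AE_eq_on_interval[OF T_pos])
    show "AE \<omega> in N. i t \<omega> = wiener_integral (\<lambda>t. sqrt (\<alpha> t)) \<sigma>' t \<omega>" if t: "t \<in> {0..T}" for t
      by (rule ito_integral_eq_wiener_integral[OF \<sigma>_deriv \<sigma>'_cont t E approx i(1)[OF t] i(2)[OF t]])
    show "AE \<omega> in N. continuous_on {0..T} (\<lambda>t. wiener_integral (\<lambda>t. sqrt (\<alpha> t)) \<sigma>' t \<omega>)"
      using cont
    proof eventually_elim
      case (elim \<omega>)
      then show ?case unfolding wiener_integral_def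
        by (intro continuous_intros \<alpha>_cont \<sigma>'_cont indefinite_integral_continuous_1 integrable_continuous_real)
    qed
  qed (rule i(3))
  with start cont x show ?thesis
  proof eventually_elim
    case (elim \<omega>)
    show ?case
    proof
      fix t assume t: "t \<in> {0..T}"
      show "a_coeff \<alpha> t * x t \<omega> = x 0 \<omega> + wiener_integral g g' t \<omega>"
        unfolding wiener_integral_def
      proof (rule variation_of_constants[where i="\<lambda>t. i t \<omega>", OF elim(3,2,1) _ _ t])
        fix s assume s: "s \<in> {0..T}"
        show "i s \<omega> = sqrt (\<alpha> s) * w s \<omega> - integral {0..s} (\<lambda>r. \<sigma>' r * w r \<omega>)"
          using elim(5) s by (simp add: wiener_integral_def)
        show "x s \<omega> = x 0 \<omega> + integral {0..s} (\<lambda>s. - (1/2) * \<alpha> s * x s \<omega>) + i s \<omega>"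
          using elim(4) s by blast
      qed
    qed
  qed
qed

end

subsection \<open>Orthonormal expansions and the trace\<close>

text \<open>Finite partial sums are orthogonal projections, so they approximate \<open>x\<close> at
  least as well as any vector of the span of the same basis elements. Density of the full span
  provides such a vector close to \<open>x\<close>.\<close>

lemma orthonormal_expansion:
  fixes B :: "'h::real_inner set"
  assumes B: "orthonormal_basis B"
  shows "((\<lambda>b. (x \<bullet> b) *\<^sub>R b) has_sum x) B"
  unfolding has_sum_def tendsto_iff eventually_finite_subsets_at_top
proof (intro allI impI)
  fix \<epsilon> :: real assume \<epsilon>: "0 < \<epsilon>"
  have unit: "b \<bullet> b = 1" if "b \<in> B" for b
    using B that by (simp add: orthonormal_basis_def norm_eq_1)
  have orth: "b \<bullet> c = 0" if "b \<in> B" "c \<in> B" "b \<noteq> c" for b c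
    using B that by (auto simp: orthonormal_basis_def pairwise_def orthogonal_def)
  have "x \<in> closure (span B)" using B by (simp add: orthonormal_basis_def)
  then obtain y where y: "y \<in> span B" "dist y x < \<epsilon>" using \<epsilon> by (meson closure_approachable)
  then obtain F r where F: "finite F" "F \<subseteq> B" and y_eq: "y = (\<Sum>a\<in>F. r a *\<^sub>R a)"
    by (auto simp: span_explicit)
  have "dist (\<Sum>b\<in>G. (x \<bullet> b) *\<^sub>R b) x < \<epsilon>" if G: "finite G" "F \<subseteq> G" "G \<subseteq> B" for G
  proof -
    define P where "P = (\<Sum>b\<in>G. (x \<bullet> b) *\<^sub>R b)"
    have perp: "(x - P) \<bullet> c = 0" if c: "c \<in> G" for c
    proof -
      have "P \<bullet> c = (\<Sum>b\<in>G. if b = c then x \<bullet> c else 0)"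
        unfolding P_def inner_sum_left
      proof (intro sum.cong refl)
        fix b assume "b \<in> G"
        then show "(x \<bullet> b) *\<^sub>R b \<bullet> c = (if b = c then x \<bullet> c else 0)"
          using c G(3) unit[of c] orth[of b c] by auto
      qed
      then show ?thesis using c G(1) by (simp add: inner_diff_left)
    qed
    have "(x - P) \<bullet> P = 0" "(x - P) \<bullet> y = 0"
      using perp G(2) unfolding y_eq by (auto simp: P_def inner_sum_right intro!: sum.neutral)
    then have "(norm (x - y))\<^sup>2 = (norm (x - P))\<^sup>2 + (norm (P - y))\<^sup>2"
      unfolding power2_norm_eq_inner by (simp add: inner_diff_left inner_diff_right inner_commute algebra_simps)
    then have "(norm (x - P))\<^sup>2 \<le> (norm (x - y))\<^sup>2" by simp
    then have "norm (x - P) \<le> norm (x - y)" by (rule power2_le_imp_le) simp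
    then show ?thesis using y(2) by (simp add: P_def dist_norm norm_minus_commute)
  qed
  then show "\<exists>X. finite X \<and> X \<subseteq> B \<and> (\<forall>Y. finite Y \<and> X \<subseteq> Y \<and> Y \<subseteq> B \<longrightarrow> dist (\<Sum>b\<in>Y. (x \<bullet> b) *\<^sub>R b) x < \<epsilon>)"
    using F by blast
qed

lemma parseval:
  assumes "orthonormal_basis B"
  shows "((\<lambda>b. (x \<bullet> b)\<^sup>2) has_sum (norm x)\<^sup>2) B"
  using has_sum_bounded_linear[OF bounded_linear_inner_right[of x] orthonormal_expansion[OF assms, of x]]
  unfolding power2_norm_eq_inner by (simp add: power2_eq_square)

locale eigenbasis =
  fixes e :: "nat \<Rightarrow> 'h::real_inner"
  assumes inj: "inj e" and basis: "orthonormal_basis (range e)"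
begin

lemma norm_e [simp]: "norm (e k) = 1"
  using basis by (simp add: orthonormal_basis_def)

lemma inner_e: "e j \<bullet> e k = (if j = k then 1 else 0)"
proof (cases "j = k")
  case True
  then show ?thesis using norm_eq_1[of "e k"] by simp
next
  case False
  then have "e j \<noteq> e k" using inj by (auto dest: injD)
  then show ?thesis
    using basis False by (auto simp: orthonormal_basis_def pairwise_def orthogonal_def)
qed

lemma expansion: "((\<lambda>k. (x \<bullet> e k) *\<^sub>R e k) has_sum x) UNIV"
  using orthonormal_expansion[OF basis, of x] by (simp add: has_sum_reindex[OF inj] comp_def)

lemma parseval_sums: "(\<lambda>k. (x \<bullet> e k)\<^sup>2) sums (norm x)\<^sup>2"
  using parseval[OF basis, of x] by (intro has_sum_imp_sums) (simp add: has_sum_reindex[OF inj] comp_def)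

lemma parseval_ennreal: "(\<Sum>k. ennreal ((x \<bullet> e k)\<^sup>2)) = ennreal ((norm x)\<^sup>2)"
  using parseval_sums[of x] by (simp add: suminf_ennreal2 sums_iff)

text \<open>\<open>op_trace\<close> is a definite description over all bases, so every basis
  \<open>B\<close> must give the same sum. The nonnegative family
  \<open>\<mu> k * (b \<bullet> e k)\<^sup>2\<close> is summed in both orders: over \<open>b\<close>
  first, Parseval gives \<open>suminf \<mu>\<close>; over \<open>k\<close> first, expanding
  \<open>b\<close> gives \<open>R b \<bullet> b\<close>.\<close>

lemma diagonal_trace:
  assumes R: "bounded_linear R" and eig: "\<And>k. R (e k) = \<mu> k *\<^sub>R e k"
    and \<mu>: "\<And>k. 0 \<le> \<mu> k" "summable \<mu>"
  shows "op_trace R = suminf \<mu>"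
proof -
  have trace: "((\<lambda>b. R b \<bullet> b) has_sum suminf \<mu>) B" if B: "orthonormal_basis B" for B
  proof -
    define f where "f = (\<lambda>(k, b). \<mu> k * (b \<bullet> e k)\<^sup>2)"
    have row: "((\<lambda>b. f (k, b)) has_sum \<mu> k) B" for k
      using has_sum_cmult_right[OF parseval[OF B, of "e k"], of "\<mu> k"] by (simp add: f_def inner_commute)
    have \<mu>_sum: "(\<mu> has_sum suminf \<mu>) UNIV"
      using \<mu> by (intro sums_nonneg_imp_has_sum summable_sums)
    have "f summable_on UNIV \<times> B"
    proof (rule summable_on_SigmaI[OF row])
      show "\<mu> summable_on UNIV" using \<mu>_sum by (auto simp: summable_on_def)
    qed (use \<mu> in \<open>auto simp: f_def\<close>)
    then have "(f has_sum suminf \<mu>) (UNIV \<times> B)"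
      by (intro has_sum_SigmaI[OF row \<mu>_sum])
    then have swapped: "((\<lambda>(b, k). f (k, b)) has_sum suminf \<mu>) (B \<times> UNIV)"
      by (subst (asm) has_sum_swap)
    show ?thesis
    proof (rule has_sum_SigmaD[OF swapped])
      fix b assume "b \<in> B"
      have "bounded_linear (\<lambda>y. R y \<bullet> b)"
        by (rule bounded_linear_compose[OF bounded_linear_inner_left R])
      from has_sum_bounded_linear[OF this expansion[of b]]
      show "((\<lambda>k. (\<lambda>(b, k). f (k, b)) (b, k)) has_sum R b \<bullet> b) UNIV"
        by (simp add: bounded_linear.linear[OF R, THEN linear_scale] eig f_def power2_eq_square inner_commute mult_ac)
    qed
  qed
  show ?thesis
    unfolding op_trace_def
  proof (rule the_equality)
    fix \<tau> assume "\<forall>B. orthonormal_basis B \<longrightarrow> ((\<lambda>b. R b \<bullet> b) has_sum \<tau>) B"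
    then show "\<tau> = suminf \<mu>" using basis trace has_sum_unique by blast
  qed (use trace in blast)
qed

end

section \<open>Eigenvalues and trace of \<open>Q\<close> minus its truncation\<close>

locale trace_class_eigenbasis = eigenbasis e for e :: "nat \<Rightarrow> 'h::real_inner" +
  fixes Q :: "'h \<Rightarrow> 'h" and lam :: "nat \<Rightarrow> real"
  assumes Q: "trace_class Q" and eig: "\<And>k. Q (e k) = lam k *\<^sub>R e k"
begin

lemma Q_e: "Q (e k) \<bullet> e k = lam k"
  by (simp add: eig inner_e)

lemma lam_nonneg: "0 \<le> lam k"
  using Q unfolding trace_class_def Q_e[symmetric] by blast

lemma lam_summable: "summable lam"
proof -
  have "(\<lambda>b. Q b \<bullet> b) summable_on range e" using Q basis unfolding trace_class_def by blast
  then have "(\<lambda>k. Q (e k) \<bullet> e k) summable_on UNIV"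
    by (simp add: summable_on_reindex[OF inj] comp_def)
  then show ?thesis unfolding Q_e by (rule summable_on_imp_summable)
qed

text \<open>The eigenvalues of \<open>Q\<close> minus \<open>truncated_op lam e n\<close> in the
  basis \<open>e\<close>.\<close>

definition tail :: "nat \<Rightarrow> nat \<Rightarrow> real" where
  "tail n k = (if k < n then 0 else lam k)"

lemma tail_nonneg: "0 \<le> tail n k"
  by (simp add: tail_def lam_nonneg)

lemma tail_sums: "tail n sums (suminf lam - (\<Sum>k<n. lam k))"
proof -
  have "(\<lambda>k. if k \<in> {..<n} then lam k else 0) sums (\<Sum>k<n. lam k)"
    by (rule sums_If_finite_set) simp
  from sums_diff[OF summable_sums[OF lam_summable] this] show ?thesis
    by (rule sums_cong[THEN iffD1, rotated]) (simp add: tail_def)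
qed

lemma op_trace_tail: "op_trace (\<lambda>x. Q x - truncated_op lam e n x) = suminf (tail n)"
proof (rule diagonal_trace)
  have "bounded_linear Q" using Q by (simp add: trace_class_def)
  moreover have "bounded_linear (truncated_op lam e n)"
    unfolding truncated_op_def[abs_def]
    by (intro bounded_linear_sum bounded_linear_scaleR_right[THEN bounded_linear_compose]
        bounded_linear_scaleR_left[THEN bounded_linear_compose] bounded_linear_inner_right)
  ultimately show "bounded_linear (\<lambda>x. Q x - truncated_op lam e n x)" by (rule bounded_linear_sub)
  show "Q (e k) - truncated_op lam e n (e k) = tail n k *\<^sub>R e k" for k
  proof -
    have "truncated_op lam e n (e k) = (\<Sum>j<n. if j = k then lam k *\<^sub>R e k else 0)"
      unfolding truncated_op_def by (intro sum.cong) (auto simp: inner_e)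
    then show ?thesis by (simp add: eig tail_def)
  qed
  show "summable (tail n)" using tail_sums by (rule sums_summable)
qed (rule tail_nonneg)

lemma op_trace_tail_tendsto_0: "(\<lambda>n. op_trace (\<lambda>x. Q x - truncated_op lam e n x)) \<longlonglongrightarrow> 0"
proof -
  have "(\<lambda>n. suminf lam - (\<Sum>k<n. lam k)) \<longlonglongrightarrow> suminf lam - suminf lam"
    by (intro tendsto_diff tendsto_const summable_LIMSEQ lam_summable)
  then show ?thesis unfolding op_trace_tail using tail_sums by (simp add: sums_iff)
qed

lemma suminf_tail_ennreal:
  assumes "0 \<le> c"
  shows "(\<Sum>k. ennreal (c * tail n k)) = ennreal (c * op_trace (\<lambda>x. Q x - truncated_op lam e n x))"
  using tail_sums[of n] assms tail_nonneg unfolding op_trace_tail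
  by (subst suminf_ennreal2) (auto simp: sums_iff suminf_mult intro: summable_mult)

end

subsection \<open>Components of strong solutions\<close>

text \<open>The two functions differ only inside a null set, and every subset of that set is again
  null for the completion, hence in \<open>G\<close>.\<close>

lemma AE_completion_measurable:
  assumes f: "f \<in> borel_measurable G" and G: "space G = space M" "null_sets (completion M) \<subseteq> sets G"
    and eq: "AE \<omega> in completion M. f \<omega> = f' \<omega>"
  shows "f' \<in> borel_measurable G"
proof (rule measurableI)
  fix A :: "'b::topological_space set" assume A: "A \<in> sets borel"
  obtain Z where Z: "Z \<in> null_sets (completion M)" "{\<omega> \<in> space M. f \<omega> \<noteq> f' \<omega>} \<subseteq> Z"
    using eq by (auto simp: eventually_ae_filter)
  have "f' -` A \<inter> space G = (f -` A \<inter> space G - Z) \<union> (f' -` A \<inter> space G \<inter> Z)"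
    using Z(2) G(1) by auto
  moreover have "f' -` A \<inter> space G \<inter> Z \<in> null_sets (completion M)"
    by (rule null_sets_completion_subset[OF _ Z(1)]) auto
  then have "f' -` A \<inter> space G \<inter> Z \<in> sets G" "Z \<in> sets G"
    using Z(1) G(2) by blast+
  ultimately show "f' -` A \<inter> space G \<in> sets G"
    using measurable_sets[OF f A] by (metis sets.Diff sets.Un)
qed simp

lemma elementary_integral_inner:
  "elementary_integral E V t \<omega> \<bullet> h = elementary_integral E (\<lambda>t \<omega>. V t \<omega> \<bullet> h) t \<omega>"
  unfolding elementary_integral_def
  by (induction E) (auto simp: inner_add_left inner_diff_left)

lemma elementary_integral_cong:
  assumes "is_elementary M F T E" "t \<in> {0..T}" "\<And>s. s \<in> {0..T} \<Longrightarrow> V s \<omega> = V' s \<omega>"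
  shows "elementary_integral E V t \<omega> = elementary_integral E V' t \<omega>"
  unfolding elementary_integral_def
proof (intro arg_cong[of _ _ sum_list] map_cong refl)
  fix x assume x: "x \<in> set E"
  obtain s u \<phi> where [simp]: "x = (s, u, \<phi>)" by (cases x)
  have "0 \<le> s" "s \<le> u" "u \<le> T" using assms(1) x by (auto simp: is_elementary_def)
  then have "min u t \<in> {0..T}" "min s t \<in> {0..T}" using assms(2) by auto
  then show "(case x of (s, u, \<phi>) \<Rightarrow> \<phi> \<omega> *\<^sub>R (V (min u t) \<omega> - V (min s t) \<omega>))
      = (case x of (s, u, \<phi>) \<Rightarrow> \<phi> \<omega> *\<^sub>R (V' (min u t) \<omega> - V' (min s t) \<omega>))"
    using assms(3) by simp
qed

lemma set_integral_inner:
  fixes f :: "real \<Rightarrow> 'h::{real_inner, banach, second_countable_topology}"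
  assumes "continuous_on {0..t} f"
  shows "(LBINT s:{0..t}. f s) \<bullet> h = integral {0..t} (\<lambda>s. f s \<bullet> h)"
proof -
  have int: "set_integrable lborel {0..t} f" by (rule borel_integrable_atLeastAtMost'[OF assms])
  have "(LBINT s:{0..t}. f s) \<bullet> h = (LBINT s:{0..t}. f s \<bullet> h)"
    using integral_inner_left[OF int[unfolded set_integrable_def], of h]
    by (simp add: set_lebesgue_integral_def)
  also have "\<dots> = integral {0..t} (\<lambda>s. f s \<bullet> h)"
    using assms by (intro set_borel_integral_eq_integral borel_integrable_atLeastAtMost' continuous_intros)
  finally show ?thesis .
qed

context wiener_start
begin

text \<open>A general driver \<open>V\<close> covers the full and the truncated noise. The
  filtration of the driver lies inside \<open>F\<close>, so its elementary integrands are admissible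
  for the scalar isometry in \<open>F\<close>; the component of \<open>V\<close> has to match the
  scalar noise only almost surely.\<close>

lemma strong_solution_component:
  assumes coeff: "ou_coefficients T \<alpha> \<alpha>'"
    and noise: "scalar_noise N F T q v"
    and V: "AE \<omega> in N. \<forall>t\<in>{0..T}. V t \<omega> \<bullet> h = v t \<omega>"
    and h: "norm h = 1"
    and filt: "\<And>t. t \<in> {0..T} \<Longrightarrow> subalgebra (F t) (driving_filtration M \<xi> V t)"
    and sol: "strong_solution M T \<alpha> V \<xi> Y"
  shows "AE \<omega> in N. \<forall>t\<in>{0..T}. a_coeff \<alpha> t * (Y t \<omega> \<bullet> h)
    = \<xi> \<omega> \<bullet> h + scalar_noise.wiener_integral v (ou_coefficients.g \<alpha>) (ou_coefficients.g' \<alpha> \<alpha>') t \<omega>"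
proof -
  interpret S: scalar_noise N F T q v by (rule noise)
  interpret ou_coefficients T \<alpha> \<alpha>' by (rule coeff)
  let ?F' = "driving_filtration M \<xi> V"
  obtain I where ito: "is_ito_integral M ?F' T V (\<lambda>t _. sqrt (\<alpha> t)) I"
    and sde: "AE \<omega> in M. \<forall>t\<in>{0..T}. Y t \<omega> = Y 0 \<omega> + (LBINT s:{0..t}. (- (1/2) * \<alpha> s) *\<^sub>R Y s \<omega>) + I t \<omega>"
    using sol unfolding strong_solution_def by blast
  obtain E where E: "\<And>m. is_elementary M ?F' T (E m)"
    and approx: "(\<lambda>m. \<integral>\<^sup>+\<omega>. (\<integral>\<^sup>+t\<in>{0..T}. ennreal ((sqrt (\<alpha> t) - elementary_process (E m) t \<omega>)\<^sup>2) \<partial>lborel) \<partial>M) \<longlonglongrightarrow> 0"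
    and conv: "\<And>t. t \<in> {0..T} \<Longrightarrow> (\<lambda>m. \<integral>\<^sup>+\<omega>. ennreal ((norm (I t \<omega> - elementary_integral (E m) V t \<omega>))\<^sup>2) \<partial>M) \<longlonglongrightarrow> 0"
    using ito unfolding is_ito_integral_def by blast
  have I: "\<And>t. t \<in> {0..T} \<Longrightarrow> I t \<in> borel_measurable (?F' t)"
    and I_cont: "AE \<omega> in M. continuous_on {0..T} (\<lambda>t. I t \<omega>)"
    using ito unfolding is_ito_integral_def by blast+
  have Y: "AE \<omega> in M. continuous_on {0..T} (\<lambda>t. Y t \<omega>)" "AE \<omega> in M. Y 0 \<omega> = \<xi> \<omega>"
    using sol unfolding strong_solution_def by blast+
  have E': "is_elementary N F T (E m)" for m
    unfolding is_elementary_def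
  proof (intro ballI, clarify)
    fix s u \<phi> assume x: "(s, u, \<phi>) \<in> set (E m)"
    have *: "0 \<le> s \<and> s \<le> u \<and> u \<le> T \<and> \<phi> \<in> borel_measurable (?F' s) \<and> (\<exists>c. \<forall>\<omega>\<in>space M. \<bar>\<phi> \<omega>\<bar> \<le> c)"
      using E[of m] x unfolding is_elementary_def by fastforce
    then have "\<phi> \<in> borel_measurable (F s)"
      by (intro measurable_from_subalg[OF filt]) auto
    then show "0 \<le> s \<and> s \<le> u \<and> u \<le> T \<and> \<phi> \<in> borel_measurable (F s) \<and> (\<exists>c. \<forall>\<omega>\<in>space N. \<bar>\<phi> \<omega>\<bar> \<le> c)"
      using * by simp
  qed
  have "AE \<omega> in N. \<forall>t\<in>{0..T}. a_coeff \<alpha> t * (Y t \<omega> \<bullet> h) = Y 0 \<omega> \<bullet> h + S.wiener_integral g g' t \<omega>"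
  proof (rule S.linear_sde_solution[OF coeff E', where i="\<lambda>t \<omega>. I t \<omega> \<bullet> h"])
    show "(\<lambda>m. \<integral>\<^sup>+\<omega>. (\<integral>\<^sup>+r\<in>{0..T}. ennreal ((sqrt (\<alpha> r) - elementary_process (E m) r \<omega>)\<^sup>2) \<partial>lborel) \<partial>N) \<longlonglongrightarrow> 0"
      using approx by (simp add: nn_integral_completion)
    show "AE \<omega> in N. continuous_on {0..T} (\<lambda>t. I t \<omega> \<bullet> h)"
      using I_cont unfolding AE_completion_iff by eventually_elim (intro continuous_intros)
    show "AE \<omega> in N. continuous_on {0..T} (\<lambda>t. Y t \<omega> \<bullet> h)"
      using Y(1) unfolding AE_completion_iff by eventually_elim (intro continuous_intros)
    show "AE \<omega> in N. \<forall>t\<in>{0..T}. Y t \<omega> \<bullet> h = Y 0 \<omega> \<bullet> h + integral {0..t} (\<lambda>s. - (1/2) * \<alpha> s * (Y s \<omega> \<bullet> h)) + I t \<omega> \<bullet> h"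
      using sde Y(1) unfolding AE_completion_iff
    proof eventually_elim
      case (elim \<omega>)
      show ?case
      proof
        fix t assume t: "t \<in> {0..T}"
        have "continuous_on {0..t} (\<lambda>s. (- (1/2) * \<alpha> s) *\<^sub>R Y s \<omega>)"
          using t by (intro continuous_on_subset[of "{0..T}" _ "{0..t}"] continuous_intros \<alpha>_cont elim(2)) auto
        from set_integral_inner[OF this, of h]
        have "(LBINT s:{0..t}. (- (1/2) * \<alpha> s) *\<^sub>R Y s \<omega>) \<bullet> h = integral {0..t} (\<lambda>s. - (1/2) * \<alpha> s * (Y s \<omega> \<bullet> h))"
          unfolding inner_scaleR_left .
        moreover have "Y t \<omega> \<bullet> h = (Y 0 \<omega> + (LBINT s:{0..t}. (- (1/2) * \<alpha> s) *\<^sub>R Y s \<omega>) + I t \<omega>) \<bullet> h"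
          using elim(1) t by metis
        ultimately show "Y t \<omega> \<bullet> h = Y 0 \<omega> \<bullet> h + integral {0..t} (\<lambda>s. - (1/2) * \<alpha> s * (Y s \<omega> \<bullet> h)) + I t \<omega> \<bullet> h"
          unfolding inner_add_left by simp
      qed
    qed
  next
    fix t assume t: "t \<in> {0..T}"
    have "I t \<in> borel_measurable N"
      using measurable_from_subalg[OF F_subalgebra[OF t] measurable_from_subalg[OF filt[OF t] I[OF t]]] .
    then show "(\<lambda>\<omega>. I t \<omega> \<bullet> h) \<in> borel_measurable N" by simp
    \<comment> \<open>Taking the component along the unit vector \<open>h\<close> is a contraction,
      so convergence in the Hilbert space passes to the component.\<close>
    show "(\<lambda>m. \<integral>\<^sup>+\<omega>. ennreal ((I t \<omega> \<bullet> h - elementary_integral (E m) v t \<omega>)\<^sup>2) \<partial>N) \<longlonglongrightarrow> 0"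
    proof (rule tendsto_sandwich[OF _ _ tendsto_const conv[OF t]])
      show "\<forall>\<^sub>F m in sequentially. (\<integral>\<^sup>+\<omega>. ennreal ((I t \<omega> \<bullet> h - elementary_integral (E m) v t \<omega>)\<^sup>2) \<partial>N)
        \<le> (\<integral>\<^sup>+\<omega>. ennreal ((norm (I t \<omega> - elementary_integral (E m) V t \<omega>))\<^sup>2) \<partial>M)"
      proof (intro always_eventually allI)
        fix m
        have "(\<integral>\<^sup>+\<omega>. ennreal ((I t \<omega> \<bullet> h - elementary_integral (E m) v t \<omega>)\<^sup>2) \<partial>N)
          \<le> (\<integral>\<^sup>+\<omega>. ennreal ((norm (I t \<omega> - elementary_integral (E m) V t \<omega>))\<^sup>2) \<partial>N)"
        proof (rule nn_integral_mono_AE)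
          show "AE \<omega> in N. ennreal ((I t \<omega> \<bullet> h - elementary_integral (E m) v t \<omega>)\<^sup>2)
            \<le> ennreal ((norm (I t \<omega> - elementary_integral (E m) V t \<omega>))\<^sup>2)"
            using V
          proof eventually_elim
            case (elim \<omega>)
            let ?d = "I t \<omega> - elementary_integral (E m) V t \<omega>"
            have "elementary_integral (E m) v t \<omega> = elementary_integral (E m) V t \<omega> \<bullet> h"
              unfolding elementary_integral_inner
              by (rule elementary_integral_cong[OF E t]) (use elim in simp)
            then have "I t \<omega> \<bullet> h - elementary_integral (E m) v t \<omega> = ?d \<bullet> h" by (simp add: inner_diff_left)
            moreover have "\<bar>?d \<bullet> h\<bar> \<le> norm ?d" using Cauchy_Schwarz_ineq2[of ?d h] h by simp
            then have "(?d \<bullet> h)\<^sup>2 \<le> (norm ?d)\<^sup>2" by (simp add: abs_le_square_iff[symmetric])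
            ultimately show ?case by (simp add: ennreal_leI)
          qed
        qed
        then show "(\<integral>\<^sup>+\<omega>. ennreal ((I t \<omega> \<bullet> h - elementary_integral (E m) v t \<omega>)\<^sup>2) \<partial>N)
          \<le> (\<integral>\<^sup>+\<omega>. ennreal ((norm (I t \<omega> - elementary_integral (E m) V t \<omega>))\<^sup>2) \<partial>M)"
          by (simp only: nn_integral_completion)
      qed
    qed simp
  qed
  with Y(2)[THEN AE_completion] show ?thesis by eventually_elim simp
qed

text \<open>Components beyond the truncation level have no noise; through this instance
  \<open>strong_solution_component\<close> applies to them as well. The filtration axioms are
  borrowed from the noise with \<open>h = 0\<close>.\<close>

lemma scalar_noise_zero: "scalar_noise N F T 0 (\<lambda>_ _. 0)"
proof -
  interpret S: scalar_noise N F T "Q 0 \<bullet> 0" "\<lambda>t \<omega>. W t \<omega> \<bullet> 0" by (rule scalar_noise_inner)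
  show ?thesis
    by unfold_locales (auto simp: S.horizon S.sub S.filtration has_bochner_integral_zero)
qed

end

subsection \<open>Truncation of the Karhunen--Loeve expansion\<close>

locale truncation = wiener_start M T Q W X0 + trace_class_eigenbasis e Q lam + ou_coefficients T \<alpha> \<alpha>'
  for M :: "'w measure" and T :: real and Q :: "'h::{real_inner, banach, second_countable_topology} \<Rightarrow> 'h"
    and W :: "real \<Rightarrow> 'w \<Rightarrow> 'h" and X0 :: "'w \<Rightarrow> 'h" and e :: "nat \<Rightarrow> 'h" and lam :: "nat \<Rightarrow> real"
    and \<alpha> \<alpha>' :: "real \<Rightarrow> real" +
  fixes \<beta> :: "nat \<Rightarrow> real \<Rightarrow> 'w \<Rightarrow> real" and X :: "real \<Rightarrow> 'w \<Rightarrow> 'h"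
    and X0n :: "nat \<Rightarrow> 'w \<Rightarrow> 'h" and Xn :: "nat \<Rightarrow> real \<Rightarrow> 'w \<Rightarrow> 'h"
  assumes kl: "karhunen_loeve M T lam \<beta> e W"
    and X: "strong_solution M T \<alpha> W X0 X"
    and X0n: "\<And>n \<omega>. X0n n \<omega> = (\<Sum>k<n. (X0 \<omega> \<bullet> e k) *\<^sub>R e k)"
    and Xn: "\<And>n. strong_solution M T \<alpha> (kl_partial_sum lam \<beta> e n) (X0n n) (Xn n)"
begin

lemma inner_partial_sum: "(\<Sum>j<n. c j *\<^sub>R e j) \<bullet> e k = (if k < n then c k else 0)"
proof -
  have "(\<Sum>j<n. c j *\<^sub>R e j) \<bullet> e k = (\<Sum>j<n. if j = k then c k else 0)"
    unfolding inner_sum_left by (intro sum.cong) (auto simp: inner_e)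
  then show ?thesis by simp
qed

lemma kl_component: "kl_partial_sum lam \<beta> e n t \<omega> \<bullet> e k = (if k < n then sqrt (lam k) * \<beta> k t \<omega> else 0)"
  unfolding kl_partial_sum_def by (rule inner_partial_sum)

text \<open>Once \<open>n > k\<close>, the component along \<open>e k\<close> of \<open>W\<close>
  minus the partial sum no longer depends on \<open>n\<close>, while the Karhunen-Loeve error that
  bounds its mean square tends to 0.\<close>

lemma W_component: "AE \<omega> in N. \<forall>t\<in>{0..T}. W t \<omega> \<bullet> e k = sqrt (lam k) * \<beta> k t \<omega>"
  unfolding AE_completion_iff
proof (rule AE_eq_on_interval[OF T_pos])
  have b: "brownian_motion M T (\<beta> k)" using kl by (simp add: karhunen_loeve_def)
  show "AE \<omega> in M. continuous_on {0..T} (\<lambda>t. W t \<omega> \<bullet> e k)"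
    using W_cont by eventually_elim (intro continuous_intros)
  have "AE \<omega> in M. continuous_on {0..T} (\<lambda>t. \<beta> k t \<omega>)"
    using b unfolding wiener_process_def by blast
  then show "AE \<omega> in M. continuous_on {0..T} (\<lambda>t. sqrt (lam k) * \<beta> k t \<omega>)"
    by eventually_elim (intro continuous_intros)
  fix t assume t: "t \<in> {0..T}"
  define d where "d \<omega> = W t \<omega> \<bullet> e k - sqrt (lam k) * \<beta> k t \<omega>" for \<omega>
  have "\<beta> k t \<in> borel_measurable M"
    using b t unfolding wiener_process_def by blast
  then have meas: "(\<lambda>\<omega>. ennreal ((d \<omega>)\<^sup>2)) \<in> borel_measurable M"
    unfolding d_def using W_measurable[OF t] by measurable
  let ?K = "\<lambda>n. \<integral>\<^sup>+\<omega>. (SUP t\<in>{0..T}. ennreal ((norm (W t \<omega> - kl_partial_sum lam \<beta> e n t \<omega>))\<^sup>2)) \<partial>M"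
  have "(\<integral>\<^sup>+\<omega>. ennreal ((d \<omega>)\<^sup>2) \<partial>M) \<le> ?K n" if "k < n" for n
  proof (rule nn_integral_mono)
    fix \<omega>
    let ?r = "W t \<omega> - kl_partial_sum lam \<beta> e n t \<omega>"
    have "d \<omega> = ?r \<bullet> e k" using that by (simp add: d_def inner_diff_left kl_component)
    then have "\<bar>d \<omega>\<bar> \<le> norm ?r" using Cauchy_Schwarz_ineq2[of ?r "e k"] by simp
    then have "(d \<omega>)\<^sup>2 \<le> (norm ?r)\<^sup>2" by (simp add: abs_le_square_iff[symmetric])
    then show "ennreal ((d \<omega>)\<^sup>2) \<le> (SUP t\<in>{0..T}. ennreal ((norm (W t \<omega> - kl_partial_sum lam \<beta> e n t \<omega>))\<^sup>2))"
      using t by (intro SUP_upper2[of t]) (auto intro: ennreal_leI)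
  qed
  moreover have "?K \<longlonglongrightarrow> 0" using kl by (simp add: karhunen_loeve_def)
  ultimately have "(\<integral>\<^sup>+\<omega>. ennreal ((d \<omega>)\<^sup>2) \<partial>M) \<le> 0"
    by (intro LIMSEQ_le_const[of ?K]) (auto intro!: exI[of _ "Suc k"])
  then have "AE \<omega> in M. ennreal ((d \<omega>)\<^sup>2) = 0"
    using meas by (simp add: nn_integral_0_iff_AE)
  then show "AE \<omega> in M. W t \<omega> \<bullet> e k = sqrt (lam k) * \<beta> k t \<omega>"
    by eventually_elim (simp add: d_def)
qed

text \<open>
  Here the completeness of \<open>F\<close> enters: the truncated noise is only almost surely a function of \<open>W\<close>.
\<close>

lemma truncated_filtration:
  assumes t: "t \<in> {0..T}"
  shows "subalgebra (F t) (driving_filtration M (X0n n) (kl_partial_sum lam \<beta> e n) t)"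
proof -
  let ?V = "kl_partial_sum lam \<beta> e n"
  have null: "null_sets N \<subseteq> sets (F t)" unfolding sets_F by auto
  have "X0 \<in> borel_measurable (F t)"
    by (intro measurableI) (auto simp: sets_F space_F intro!: sigma_sets.Basic)
  then have X0n_meas: "X0n n \<in> borel_measurable (F t)"
    unfolding X0n[abs_def] by measurable
  have V_meas: "?V s \<in> borel_measurable (F t)" if s: "0 \<le> s" "s \<le> t" for s
  proof (rule AE_completion_measurable[where M=M])
    show "(\<lambda>\<omega>. \<Sum>k<n. (W s \<omega> \<bullet> e k) *\<^sub>R e k) \<in> borel_measurable (F t)"
      using W_adapted[OF s] by measurable
    have "AE \<omega> in N. \<forall>k. \<forall>t\<in>{0..T}. W t \<omega> \<bullet> e k = sqrt (lam k) * \<beta> k t \<omega>"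
      unfolding AE_all_countable using W_component by blast
    then show "AE \<omega> in N. (\<Sum>k<n. (W s \<omega> \<bullet> e k) *\<^sub>R e k) = ?V s \<omega>"
    proof eventually_elim
      case (elim \<omega>)
      have "s \<in> {0..T}" using s t by auto
      then show ?case unfolding kl_partial_sum_def using elim by (intro sum.cong) auto
    qed
  qed (use null in \<open>auto simp: space_F\<close>)
  have "{X0n n -` A \<inter> space M | A. A \<in> sets borel} \<union>
      {?V s -` A \<inter> space M | s A. 0 \<le> s \<and> s \<le> t \<and> A \<in> sets borel} \<union> null_sets N \<subseteq> sets (F t)"
    using null measurable_sets[OF X0n_meas] measurable_sets[OF V_meas] by (auto simp: space_F)
  then have "sigma_sets (space (F t)) ({X0n n -` A \<inter> space M | A. A \<in> sets borel} \<union>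
      {?V s -` A \<inter> space M | s A. 0 \<le> s \<and> s \<le> t \<and> A \<in> sets borel} \<union> null_sets N) \<subseteq> sets (F t)"
    by (rule sets.sigma_sets_subset)
  moreover have "null_sets N \<subseteq> Pow (space M)" using sets.sets_into_space[of _ N] by (auto simp: null_sets_def)
  ultimately show ?thesis
    unfolding subalgebra_def driving_filtration_def[of M "X0n n"] space_F
    by (subst sets_measure_of) (auto simp: space_measure_of_conv)
qed

abbreviation "noise_integral k \<equiv> scalar_noise.wiener_integral (\<lambda>t \<omega>. W t \<omega> \<bullet> e k) g g'"

lemma X_component:
  "AE \<omega> in N. \<forall>t\<in>{0..T}. a t * (X t \<omega> \<bullet> e k) = X0 \<omega> \<bullet> e k + noise_integral k t \<omega>"
  by (rule strong_solution_component[OF ou_coefficients_axioms scalar_noise_inner _ _ _ X])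
    (auto simp: F_mono)

lemma Xn_component:
  "AE \<omega> in N. \<forall>t\<in>{0..T}. a t * (Xn n t \<omega> \<bullet> e k) = (if k < n then X0 \<omega> \<bullet> e k + noise_integral k t \<omega> else 0)"
proof (cases "k < n")
  case True
  have "AE \<omega> in N. \<forall>t\<in>{0..T}. a t * (Xn n t \<omega> \<bullet> e k) = X0n n \<omega> \<bullet> e k + noise_integral k t \<omega>"
  proof (rule strong_solution_component[OF ou_coefficients_axioms scalar_noise_inner _ _ truncated_filtration Xn])
    show "AE \<omega> in N. \<forall>t\<in>{0..T}. kl_partial_sum lam \<beta> e n t \<omega> \<bullet> e k = W t \<omega> \<bullet> e k"
      using W_component[of k] by eventually_elim (simp add: kl_component True)
  qed auto
  then show ?thesis using True by (simp add: X0n inner_partial_sum)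
next
  case False
  have "AE \<omega> in N. \<forall>t\<in>{0..T}. a t * (Xn n t \<omega> \<bullet> e k) = X0n n \<omega> \<bullet> e k + scalar_noise.wiener_integral (\<lambda>_ _. 0) g g' t \<omega>"
    by (rule strong_solution_component[OF ou_coefficients_axioms scalar_noise_zero _ _ truncated_filtration Xn])
      (auto simp: kl_component False)
  then show ?thesis
    using False by (simp add: X0n inner_partial_sum scalar_noise.wiener_integral_def[OF scalar_noise_zero])
qed

section \<open>From components to the error estimates\<close>

lemma X0_diff_component: "(X0 \<omega> - X0n n \<omega>) \<bullet> e k = (if k < n then 0 else X0 \<omega> \<bullet> e k)"
  by (simp add: inner_diff_left X0n inner_partial_sum)

text \<open>Components below \<open>n\<close> cancel; in the others initial value and noise are
  separated at the price of the factor 2, and Parseval sums up. Extended nonnegative reals keep the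
  noise series meaningful before its finiteness is known.\<close>

lemma difference_bound:
  "AE \<omega> in N. \<forall>t\<in>{0..T}. ennreal ((norm (X t \<omega> - Xn n t \<omega>))\<^sup>2)
    \<le> ennreal (2 / (a t)\<^sup>2) * ennreal ((norm (X0 \<omega> - X0n n \<omega>))\<^sup>2)
      + (\<Sum>k. ennreal (2 / (a t)\<^sup>2) * (if k < n then 0 else ennreal ((noise_integral k t \<omega>)\<^sup>2)))"
proof -
  have "AE \<omega> in N. \<forall>k. \<forall>t\<in>{0..T}. a t * (X t \<omega> \<bullet> e k) = X0 \<omega> \<bullet> e k + noise_integral k t \<omega>"
    "AE \<omega> in N. \<forall>k. \<forall>t\<in>{0..T}. a t * (Xn n t \<omega> \<bullet> e k) = (if k < n then X0 \<omega> \<bullet> e k + noise_integral k t \<omega> else 0)"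
    unfolding AE_all_countable using X_component Xn_component by blast+
  then show ?thesis
  proof eventually_elim
    case (elim \<omega>)
    show ?case
    proof
      fix t assume t: "t \<in> {0..T}"
      let ?c = "2 / (a t)\<^sup>2"
      have "ennreal (((X t \<omega> - Xn n t \<omega>) \<bullet> e k)\<^sup>2)
        \<le> ennreal ?c * ennreal (((X0 \<omega> - X0n n \<omega>) \<bullet> e k)\<^sup>2)
          + ennreal ?c * (if k < n then 0 else ennreal ((noise_integral k t \<omega>)\<^sup>2))" for k
      proof -
        have eq: "a t * ((X t \<omega> - Xn n t \<omega>) \<bullet> e k) = (if k < n then 0 else X0 \<omega> \<bullet> e k + noise_integral k t \<omega>)"
          using elim t by (simp add: inner_diff_left right_diff_distrib)
        show ?thesis
        proof (cases "k < n")
          case True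
          then show ?thesis using eq a_pos[of t] by simp
        next
          case False
          let ?u = "X0 \<omega> \<bullet> e k" and ?v = "noise_integral k t \<omega>"
          have "(X t \<omega> - Xn n t \<omega>) \<bullet> e k = (?u + ?v) / a t"
            using eq False a_pos[of t] by (simp add: field_simps)
          then have "((X t \<omega> - Xn n t \<omega>) \<bullet> e k)\<^sup>2 = (?u + ?v)\<^sup>2 / (a t)\<^sup>2"
            by (simp add: power_divide)
          also have "\<dots> \<le> (2 * ?u\<^sup>2 + 2 * ?v\<^sup>2) / (a t)\<^sup>2"
            using zero_le_power2[of "?u - ?v"]
            by (intro divide_right_mono) (auto simp: power2_eq_square algebra_simps)
          also have "\<dots> = ?c * ?u\<^sup>2 + ?c * ?v\<^sup>2" by (simp add: add_divide_distrib)
          finally have "ennreal (((X t \<omega> - Xn n t \<omega>) \<bullet> e k)\<^sup>2) \<le> ennreal (?c * ?u\<^sup>2 + ?c * ?v\<^sup>2)"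
            by (rule ennreal_leI)
          also have "\<dots> = ennreal (?c * ?u\<^sup>2) + ennreal (?c * ?v\<^sup>2)"
            by (rule ennreal_plus) auto
          also have "ennreal (?c * ?u\<^sup>2) = ennreal ?c * ennreal (?u\<^sup>2)"
            by (rule ennreal_mult) auto
          also have "ennreal (?c * ?v\<^sup>2) = ennreal ?c * ennreal (?v\<^sup>2)"
            by (rule ennreal_mult) auto
          finally show ?thesis using False by (simp add: X0_diff_component)
        qed
      qed
      then have "(\<Sum>k. ennreal (((X t \<omega> - Xn n t \<omega>) \<bullet> e k)\<^sup>2))
        \<le> (\<Sum>k. ennreal ?c * ennreal (((X0 \<omega> - X0n n \<omega>) \<bullet> e k)\<^sup>2)
          + ennreal ?c * (if k < n then 0 else ennreal ((noise_integral k t \<omega>)\<^sup>2)))"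
        by (intro suminf_le) auto
      also have "\<dots> = (\<Sum>k. ennreal ?c * ennreal (((X0 \<omega> - X0n n \<omega>) \<bullet> e k)\<^sup>2))
        + (\<Sum>k. ennreal ?c * (if k < n then 0 else ennreal ((noise_integral k t \<omega>)\<^sup>2)))"
        by (intro suminf_add[symmetric]) auto
      finally show "ennreal ((norm (X t \<omega> - Xn n t \<omega>))\<^sup>2)
        \<le> ennreal ?c * ennreal ((norm (X0 \<omega> - X0n n \<omega>))\<^sup>2)
          + (\<Sum>k. ennreal ?c * (if k < n then 0 else ennreal ((noise_integral k t \<omega>)\<^sup>2)))"
        unfolding ennreal_suminf_cmult parseval_ennreal .
    qed
  qed
qed

lemma X0_diff_measurable: "(\<lambda>\<omega>. ennreal ((norm (X0 \<omega> - X0n n \<omega>))\<^sup>2)) \<in> borel_measurable M"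
  unfolding X0n using X0_measurable by measurable

text \<open>Common source of both estimates: \<open>S = {t}\<close> with
  \<open>c = 2 / (a t)\<^sup>2\<close> and \<open>d = (a t)\<^sup>2 - 1\<close>, or
  \<open>S = {0..T}\<close> with \<open>c = 2\<close> and
  \<open>d = 4 * ((a T)\<^sup>2 - 1)\<close>. The measurable majorants \<open>Z k\<close> take the
  place of the suprema over \<open>S\<close>.\<close>

lemma truncation_error:
  assumes S: "S \<subseteq> {0..T}" and c: "0 \<le> c" "\<And>t. t \<in> S \<Longrightarrow> 2 / (a t)\<^sup>2 \<le> c" and d: "0 \<le> d"
    and Z: "\<And>k. Z k \<in> borel_measurable N" "\<And>k. (\<integral>\<^sup>+\<omega>. Z k \<omega> \<partial>N) \<le> ennreal (lam k * d)"
      "\<And>k. AE \<omega> in N. \<forall>t\<in>S. ennreal ((noise_integral k t \<omega>)\<^sup>2) \<le> Z k \<omega>"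
  shows "(\<integral>\<^sup>+\<omega>. (SUP t\<in>S. ennreal ((norm (X t \<omega> - Xn n t \<omega>))\<^sup>2)) \<partial>M)
    \<le> ennreal c * (\<integral>\<^sup>+\<omega>. ennreal ((norm (X0 \<omega> - X0n n \<omega>))\<^sup>2) \<partial>M)
      + ennreal (c * d * op_trace (\<lambda>x. Q x - truncated_op lam e n x))"
proof -
  define D where "D \<omega> = ennreal ((norm (X0 \<omega> - X0n n \<omega>))\<^sup>2)" for \<omega>
  define Y where "Y k \<omega> = ennreal c * (if k < n then 0 else Z k \<omega>)" for k \<omega>
  have D: "D \<in> borel_measurable N"
    unfolding D_def by (rule measurable_completion[OF X0_diff_measurable])
  have Y: "Y k \<in> borel_measurable N" for k
    unfolding Y_def using Z(1) by simp
  have "AE \<omega> in N. \<forall>k. \<forall>t\<in>S. ennreal ((noise_integral k t \<omega>)\<^sup>2) \<le> Z k \<omega>"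
    unfolding AE_all_countable using Z(3) by blast
  with difference_bound[of n]
  have "AE \<omega> in N. (SUP t\<in>S. ennreal ((norm (X t \<omega> - Xn n t \<omega>))\<^sup>2)) \<le> ennreal c * D \<omega> + (\<Sum>k. Y k \<omega>)"
  proof eventually_elim
    case (elim \<omega>)
    show ?case
    proof (rule SUP_least)
      fix t assume t: "t \<in> S"
      have "ennreal ((norm (X t \<omega> - Xn n t \<omega>))\<^sup>2)
        \<le> ennreal (2 / (a t)\<^sup>2) * D \<omega>
          + (\<Sum>k. ennreal (2 / (a t)\<^sup>2) * (if k < n then 0 else ennreal ((noise_integral k t \<omega>)\<^sup>2)))"
        using elim(1) t S unfolding D_def by blast
      also have "\<dots> \<le> ennreal c * D \<omega> + (\<Sum>k. Y k \<omega>)"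
        unfolding Y_def using c(2)[OF t] elim(2) t
        by (intro add_mono mult_mono suminf_le) (auto intro: ennreal_leI)
      finally show "ennreal ((norm (X t \<omega> - Xn n t \<omega>))\<^sup>2) \<le> ennreal c * D \<omega> + (\<Sum>k. Y k \<omega>)" .
    qed
  qed
  then have "(\<integral>\<^sup>+\<omega>. (SUP t\<in>S. ennreal ((norm (X t \<omega> - Xn n t \<omega>))\<^sup>2)) \<partial>N)
    \<le> (\<integral>\<^sup>+\<omega>. ennreal c * D \<omega> + (\<Sum>k. Y k \<omega>) \<partial>N)"
    by (rule nn_integral_mono_AE)
  also have "\<dots> = ennreal c * (\<integral>\<^sup>+\<omega>. D \<omega> \<partial>N) + (\<Sum>k. \<integral>\<^sup>+\<omega>. Y k \<omega> \<partial>N)"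
    using D Y by (simp add: nn_integral_add nn_integral_cmult nn_integral_suminf)
  \<comment> \<open>Only indices \<open>k \<ge> n\<close> contribute, which is what
    \<open>tail n k\<close> records.\<close>
  also have "(\<Sum>k. \<integral>\<^sup>+\<omega>. Y k \<omega> \<partial>N) \<le> (\<Sum>k. ennreal (c * d * tail n k))"
  proof (intro suminf_le)
    fix k
    have "(\<integral>\<^sup>+\<omega>. Y k \<omega> \<partial>N) = ennreal c * (if k < n then 0 else (\<integral>\<^sup>+\<omega>. Z k \<omega> \<partial>N))"
      unfolding Y_def using Z(1) by (simp add: nn_integral_cmult)
    also have "\<dots> \<le> ennreal c * ennreal (tail n k * d)"
      using Z(2)[of k] by (intro mult_left_mono) (auto simp: tail_def)
    also have "\<dots> = ennreal (c * d * tail n k)"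
      using c(1) d tail_nonneg[of n k] by (simp add: ennreal_mult[symmetric] mult_ac)
    finally show "(\<integral>\<^sup>+\<omega>. Y k \<omega> \<partial>N) \<le> ennreal (c * d * tail n k)" .
  qed auto
  also have "(\<Sum>k. ennreal (c * d * tail n k)) = ennreal (c * d * op_trace (\<lambda>x. Q x - truncated_op lam e n x))"
    using c(1) d by (intro suminf_tail_ennreal) simp
  finally show ?thesis
    unfolding D_def nn_integral_completion by (simp add: add_left_mono)
qed

lemma mean_square_error:
  assumes t: "t \<in> {0..T}"
  shows "(\<integral>\<^sup>+\<omega>. ennreal ((norm (X t \<omega> - Xn n t \<omega>))\<^sup>2) \<partial>M)
    \<le> ennreal (2 / (a t)\<^sup>2) * (\<integral>\<^sup>+\<omega>. ennreal ((norm (X0 \<omega> - X0n n \<omega>))\<^sup>2) \<partial>M)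
      + ennreal (2 * (1 - 1 / (a t)\<^sup>2) * op_trace (\<lambda>x. Q x - truncated_op lam e n x))"
proof -
  have "\<exists>Z. Z \<in> borel_measurable N \<and> (\<integral>\<^sup>+\<omega>. Z \<omega> \<partial>N) \<le> ennreal (lam k * ((a t)\<^sup>2 - 1)) \<and>
    (AE \<omega> in N. ennreal ((noise_integral k t \<omega>)\<^sup>2) \<le> Z \<omega>)" for k
  proof -
    interpret noise: scalar_noise N F T "Q (e k) \<bullet> e k" "\<lambda>t \<omega>. W t \<omega> \<bullet> e k" by (rule scalar_noise_inner)
    obtain Z where "Z \<in> borel_measurable N" "(\<integral>\<^sup>+\<omega>. Z \<omega> \<partial>N) \<le> ennreal (Q (e k) \<bullet> e k * ((a t)\<^sup>2 - (a 0)\<^sup>2))"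
      "AE \<omega> in N. ennreal ((noise_integral k t \<omega>)\<^sup>2) \<le> Z \<omega>"
      by (rule noise.wiener_integral_bound[where A="\<lambda>t. (a t)\<^sup>2", OF T_pos g_deriv g'_cont a_square_deriv t])
    then show ?thesis unfolding Q_e a_0 one_power2 by blast
  qed
  then have "\<exists>Z. \<forall>k. Z k \<in> borel_measurable N \<and> (\<integral>\<^sup>+\<omega>. Z k \<omega> \<partial>N) \<le> ennreal (lam k * ((a t)\<^sup>2 - 1)) \<and>
    (AE \<omega> in N. ennreal ((noise_integral k t \<omega>)\<^sup>2) \<le> Z k \<omega>)"
    by (intro choice allI)
  then obtain Z where Z: "\<And>k. Z k \<in> borel_measurable N" "\<And>k. (\<integral>\<^sup>+\<omega>. Z k \<omega> \<partial>N) \<le> ennreal (lam k * ((a t)\<^sup>2 - 1))"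
    "\<And>k. AE \<omega> in N. ennreal ((noise_integral k t \<omega>)\<^sup>2) \<le> Z k \<omega>" by blast
  have a1: "1 \<le> (a t)\<^sup>2" using a_ge_1[OF t] by simp
  then have eq: "2 / (a t)\<^sup>2 * ((a t)\<^sup>2 - 1) = 2 * (1 - 1 / (a t)\<^sup>2)"
    using a_pos[of t] by (simp add: field_simps)
  show ?thesis
    using truncation_error[of "{t}" "2 / (a t)\<^sup>2" "(a t)\<^sup>2 - 1" Z n] Z t a1 unfolding eq by simp
qed

lemma maximal_error:
  "(\<integral>\<^sup>+\<omega>. (SUP t\<in>{0..T}. ennreal ((norm (X t \<omega> - Xn n t \<omega>))\<^sup>2)) \<partial>M)
    \<le> 2 * (\<integral>\<^sup>+\<omega>. ennreal ((norm (X0 \<omega> - X0n n \<omega>))\<^sup>2) \<partial>M)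
      + ennreal (8 * ((a T)\<^sup>2 - 1) * op_trace (\<lambda>x. Q x - truncated_op lam e n x))"
proof -
  have "\<exists>Z. Z \<in> borel_measurable N \<and> (\<integral>\<^sup>+\<omega>. Z \<omega> \<partial>N) \<le> ennreal (4 * lam k * ((a T)\<^sup>2 - 1)) \<and>
    (AE \<omega> in N. \<forall>t\<in>{0..T}. ennreal ((noise_integral k t \<omega>)\<^sup>2) \<le> Z \<omega>)" for k
  proof -
    interpret noise: scalar_noise N F T "Q (e k) \<bullet> e k" "\<lambda>t \<omega>. W t \<omega> \<bullet> e k" by (rule scalar_noise_inner)
    obtain Z where "Z \<in> borel_measurable N" "(\<integral>\<^sup>+\<omega>. Z \<omega> \<partial>N) \<le> ennreal (4 * (Q (e k) \<bullet> e k) * ((a T)\<^sup>2 - (a 0)\<^sup>2))"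
      "AE \<omega> in N. \<forall>t\<in>{0..T}. ennreal ((noise_integral k t \<omega>)\<^sup>2) \<le> Z \<omega>"
      by (rule noise.wiener_integral_sup_bound[where A="\<lambda>t. (a t)\<^sup>2", OF T_pos g_deriv g'_cont a_square_deriv])
    then show ?thesis unfolding Q_e a_0 one_power2 by blast
  qed
  then have "\<exists>Z. \<forall>k. Z k \<in> borel_measurable N \<and> (\<integral>\<^sup>+\<omega>. Z k \<omega> \<partial>N) \<le> ennreal (4 * lam k * ((a T)\<^sup>2 - 1)) \<and>
    (AE \<omega> in N. \<forall>t\<in>{0..T}. ennreal ((noise_integral k t \<omega>)\<^sup>2) \<le> Z k \<omega>)"
    by (intro choice allI)
  then obtain Z where Z: "\<And>k. Z k \<in> borel_measurable N" "\<And>k. (\<integral>\<^sup>+\<omega>. Z k \<omega> \<partial>N) \<le> ennreal (4 * lam k * ((a T)\<^sup>2 - 1))"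
    "\<And>k. AE \<omega> in N. \<forall>t\<in>{0..T}. ennreal ((noise_integral k t \<omega>)\<^sup>2) \<le> Z k \<omega>" by blast
  \<comment> \<open>A constant independent of \<open>t\<close> is needed to pull the factor out of
    the supremum; \<open>a t \<ge> 1\<close> provides it.\<close>
  have le: "2 / (a t)\<^sup>2 \<le> 2" if "t \<in> {0..T}" for t
    using a_ge_1[OF that] by (simp add: divide_le_eq one_le_power)
  have "1 \<le> (a T)\<^sup>2" using a_ge_1[of T] T_pos by simp
  then show ?thesis
    using truncation_error[of "{0..T}" 2 "4 * ((a T)\<^sup>2 - 1)" Z n] Z le by (simp add: mult_ac)
qed

text \<open>By Parseval the remainder of the expansion is never longer than \<open>X0\<close>
  itself, which gives the integrable majorant.\<close>

lemma X0_diff_tendsto_0: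
  assumes "(\<integral>\<^sup>+\<omega>. ennreal ((norm (X0 \<omega>))\<^sup>2) \<partial>M) < \<infinity>"
  shows "(\<lambda>n. \<integral>\<^sup>+\<omega>. ennreal ((norm (X0 \<omega> - X0n n \<omega>))\<^sup>2) \<partial>M) \<longlonglongrightarrow> 0"
proof -
  have "(\<lambda>n. \<integral>\<^sup>+\<omega>. ennreal ((norm (X0 \<omega> - X0n n \<omega>))\<^sup>2) \<partial>M) \<longlonglongrightarrow> (\<integral>\<^sup>+\<omega>. 0 \<partial>M)"
  proof (rule nn_integral_dominated_convergence)
    show "(\<lambda>\<omega>. ennreal ((norm (X0 \<omega> - X0n n \<omega>))\<^sup>2)) \<in> borel_measurable M" for n
      by (rule X0_diff_measurable)
    show "(\<lambda>\<omega>. ennreal ((norm (X0 \<omega>))\<^sup>2)) \<in> borel_measurable M" using X0_measurable by measurable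
    have "(norm (X0 \<omega> - X0n n \<omega>))\<^sup>2 \<le> (norm (X0 \<omega>))\<^sup>2" for n \<omega>
      by (rule sums_le[OF _ parseval_sums parseval_sums]) (simp add: X0_diff_component)
    then show "AE \<omega> in M. ennreal ((norm (X0 \<omega> - X0n n \<omega>))\<^sup>2) \<le> ennreal ((norm (X0 \<omega>))\<^sup>2)" for n
      by (intro AE_I2 ennreal_leI)
    have "(\<lambda>n. ennreal ((norm (X0 \<omega> - X0n n \<omega>))\<^sup>2)) \<longlonglongrightarrow> ennreal ((norm (X0 \<omega> - X0 \<omega>))\<^sup>2)" for \<omega>
    proof -
      have "(\<lambda>n. X0n n \<omega>) \<longlonglongrightarrow> X0 \<omega>"
        using has_sum_imp_sums[OF expansion[of "X0 \<omega>"]] unfolding X0n sums_def .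
      then show ?thesis by (intro tendsto_ennrealI tendsto_intros)
    qed
    then show "AE \<omega> in M. (\<lambda>n. ennreal ((norm (X0 \<omega> - X0n n \<omega>))\<^sup>2)) \<longlonglongrightarrow> 0" by simp
  qed (use assms in simp_all)
  then show ?thesis by simp
qed

lemma maximal_error_tendsto_0:
  assumes "(\<integral>\<^sup>+\<omega>. ennreal ((norm (X0 \<omega>))\<^sup>2) \<partial>M) < \<infinity>"
  shows "(\<lambda>n. \<integral>\<^sup>+\<omega>. (SUP t\<in>{0..T}. ennreal ((norm (X t \<omega> - Xn n t \<omega>))\<^sup>2)) \<partial>M) \<longlonglongrightarrow> 0"
proof (rule tendsto_sandwich[OF _ _ tendsto_const])
  let ?B = "\<lambda>n. 2 * (\<integral>\<^sup>+\<omega>. ennreal ((norm (X0 \<omega> - X0n n \<omega>))\<^sup>2) \<partial>M)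
      + ennreal (8 * ((a T)\<^sup>2 - 1) * op_trace (\<lambda>x. Q x - truncated_op lam e n x))"
  have "?B \<longlonglongrightarrow> 2 * 0 + ennreal (8 * ((a T)\<^sup>2 - 1) * 0)"
    by (intro tendsto_add ennreal_tendsto_cmult tendsto_ennrealI tendsto_mult_left
        X0_diff_tendsto_0[OF assms] op_trace_tail_tendsto_0) simp
  then show "?B \<longlonglongrightarrow> 0" by simp
  show "\<forall>\<^sub>F n in sequentially. (\<integral>\<^sup>+\<omega>. (SUP t\<in>{0..T}. ennreal ((norm (X t \<omega> - Xn n t \<omega>))\<^sup>2)) \<partial>M) \<le> ?B n"
    using maximal_error by (intro always_eventually allI)
qed simp

end

theorem theorem3p2:
  fixes M :: "'w measure"
    and T :: real
    and \<alpha> :: "real \<Rightarrow> real"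
    and Q :: "'h::{real_inner, banach, second_countable_topology} \<Rightarrow> 'h"
    and e :: "nat \<Rightarrow> 'h"
    and lam :: "nat \<Rightarrow> real"
    and X0 :: "'w \<Rightarrow> 'h"
    and W :: "real \<Rightarrow> 'w \<Rightarrow> 'h"
    and \<beta> :: "nat \<Rightarrow> real \<Rightarrow> 'w \<Rightarrow> real"
    and X :: "real \<Rightarrow> 'w \<Rightarrow> 'h"
    and X0n :: "nat \<Rightarrow> 'w \<Rightarrow> 'h"
    and Xn :: "nat \<Rightarrow> real \<Rightarrow> 'w \<Rightarrow> 'h"
  assumes "prob_space M"
    and "0 < T"
    and "positive_C1_on T \<alpha>"
    and "trace_class Q"
    and "inj e" and "orthonormal_basis (range e)"
    and "\<And>k. Q (e k) = lam k *\<^sub>R e k"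
    and "X0 \<in> borel_measurable M"
    and "wiener_process M T Q W"
    and "independent_rvs M borel X0 (PiM {0..T} (\<lambda>_. borel)) (sample_path T W)"
    and "karhunen_loeve M T lam \<beta> e W"
    and "strong_solution M T \<alpha> W X0 X"
    and "\<And>n \<omega>. X0n n \<omega> = (\<Sum>k<n. (X0 \<omega> \<bullet> e k) *\<^sub>R e k)"
    and "\<And>n. strong_solution M T \<alpha> (kl_partial_sum lam \<beta> e n) (X0n n) (Xn n)"
  shows "(\<forall>n. \<forall>t\<in>{0..T}.
            (\<integral>\<^sup>+\<omega>. ennreal ((norm (X t \<omega> - Xn n t \<omega>))\<^sup>2) \<partial>M)
              \<le> ennreal (2 / (a_coeff \<alpha> t)\<^sup>2) * (\<integral>\<^sup>+\<omega>. ennreal ((norm (X0 \<omega> - X0n n \<omega>))\<^sup>2) \<partial>M)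
                + ennreal (2 * (1 - 1 / (a_coeff \<alpha> t)\<^sup>2) * op_trace (\<lambda>x. Q x - truncated_op lam e n x)))
       \<and> (\<forall>n. (\<integral>\<^sup>+\<omega>. (SUP t\<in>{0..T}. ennreal ((norm (X t \<omega> - Xn n t \<omega>))\<^sup>2)) \<partial>M)
              \<le> 2 * (\<integral>\<^sup>+\<omega>. ennreal ((norm (X0 \<omega> - X0n n \<omega>))\<^sup>2) \<partial>M)
                + ennreal (8 * ((a_coeff \<alpha> T)\<^sup>2 - 1) * op_trace (\<lambda>x. Q x - truncated_op lam e n x)))
       \<and> ((\<integral>\<^sup>+\<omega>. ennreal ((norm (X0 \<omega>))\<^sup>2) \<partial>M) < \<infinity> \<longrightarrow>
            (\<lambda>n. \<integral>\<^sup>+\<omega>. (SUP t\<in>{0..T}. ennreal ((norm (X t \<omega> - Xn n t \<omega>))\<^sup>2)) \<partial>M)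
              \<longlonglongrightarrow> 0)"
proof -
  obtain \<alpha>' where \<alpha>': "continuous_on {0..T} \<alpha>'"
      "\<And>t. t \<in> {0..T} \<Longrightarrow> (\<alpha> has_real_derivative \<alpha>' t) (at t within {0..T})"
    and pos: "\<And>t. t \<in> {0..T} \<Longrightarrow> 0 < \<alpha> t"
    using assms(3) unfolding positive_C1_on_def by blast
  have Q: "\<And>x. 0 \<le> Q x \<bullet> x"
    using assms(4) unfolding trace_class_def by blast
  have "truncation M T Q W X0 e lam \<alpha> \<alpha>' \<beta> X X0n Xn"
    by (intro truncation.intro wiener_start.intro wiener_start_axioms.intro trace_class_eigenbasis.intro
        trace_class_eigenbasis_axioms.intro eigenbasis.intro ou_coefficients.intro truncation_axioms.intro)
      (fact assms \<alpha>' pos Q)+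
  then interpret truncation M T Q W X0 e lam \<alpha> \<alpha>' \<beta> X X0n Xn .
  show ?thesis
    using mean_square_error maximal_error maximal_error_tendsto_0 by blast
qed

end
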